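(* Let $\mathring u:\mathbb R\to\mathbb R$ satisfy: (H1) $\mathring u$ is smooth; (H2) there are $\mathring c\in\mathbb R$, $\mathring L>0$ with $\mathring u\equiv\mathring c$ outside $[-\mathring L,\mathring L]$; (H3) $\min\mathring u'<0$ and this minimum is attained at a unique point $\mathring x$; (H4) $\mathring u'''(\mathring x)>0$. Let $t_0=1/\min\mathring u'<0$. For $\nu>0$ let $u^\nu$ be the (bounded, classical) solution of $\partial_tu^\nu=\nu\partial_x^2u^\nu-u^\nu\partial_xu^\nu$ with $u^\nu(t_0,\cdot)=\mathring u$, and let $u^0$ be the entropy solution of $\partial_tu^0=-u^0\partial_xu^0$ with $u^0(t_0,\cdot)=\mathring u$. Then there exists a constant $C(\mathring u)\ge1$ such that for all $\nu\in(0,1]$, $$C(\mathring u)^{-1}\nu^{1/4}\le\|u^\nu-u^0\|_{L^\infty([t_0,0)\times\mathbb R)}\le C(\mathring u)\,\nu^{1/4}.$$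
   Context: On $[t_0,0)\times\mathbb R$ the entropy solution $u^0$ is the smooth classical solution given by the method of characteristics; its first shock forms at time $0$. *)

theory Defs
  imports "HOL-Analysis.Analysis" "HOL-Probability.Essential_Supremum"
begin

text \<open>Functions on space-time are curried, with time as the first argument.\<close>

definition smooth :: "(real \<Rightarrow> real) \<Rightarrow> bool"
  where "smooth f \<longleftrightarrow> (\<forall>n x. (deriv ^^ n) f differentiable (at x))"

definition viscous_burgers_solution ::
    "real \<Rightarrow> real \<Rightarrow> (real \<Rightarrow> real) \<Rightarrow> (real \<Rightarrow> real \<Rightarrow> real) \<Rightarrow> bool"
  where "viscous_burgers_solution \<nu> t0 u_init u \<longleftrightarrow>
    continuous_on ({t0..} \<times> UNIV) (\<lambda>(t, x). u t x) \<and>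
    bounded ((\<lambda>(t, x). u t x) ` ({t0..} \<times> UNIV)) \<and>
    (\<forall>x. u t0 x = u_init x) \<and>
    (\<exists>u\<^sub>t u\<^sub>x u\<^sub>x\<^sub>x.
      continuous_on ({t0<..} \<times> UNIV) (\<lambda>(t, x). u\<^sub>t t x) \<and>
      continuous_on ({t0<..} \<times> UNIV) (\<lambda>(t, x). u\<^sub>x t x) \<and>
      continuous_on ({t0<..} \<times> UNIV) (\<lambda>(t, x). u\<^sub>x\<^sub>x t x) \<and>
      (\<forall>t>t0. \<forall>x.
        ((\<lambda>s. u s x) has_real_derivative u\<^sub>t t x) (at t) \<and>
        (u t has_real_derivative u\<^sub>x t x) (at x) \<and>
        (u\<^sub>x t has_real_derivative u\<^sub>x\<^sub>x t x) (at x) \<and>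
        u\<^sub>t t x = \<nu> * u\<^sub>x\<^sub>x t x - u t x * u\<^sub>x t x))"

text \<open>
  Nonnegative compactly supported \<open>C\<^sup>1\<close> functions on the whole plane, together with their
  partial derivatives. They need not vanish at the initial time.
\<close>

definition test_function ::
    "(real \<Rightarrow> real \<Rightarrow> real) \<Rightarrow> (real \<Rightarrow> real \<Rightarrow> real) \<Rightarrow> (real \<Rightarrow> real \<Rightarrow> real) \<Rightarrow> bool"
  where "test_function \<phi> \<phi>\<^sub>t \<phi>\<^sub>x \<longleftrightarrow>
    (\<forall>t x. \<phi> t x \<ge> 0) \<and>
    (\<exists>K. compact K \<and> (\<forall>t x. (t, x) \<notin> K \<longrightarrow> \<phi> t x = 0)) \<and>
    (\<forall>t x. ((\<lambda>s. \<phi> s x) has_real_derivative \<phi>\<^sub>t t x) (at t) \<and>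
           (\<phi> t has_real_derivative \<phi>\<^sub>x t x) (at x)) \<and>
    continuous_on UNIV (\<lambda>(t, x). \<phi>\<^sub>t t x) \<and>
    continuous_on UNIV (\<lambda>(t, x). \<phi>\<^sub>x t x)"

text \<open>Entropy--entropy flux pairs for the flux \<open>w\<^sup>2 / 2\<close>.\<close>

definition entropy_pair :: "(real \<Rightarrow> real) \<Rightarrow> (real \<Rightarrow> real) \<Rightarrow> bool"
  where "entropy_pair \<eta> q \<longleftrightarrow>
    smooth \<eta> \<and> convex_on UNIV \<eta> \<and> (\<forall>w. (q has_real_derivative w * deriv \<eta> w) (at w))"

text \<open>
  Weak form of \<open>\<partial>\<^sub>t \<eta>(u) + \<partial>\<^sub>x q(u) \<le> 0\<close> for every entropy pair; the single integral encodes the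
  initial condition. The pairs \<open>\<eta>(w) = w\<close> and \<open>\<eta>(w) = -w\<close> give the weak form of the equation.
  Such a \<open>u\<close> is determined only up to null sets.
\<close>

definition burgers_entropy_solution ::
    "real \<Rightarrow> (real \<Rightarrow> real) \<Rightarrow> (real \<Rightarrow> real \<Rightarrow> real) \<Rightarrow> bool"
  where "burgers_entropy_solution t0 u_init u \<longleftrightarrow>
    (\<lambda>(t, x). u t x) \<in> borel_measurable (lebesgue_on ({t0..} \<times> UNIV)) \<and>
    (\<exists>M. AE (t, x) in lebesgue_on ({t0..} \<times> UNIV). \<bar>u t x\<bar> \<le> M) \<and>
    (\<forall>\<eta> q \<phi> \<phi>\<^sub>t \<phi>\<^sub>x. entropy_pair \<eta> q \<longrightarrow> test_function \<phi> \<phi>\<^sub>t \<phi>\<^sub>x \<longrightarrow>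
      (LINT (t, x)|lebesgue_on ({t0..} \<times> UNIV). \<eta> (u t x) * \<phi>\<^sub>t t x + q (u t x) * \<phi>\<^sub>x t x)
      + (LINT x|lebesgue. \<eta> (u_init x) * \<phi> t0 x) \<ge> 0)"

definition Linfty_norm :: "(real \<times> real) set \<Rightarrow> (real \<Rightarrow> real \<Rightarrow> real) \<Rightarrow> ereal"
  where "Linfty_norm S f = esssup (lebesgue_on S) (\<lambda>(t, x). ereal \<bar>f t x\<bar>)"

end

theory Submission
  imports Defs
begin

text \<open>
  Before the shock, characteristics give the classical solution \<open>v\<close>, with \<open>v\<^sub>x \<ge> 1 / t\<close>,
  \<open>\<bar>v\<^sub>x\<^sub>x\<bar> \<le> C \<bar>t\<bar>\<^bsup>-5/2\<^esup>\<close> and \<open>\<bar>(v - f x0) v\<^sub>x\<bar> \<le> C \<bar>t\<bar>\<^bsup>-1/2\<^esup>\<close>. The last two are where the cubic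
  nondegeneracy at \<open>x0\<close> enters.

  Upper bound: the maximum principle for \<open>u\<^sup>\<nu> - v\<close> gives \<open>\<bar>u\<^sup>\<nu> - v\<bar> \<le> C \<nu> \<bar>t\<bar>\<^bsup>-3/2\<^esup>\<close>, which is of
  order \<open>\<nu>\<^bsup>1/4\<^esup>\<close> up to time \<open>\<tau> = t0 \<nu>\<^bsup>1/2\<^esup>\<close>. On \<open>[\<tau>, 0)\<close> both functions stay within \<open>O(\<nu>\<^bsup>1/4\<^esup>)\<close> of the
  profile \<open>v(\<tau>, \<cdot>)\<close> transported rigidly with speed \<open>f x0\<close>.

  Lower bound: a maximum principle for \<open>u\<^sup>\<nu>(t,x) - u\<^sup>\<nu>(t,y)\<close> on the strip \<open>0 \<le> y - x \<le> \<nu>\<^bsup>3/4\<^esup>\<close>, whose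
  outer edge is controlled by the upper bound, yields \<open>u\<^sup>\<nu>(t,x) - u\<^sup>\<nu>(t,y) \<le> C \<nu>\<^bsup>-1/2\<^esup> (y - x)\<close>, whereas
  \<open>v\<close> drops like a cube root as \<open>t\<close> tends to \<open>0\<close>. The two are incompatible at distance
  \<open>\<nu>\<^bsup>3/4\<^esup>\<close> times a small constant, up to an error of order \<open>\<nu>\<^bsup>1/4\<^esup>\<close>.

  An entropy solution equals \<open>v\<close> almost everywhere before the shock by the relative entropy
  \<open>(u - v)\<^sup>2 / 2\<close>. The constant entropy pairs \<open>(1, 0)\<close> and \<open>(0, \<plusminus>1)\<close> supply the integration by
  parts needed for the terms that involve \<open>v\<close> alone.
\<close>

section \<open>Maximum principle\<close>

lemma second_derivative_nonpos_at_max: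
  fixes g g' :: "real \<Rightarrow> real"
  assumes g: "\<And>x. (g has_real_derivative g' x) (at x)"
    and g': "(g' has_real_derivative D) (at x)"
    and max: "e > 0" "\<And>y. \<bar>y - x\<bar> < e \<Longrightarrow> g y \<le> g x"
  shows "g' x = 0" "D \<le> 0"
proof -
  show z: "g' x = 0"
    by (rule DERIV_local_max[OF g max(1)]) (use max(2) in \<open>auto simp: abs_minus_commute\<close>)
  show "D \<le> 0"
  proof (rule ccontr)
    assume "\<not> D \<le> 0"
    then obtain d where d: "d > 0" "\<And>h. 0 < h \<Longrightarrow> h < d \<Longrightarrow> g' x < g' (x + h)"
      using DERIV_pos_inc_right[OF g'] by (auto simp: not_le)
    define h where "h = min d e / 2"
    have h: "0 < h" "h < d" "h < e" using d(1) max(1) by (auto simp: h_def min_def)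
    obtain \<xi> where \<xi>: "x < \<xi>" "\<xi> < x + h" "g (x + h) - g x = (x + h - x) * g' \<xi>"
      using MVT2[of x "x + h" g g'] g h(1) by auto
    have "g' \<xi> > 0" using d(2)[of "\<xi> - x"] \<xi> h z by auto
    then have "g (x + h) > g x" using \<xi>(3) h(1) by (simp add: algebra_simps)
    then show False using max(2)[of "x + h"] h by auto
  qed
qed

text \<open>Only earlier times are compared, because the maximum over a closed time interval may sit
  at its right end.\<close>

lemma left_derivative_nonneg_at_max:
  fixes g :: "real \<Rightarrow> real"
  assumes "(g has_real_derivative D) (at t)" and "t0 < t"
    and "\<And>s. t0 \<le> s \<Longrightarrow> s \<le> t \<Longrightarrow> g s \<le> g t"
  shows "D \<ge> 0"
proof (rule ccontr)
  assume "\<not> D \<ge> 0"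
  then obtain d where d: "d > 0" "\<And>h. 0 < h \<Longrightarrow> h < d \<Longrightarrow> g t < g (t - h)"
    using DERIV_neg_dec_left[OF assms(1)] by (auto simp: not_le)
  define h where "h = min d (t - t0) / 2"
  have h: "0 < h" "h < d" "h < t - t0" using d(1) assms(2) by (auto simp: h_def min_def)
  from d(2)[OF h(1,2)] assms(3)[of "t - h"] h show False by auto
qed

text \<open>\<open>ln (1 + x^2)\<close> is the penalty at infinity in the maximum principle: it is
  unbounded, so maxima exist on noncompact domains, yet its gradient and the upper bound of its
  second derivative stay controlled.\<close>

lemma ln_weight_bounds:
  fixes x :: real
  shows "\<bar>2 * x / (1 + x\<^sup>2)\<bar> \<le> 1" "(2 - 2 * x\<^sup>2) / (1 + x\<^sup>2)\<^sup>2 \<le> 2"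
proof -
  have p: "1 + x\<^sup>2 > 0" by (simp add: add_pos_nonneg)
  have "0 \<le> (\<bar>x\<bar> - 1)\<^sup>2" by simp
  then have "2 * \<bar>x\<bar> \<le> 1 + x\<^sup>2" by (simp add: power2_diff)
  then show "\<bar>2 * x / (1 + x\<^sup>2)\<bar> \<le> 1" using p by (simp add: abs_mult)
  have "2 * (1 + x\<^sup>2)\<^sup>2 - (2 - 2 * x\<^sup>2) = 6 * x\<^sup>2 + 2 * (x\<^sup>2)\<^sup>2"
    by (simp add: power2_eq_square algebra_simps)
  then have "2 - 2 * x\<^sup>2 \<le> 2 * (1 + x\<^sup>2)\<^sup>2"
    using zero_le_power2[of x] zero_le_power2[of "x\<^sup>2"] by linarith
  then show "(2 - 2 * x\<^sup>2) / (1 + x\<^sup>2)\<^sup>2 \<le> 2"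
    using p by (simp add: divide_simps)
qed

lemma ln_weight_derivs:
  fixes x :: real
  shows "((\<lambda>x. ln (1 + x\<^sup>2)) has_real_derivative 2 * x / (1 + x\<^sup>2)) (at x)"
    "((\<lambda>x. 2 * x / (1 + x\<^sup>2)) has_real_derivative (2 - 2 * x\<^sup>2) / (1 + x\<^sup>2)\<^sup>2) (at x)"
proof -
  have p: "1 + x\<^sup>2 > 0" by (simp add: add_pos_nonneg)
  show "((\<lambda>x. ln (1 + x\<^sup>2)) has_real_derivative 2 * x / (1 + x\<^sup>2)) (at x)"
    using p by (auto intro!: derivative_eq_intros simp: divide_simps)
  show "((\<lambda>x. 2 * x / (1 + x\<^sup>2)) has_real_derivative (2 - 2 * x\<^sup>2) / (1 + x\<^sup>2)\<^sup>2) (at x)"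
    using p by (auto intro!: derivative_eq_intros simp: divide_simps power2_eq_square algebra_simps)
qed

text \<open>The critical point conditions at a maximum survive the penalty up to an error
  proportional to \<epsilon>. \<open>E\<close> stands for a time weight at a frozen time.\<close>

lemma spatial_max_bounds:
  fixes h hx :: "real \<Rightarrow> real"
  assumes h: "\<And>x. (h has_real_derivative hx x) (at x)" "(hx has_real_derivative D) (at x)"
    and E: "E > 0" and \<epsilon>: "\<epsilon> > 0"
    and max: "e > 0" "\<And>x'. \<bar>x' - x\<bar> < e \<Longrightarrow>
        E * h x' - \<epsilon> * ln (1 + x'\<^sup>2) \<le> E * h x - \<epsilon> * ln (1 + x\<^sup>2)"
  shows "E * \<bar>hx x\<bar> \<le> \<epsilon>" "E * D \<le> 2 * \<epsilon>"
proof -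
  let ?g = "\<lambda>x. E * h x - \<epsilon> * ln (1 + x\<^sup>2)"
  let ?g' = "\<lambda>x. E * hx x - \<epsilon> * (2 * x / (1 + x\<^sup>2))"
  have 1: "(?g has_real_derivative ?g' x) (at x)" for x
    by (intro DERIV_diff DERIV_cmult h ln_weight_derivs)
  have 2: "(?g' has_real_derivative E * D - \<epsilon> * ((2 - 2 * x\<^sup>2) / (1 + x\<^sup>2)\<^sup>2)) (at x)"
    by (intro DERIV_diff DERIV_cmult h ln_weight_derivs)
  note * = second_derivative_nonpos_at_max[OF 1 2 max]
  have "E * \<bar>hx x\<bar> = \<bar>E * hx x\<bar>" using E by (simp add: abs_mult)
  also have "\<dots> = \<epsilon> * \<bar>2 * x / (1 + x\<^sup>2)\<bar>" using *(1) \<epsilon> by (simp add: abs_mult)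
  also have "\<dots> \<le> \<epsilon>" using ln_weight_bounds(1)[of x] \<epsilon> by (intro mult_left_le) auto
  finally show "E * \<bar>hx x\<bar> \<le> \<epsilon>" .
  have "\<epsilon> * ((2 - 2 * x\<^sup>2) / (1 + x\<^sup>2)\<^sup>2) \<le> \<epsilon> * 2"
    by (rule mult_left_mono[OF ln_weight_bounds(2)]) (use \<epsilon> in simp)
  then show "E * D \<le> 2 * \<epsilon>" using *(2) by linarith
qed

text \<open>Penalisation turns a positive value of \<open>F\<close> into an attained maximum, where
  the differential inequality fails. Two space variables let one statement serve both uses:
  comparison of functions of \<open>x\<close> (\<open>D\<close> the plane, \<open>y\<close> a dummy)
  and differences \<open>u t x - u t y\<close> on a strip. Lateral boundary values enter through the
  demand that points with \<open>F > 0\<close> be interior.\<close>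

lemma parabolic_max_principle:
  fixes F :: "real \<Rightarrow> real \<Rightarrow> real \<Rightarrow> real" and D :: "(real \<times> real) set"
  assumes D: "closed D"
    and cont: "continuous_on ({t0..T} \<times> D) (\<lambda>(t, x, y). F t x y)"
    and bdd: "\<And>t x y. t \<in> {t0..T} \<Longrightarrow> (x, y) \<in> D \<Longrightarrow> F t x y \<le> M"
    and init: "\<And>x y. (x, y) \<in> D \<Longrightarrow> F t0 x y \<le> 0"
    and nonneg: "\<nu> \<ge> 0" "B \<ge> 0" "c \<ge> 0"
    and pde: "\<And>t x y. t0 < t \<Longrightarrow> t \<le> T \<Longrightarrow> (x, y) \<in> D \<Longrightarrow> F t x y > 0 \<Longrightarrow>
      (x, y) \<in> interior D \<and> (\<exists>Ft Fx Fy Fxx Fyy.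
        ((\<lambda>s. F s x y) has_real_derivative Ft) (at t) \<and>
        (\<forall>x. ((\<lambda>x. F t x y) has_real_derivative Fx x) (at x)) \<and>
        (Fx has_real_derivative Fxx) (at x) \<and>
        (\<forall>y. ((\<lambda>y. F t x y) has_real_derivative Fy y) (at y)) \<and>
        (Fy has_real_derivative Fyy) (at y) \<and>
        Ft \<le> \<nu> * (Fxx + Fyy) + B * (\<bar>Fx x\<bar> + \<bar>Fy y\<bar>) + c * F t x y)"
    and pt: "t1 \<in> {t0..T}" "(x1, y1) \<in> D"
  shows "F t1 x1 y1 \<le> 0"
proof (rule ccontr)
  assume "\<not> F t1 x1 y1 \<le> 0"
  then have F1: "F t1 x1 y1 > 0" by simp
  \<comment> \<open>At the maximum the second derivatives cost at most
    \<open>4 * \<nu> * \<epsilon>\<close> and the gradients \<open>2 * B * \<epsilon>\<close>; the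
    extra 1 makes the final inequality contradictory. The weight \<open>E\<close> below cancels the
    term \<open>c * F\<close>.\<close>
  define \<kappa> where "\<kappa> = 4 * \<nu> + 2 * B + 1"
  define E where "E t = exp (- c * (t - t0))" for t
  have E: "E t > 0" "t \<ge> t0 \<Longrightarrow> E t \<le> 1" for t using nonneg by (auto simp: E_def)
  define P where "P t x y = ln (1 + x\<^sup>2) + ln (1 + y\<^sup>2) + \<kappa> * (t - t0)" for t x y :: real
  have lnn: "ln (1 + x\<^sup>2) \<ge> 0" for x :: real by simp
  have \<kappa>: "\<kappa> > 0" using nonneg by (simp add: \<kappa>_def)
  have P1: "P t1 x1 y1 \<ge> 0"
    using lnn \<kappa> pt by (auto simp: P_def intro!: add_nonneg_nonneg)
  define H1 where "H1 = E t1 * F t1 x1 y1"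
  have H1: "H1 > 0" using E F1 by (simp add: H1_def)
  \<comment> \<open>Small enough that the penalty takes at most half of the positive value at the
    given point.\<close>
  define \<epsilon> where "\<epsilon> = H1 / (2 * (P t1 x1 y1 + 1))"
  have \<epsilon>: "\<epsilon> > 0" using H1 P1 by (simp add: \<epsilon>_def)
  have "\<epsilon> * P t1 x1 y1 \<le> \<epsilon> * (P t1 x1 y1 + 1)" using \<epsilon> by simp
  also have "\<dots> = H1 / 2" using P1 by (simp add: \<epsilon>_def divide_simps)
  also have "\<dots> < H1" using H1 by simp
  finally have \<epsilon>1: "\<epsilon> * P t1 x1 y1 < H1" .
  define G where "G t x y = E t * F t x y - \<epsilon> * P t x y" for t x y
  have G1: "G t1 x1 y1 > 0" using \<epsilon>1 by (simp add: G_def H1_def)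
  have EF: "E t * F t x y \<le> \<bar>M\<bar>" if "t \<in> {t0..T}" "(x, y) \<in> D" for t x y
  proof -
    have "E t * F t x y \<le> E t * \<bar>M\<bar>" using bdd[OF that] E(1)[of t] by (intro mult_left_mono) auto
    also have "\<dots> \<le> 1 * \<bar>M\<bar>" using E(2)[of t] that by (intro mult_right_mono) auto
    finally show ?thesis by simp
  qed
  \<comment> \<open>Where \<open>G\<close> is positive, each penalty term is below the bound on
    \<open>F\<close>, which confines both space variables to \<open>{-R..R}\<close>.\<close>
  define R where "R = exp (\<bar>M\<bar> / \<epsilon>) + 1"
  have far: "z \<in> {-R..R}" if "\<epsilon> * ln (1 + z\<^sup>2) < \<bar>M\<bar>" for z
  proof -
    have "ln (1 + z\<^sup>2) < \<bar>M\<bar> / \<epsilon>" using that \<epsilon> by (simp add: field_simps)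
    moreover have "1 + z\<^sup>2 > 0" by (simp add: add_pos_nonneg)
    ultimately have "1 + z\<^sup>2 < exp (\<bar>M\<bar> / \<epsilon>)" by (metis exp_less_mono exp_ln)
    moreover have "\<bar>z\<bar> \<le> 1 + z\<^sup>2"
    proof -
      have "0 \<le> (\<bar>z\<bar> - 1)\<^sup>2" by simp
      then have "2 * \<bar>z\<bar> \<le> 1 + z\<^sup>2" by (simp add: power2_diff)
      then show ?thesis by linarith
    qed
    ultimately show ?thesis by (auto simp: R_def)
  qed
  define K where "K = {t0..T} \<times> (D \<inter> ({-R..R} \<times> {-R..R}))"
  have inK: "(t, x, y) \<in> K" if "t \<in> {t0..T}" "(x, y) \<in> D" "G t x y > 0" for t x y
  proof -
    have "\<epsilon> * P t x y < \<bar>M\<bar>" using that EF[OF that(1,2)] by (simp add: G_def)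
    moreover have "\<epsilon> * (\<kappa> * (t - t0)) \<ge> 0" using \<epsilon> \<kappa> that by simp
    moreover have "\<epsilon> * ln (1 + x\<^sup>2) \<ge> 0" "\<epsilon> * ln (1 + y\<^sup>2) \<ge> 0" using \<epsilon> lnn by auto
    ultimately have "\<epsilon> * ln (1 + x\<^sup>2) < \<bar>M\<bar>" "\<epsilon> * ln (1 + y\<^sup>2) < \<bar>M\<bar>"
      by (auto simp: P_def distrib_left)
    then show ?thesis using far that by (auto simp: K_def)
  qed
  have "compact K" unfolding K_def
    by (intro compact_Times compact_Icc closed_Int_compact D)
  moreover have "K \<noteq> {}" using inK[OF pt G1] by auto
  moreover have "continuous_on K (\<lambda>(t, x, y). G t x y)"
  proof -
    have "continuous_on K (\<lambda>(t, x, y). F t x y)"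
      using cont by (rule continuous_on_subset) (auto simp: K_def)
    then have c: "continuous_on K (\<lambda>p. F (fst p) (fst (snd p)) (snd (snd p)))"
      by (simp add: case_prod_unfold)
    have nz: "1 + z\<^sup>2 \<noteq> 0" for z :: real using zero_le_power2[of z] by linarith
    show ?thesis unfolding G_def P_def E_def case_prod_unfold
      by (intro continuous_intros c) (auto simp: nz)
  qed
  ultimately obtain p where p: "p \<in> K" "\<forall>q\<in>K. (\<lambda>(t, x, y). G t x y) q \<le> (\<lambda>(t, x, y). G t x y) p"
    using continuous_attains_sup by blast
  obtain t x y where txy: "p = (t, x, y)" by (cases p)
  have K: "t \<in> {t0..T}" "(x, y) \<in> D" using p(1) by (auto simp: txy K_def)
  have pmax: "G t' x' y' \<le> G t x y" if "(t', x', y') \<in> K" for t' x' y'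
    using bspec[OF p(2) that] by (simp add: txy)
  have Gpos: "G t x y > 0" using G1 pmax[OF inK[OF pt G1]] by linarith
  \<comment> \<open>Outside the compact set \<open>K\<close> the function \<open>G\<close> is not
    positive, so the maximum over \<open>K\<close> is global.\<close>
  have Gmax: "G t' x' y' \<le> G t x y" if "t' \<in> {t0..T}" "(x', y') \<in> D" for t' x' y'
    using pmax[OF inK[OF that]] Gpos by linarith
  have Ppos: "\<epsilon> * P t x y \<ge> 0"
    using lnn \<kappa> K \<epsilon> by (auto simp: P_def intro!: mult_nonneg_nonneg add_nonneg_nonneg)
  have "E t * F t x y > 0" using Gpos Ppos by (simp add: G_def)
  then have Fpos: "F t x y > 0" using E(1)[of t] zero_less_mult_pos by blast
  have "t \<noteq> t0" using init[OF K(2)] Fpos by auto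
  then have tt: "t0 < t" "t \<le> T" using K(1) by auto
  obtain Ft Fx Fy Fxx Fyy where der: "(x, y) \<in> interior D"
        "((\<lambda>s. F s x y) has_real_derivative Ft) (at t)"
        "\<And>x. ((\<lambda>x. F t x y) has_real_derivative Fx x) (at x)"
        "(Fx has_real_derivative Fxx) (at x)"
        "\<And>y. ((\<lambda>y. F t x y) has_real_derivative Fy y) (at y)"
        "(Fy has_real_derivative Fyy) (at y)"
        and ineq: "Ft \<le> \<nu> * (Fxx + Fyy) + B * (\<bar>Fx x\<bar> + \<bar>Fy y\<bar>) + c * F t x y"
    using pde[OF tt K(2) Fpos] by metis
  obtain e where e: "e > 0" "ball (x, y) e \<subseteq> D"
    using der(1) by (auto simp: mem_interior)
  have Dx: "(x', y) \<in> D" if "\<bar>x' - x\<bar> < e" for x'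
    using e(2) that by (auto simp: subset_iff dist_Pair_Pair dist_real_def abs_minus_commute)
  have Dy: "(x, y') \<in> D" if "\<bar>y' - y\<bar> < e" for y'
    using e(2) that by (auto simp: subset_iff dist_Pair_Pair dist_real_def abs_minus_commute)
  have X: "E t * \<bar>Fx x\<bar> \<le> \<epsilon>" "E t * Fxx \<le> 2 * \<epsilon>"
  proof -
    have "E t * F t x' y - \<epsilon> * ln (1 + x'\<^sup>2) \<le> E t * F t x y - \<epsilon> * ln (1 + x\<^sup>2)" if "\<bar>x' - x\<bar> < e" for x'
      using Gmax[OF K(1) Dx[OF that]] by (simp add: G_def P_def distrib_left)
    from spatial_max_bounds[OF der(3,4) E(1) \<epsilon> e(1) this]
    show "E t * \<bar>Fx x\<bar> \<le> \<epsilon>" "E t * Fxx \<le> 2 * \<epsilon>" by auto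
  qed
  have Y: "E t * \<bar>Fy y\<bar> \<le> \<epsilon>" "E t * Fyy \<le> 2 * \<epsilon>"
  proof -
    have "E t * F t x y' - \<epsilon> * ln (1 + y'\<^sup>2) \<le> E t * F t x y - \<epsilon> * ln (1 + y\<^sup>2)" if "\<bar>y' - y\<bar> < e" for y'
      using Gmax[OF K(1) Dy[OF that]] by (simp add: G_def P_def distrib_left)
    from spatial_max_bounds[OF der(5,6) E(1) \<epsilon> e(1) this]
    show "E t * \<bar>Fy y\<bar> \<le> \<epsilon>" "E t * Fyy \<le> 2 * \<epsilon>" by auto
  qed
  have "((\<lambda>s. G s x y) has_real_derivative - c * E t * F t x y + E t * Ft - \<epsilon> * \<kappa>) (at t)"
    unfolding G_def P_def E_def
    by (auto intro!: derivative_eq_intros der(2) simp: algebra_simps)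
  then have "- c * E t * F t x y + E t * Ft - \<epsilon> * \<kappa> \<ge> 0"
    by (rule left_derivative_nonneg_at_max[OF _ tt(1)]) (use Gmax K tt in auto)
  moreover have "E t * Ft \<le> E t * (\<nu> * (Fxx + Fyy) + B * (\<bar>Fx x\<bar> + \<bar>Fy y\<bar>) + c * F t x y)"
    using ineq E(1)[of t] by (intro mult_left_mono) auto
  moreover have "\<nu> * (E t * Fxx + E t * Fyy) \<le> \<nu> * (4 * \<epsilon>)"
    using X Y nonneg by (intro mult_left_mono) auto
  moreover have "B * (E t * \<bar>Fx x\<bar> + E t * \<bar>Fy y\<bar>) \<le> B * (2 * \<epsilon>)"
    using X Y nonneg by (intro mult_left_mono) auto
  ultimately have "\<epsilon> * \<kappa> \<le> \<nu> * (4 * \<epsilon>) + B * (2 * \<epsilon>)"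
    by (simp add: algebra_simps)
  then show False using \<epsilon> by (simp add: \<kappa>_def algebra_simps)
qed

section \<open>Comparison for the viscous equation\<close>

lemma viscous_burgers_solutionE:
  assumes "viscous_burgers_solution \<nu> t0 f u"
  obtains M u\<^sub>t u\<^sub>x u\<^sub>x\<^sub>x where
    "continuous_on ({t0..} \<times> UNIV) (\<lambda>(t, x). u t x)"
    "\<And>t x. t \<ge> t0 \<Longrightarrow> \<bar>u t x\<bar> \<le> M" "M \<ge> 0" "\<And>x. u t0 x = f x"
    "\<And>t x. t > t0 \<Longrightarrow> ((\<lambda>s. u s x) has_real_derivative u\<^sub>t t x) (at t)"
    "\<And>t x. t > t0 \<Longrightarrow> (u t has_real_derivative u\<^sub>x t x) (at x)"
    "\<And>t x. t > t0 \<Longrightarrow> (u\<^sub>x t has_real_derivative u\<^sub>x\<^sub>x t x) (at x)"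
    "\<And>t x. t > t0 \<Longrightarrow> u\<^sub>t t x = \<nu> * u\<^sub>x\<^sub>x t x - u t x * u\<^sub>x t x"
proof -
  have "bounded ((\<lambda>(t, x). u t x) ` ({t0..} \<times> UNIV))"
    using assms by (simp add: viscous_burgers_solution_def)
  then obtain M where "\<And>z. z \<in> (\<lambda>(t, x). u t x) ` ({t0..} \<times> UNIV) \<Longrightarrow> norm z \<le> M"
    unfolding bounded_iff by blast
  then have M: "\<bar>u t x\<bar> \<le> M" if "t \<ge> t0" for t x
    using that by force
  have "M \<ge> 0" using M[of t0 0] by simp
  moreover obtain u\<^sub>t u\<^sub>x u\<^sub>x\<^sub>x where "\<forall>t>t0. \<forall>x.
        ((\<lambda>s. u s x) has_real_derivative u\<^sub>t t x) (at t) \<and>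
        (u t has_real_derivative u\<^sub>x t x) (at x) \<and>
        (u\<^sub>x t has_real_derivative u\<^sub>x\<^sub>x t x) (at x) \<and>
        u\<^sub>t t x = \<nu> * u\<^sub>x\<^sub>x t x - u t x * u\<^sub>x t x"
    using assms unfolding viscous_burgers_solution_def by blast
  moreover have "continuous_on ({t0..} \<times> UNIV) (\<lambda>(t, x). u t x)" "\<forall>x. u t0 x = f x"
    using assms unfolding viscous_burgers_solution_def by blast+
  ultimately show ?thesis using M by (intro that[of M u\<^sub>t u\<^sub>x u\<^sub>x\<^sub>x]) blast+
qed

lemma continuous_on_curried:
  assumes "continuous_on S (\<lambda>(t, x). f t x)" "continuous_on A g" "continuous_on A h"
    "\<And>z. z \<in> A \<Longrightarrow> (g z, h z) \<in> S"
  shows "continuous_on A (\<lambda>z. f (g z) (h z))"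
  using continuous_on_compose2[OF assms(1) continuous_on_Pair[OF assms(2,3)]] assms(4) by auto

text \<open>\<open>V\<close> is an approximate solution with residual at most \<open>r\<close>, and
  \<open>a\<close> is a supersolution of the ordinary differential equation
  \<open>a' = m * a + r\<close>. A lower bound on the slope of \<open>V\<close> suffices, since its
  slope multiplies a quantity that is positive wherever the maximum principle is tested. The sign
  \<sigma> yields both halves of the absolute value.\<close>

lemma viscous_burgers_comparison_one_sided:
  fixes a a' m r :: "real \<Rightarrow> real"
  assumes sol: "viscous_burgers_solution \<nu> t0 f u" and "\<nu> \<ge> 0" "t0 \<le> t1"
    and V_cont: "continuous_on ({t1..T} \<times> UNIV) (\<lambda>(t, x). V t x)"
    and V_bdd: "\<And>t x. t \<in> {t1..T} \<Longrightarrow> \<bar>V t x\<bar> \<le> N"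
    and V: "\<And>t x. t \<in> {t1<..T} \<Longrightarrow> ((\<lambda>s. V s x) has_real_derivative V\<^sub>t t x) (at t)"
      "\<And>t x. t \<in> {t1<..T} \<Longrightarrow> (V t has_real_derivative V\<^sub>x t x) (at x)"
      "\<And>t x. t \<in> {t1<..T} \<Longrightarrow> (V\<^sub>x t has_real_derivative V\<^sub>x\<^sub>x t x) (at x)"
      "\<And>t x. t \<in> {t1<..T} \<Longrightarrow> V\<^sub>x t x \<ge> - m t"
      "\<And>t x. t \<in> {t1<..T} \<Longrightarrow> \<bar>V\<^sub>t t x + V t x * V\<^sub>x t x - \<nu> * V\<^sub>x\<^sub>x t x\<bar> \<le> r t"
    and m: "\<And>t. t \<in> {t1<..T} \<Longrightarrow> m t \<le> c"
    and a: "continuous_on {t1..T} a" "\<And>t. t \<in> {t1..T} \<Longrightarrow> a t \<ge> 0"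
      "\<And>t. t \<in> {t1<..T} \<Longrightarrow> (a has_real_derivative a' t) (at t)"
      "\<And>t. t \<in> {t1<..T} \<Longrightarrow> m t * a t + r t \<le> a' t"
    and init: "\<And>x. \<bar>u t1 x - V t1 x\<bar> \<le> a t1"
    and t: "t \<in> {t1..T}" and \<sigma>: "\<sigma> = 1 \<or> \<sigma> = (-1::real)"
  shows "\<sigma> * (u t x - V t x) \<le> a t"
proof -
  obtain M u\<^sub>t u\<^sub>x u\<^sub>x\<^sub>x where u:
    "continuous_on ({t0..} \<times> UNIV) (\<lambda>(t, x). u t x)"
    "\<And>t x. t \<ge> t0 \<Longrightarrow> \<bar>u t x\<bar> \<le> M" "M \<ge> 0" "\<And>x. u t0 x = f x"
    "\<And>t x. t > t0 \<Longrightarrow> ((\<lambda>s. u s x) has_real_derivative u\<^sub>t t x) (at t)"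
    "\<And>t x. t > t0 \<Longrightarrow> (u t has_real_derivative u\<^sub>x t x) (at x)"
    "\<And>t x. t > t0 \<Longrightarrow> (u\<^sub>x t has_real_derivative u\<^sub>x\<^sub>x t x) (at x)"
    "\<And>t x. t > t0 \<Longrightarrow> u\<^sub>t t x = \<nu> * u\<^sub>x\<^sub>x t x - u t x * u\<^sub>x t x"
    by (rule viscous_burgers_solutionE[OF sol]) (rule that)
  define F where "F t x (y::real) = \<sigma> * (u t x - V t x) - a t" for t x y
  have "F t x 0 \<le> 0"
  proof (rule parabolic_max_principle[where F = F and D = UNIV and ?t0.0 = t1 and T = T and M = "M + N"
        and \<nu> = \<nu> and B = M and c = "max c 0"])
    show "continuous_on ({t1..T} \<times> UNIV) (\<lambda>(t, x, y). F t x y)"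
      unfolding F_def case_prod_unfold
      by (intro continuous_intros continuous_on_curried[OF u(1)] continuous_on_curried[OF V_cont]
          continuous_on_compose2[OF a(1)])
        (use \<open>t0 \<le> t1\<close> in auto)
    show "F t x y \<le> M + N" if "t \<in> {t1..T}" for t x y
      using u(2)[of t x] V_bdd[OF that, of x] a(2)[OF that] \<sigma> \<open>t0 \<le> t1\<close> that by (auto simp: F_def)
    show "F t1 x y \<le> 0" for x y using init[of x] \<sigma> by (auto simp: F_def)
    fix t x y assume t: "t1 < t" "t \<le> T" and F: "F t x y > 0"
    then have tI: "t \<in> {t1<..T}" and t0: "t > t0" using \<open>t0 \<le> t1\<close> by auto
    have pos: "\<sigma> * (u t x - V t x) = F t x y + a t" by (simp add: F_def)
    have *: "\<sigma> * (u\<^sub>t t x - V\<^sub>t t x) - a' t \<le> \<nu> * (\<sigma> * (u\<^sub>x\<^sub>x t x - V\<^sub>x\<^sub>x t x))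
        + M * \<bar>\<sigma> * (u\<^sub>x t x - V\<^sub>x t x)\<bar> + max c 0 * F t x y"
    proof -
      \<comment> \<open>The difference of the two equations is arranged so that the advection speed
        is the bounded \<open>u\<close>, while the slope of \<open>V\<close> appears only in the
        zeroth-order term. That term is then split with
        \<open>\<sigma> * (u t x - V t x) = F t x y + a t\<close>: the part with \<open>a\<close> is
        paid by \<open>a'\<close>, the part with \<open>F\<close> by the constant
        \<open>c\<close>.\<close>
      have "\<sigma> * (u\<^sub>t t x - V\<^sub>t t x) = \<nu> * (\<sigma> * (u\<^sub>x\<^sub>x t x - V\<^sub>x\<^sub>x t x))
          - u t x * (\<sigma> * (u\<^sub>x t x - V\<^sub>x t x))
          - \<sigma> * (V\<^sub>t t x + V t x * V\<^sub>x t x - \<nu> * V\<^sub>x\<^sub>x t x) - (\<sigma> * (u t x - V t x)) * V\<^sub>x t x"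
        by (simp add: u(8)[OF t0] algebra_simps)
      moreover have "- (u t x * (\<sigma> * (u\<^sub>x t x - V\<^sub>x t x))) \<le> M * \<bar>\<sigma> * (u\<^sub>x t x - V\<^sub>x t x)\<bar>"
      proof -
        have "- (u t x * (\<sigma> * (u\<^sub>x t x - V\<^sub>x t x))) \<le> \<bar>u t x\<bar> * \<bar>\<sigma> * (u\<^sub>x t x - V\<^sub>x t x)\<bar>"
          by (metis abs_ge_minus_self abs_mult)
        also have "\<dots> \<le> M * \<bar>\<sigma> * (u\<^sub>x t x - V\<^sub>x t x)\<bar>"
          using u(2)[of t x] t0 by (intro mult_right_mono) auto
        finally show ?thesis .
      qed
      moreover have "- (\<sigma> * (V\<^sub>t t x + V t x * V\<^sub>x t x - \<nu> * V\<^sub>x\<^sub>x t x)) \<le> r t"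
        using V(5)[OF tI, of x] \<sigma> by auto
      moreover have "- (F t x y + a t) * V\<^sub>x t x \<le> m t * a t + max c 0 * F t x y"
      proof -
        have "(F t x y + a t) * (- V\<^sub>x t x) \<le> (F t x y + a t) * m t"
          using V(4)[OF tI, of x] F a(2)[of t] t by (intro mult_left_mono) auto
        moreover have "m t * F t x y \<le> max c 0 * F t x y"
          using m[OF tI] F by (intro mult_right_mono) auto
        ultimately show ?thesis by (simp add: algebra_simps)
      qed
      ultimately show ?thesis using a(4)[OF tI] pos by (simp only: mult_minus_left)
    qed
    have "((\<lambda>s. F s x y) has_real_derivative \<sigma> * (u\<^sub>t t x - V\<^sub>t t x) - a' t) (at t)"
      unfolding F_def by (intro derivative_intros DERIV_cmult u(5)[OF t0] V(1)[OF tI] a(3)[OF tI])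
    moreover have "((\<lambda>x. F t x y) has_real_derivative \<sigma> * (u\<^sub>x t x - V\<^sub>x t x)) (at x)" for x
      unfolding F_def by (auto intro!: derivative_eq_intros u(6)[OF t0] V(2)[OF tI])
    moreover have "((\<lambda>x. \<sigma> * (u\<^sub>x t x - V\<^sub>x t x)) has_real_derivative
        \<sigma> * (u\<^sub>x\<^sub>x t x - V\<^sub>x\<^sub>x t x)) (at x)"
      by (auto intro!: derivative_eq_intros u(7)[OF t0] V(3)[OF tI])
    moreover have "((\<lambda>y. F t x y) has_real_derivative 0) (at y)" for y
      unfolding F_def by auto
    moreover have "((\<lambda>y. 0) has_real_derivative 0) (at y)" by simp
    ultimately show "(x, y) \<in> interior UNIV \<and> (\<exists>Ft Fx Fy Fxx Fyy.
        ((\<lambda>s. F s x y) has_real_derivative Ft) (at t) \<and>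
        (\<forall>x. ((\<lambda>x. F t x y) has_real_derivative Fx x) (at x)) \<and>
        (Fx has_real_derivative Fxx) (at x) \<and>
        (\<forall>y. ((\<lambda>y. F t x y) has_real_derivative Fy y) (at y)) \<and>
        (Fy has_real_derivative Fyy) (at y) \<and>
        Ft \<le> \<nu> * (Fxx + Fyy) + M * (\<bar>Fx x\<bar> + \<bar>Fy y\<bar>) + max c 0 * F t x y)"
      using *
      by (intro conjI exI[of _ "\<sigma> * (u\<^sub>t t x - V\<^sub>t t x) - a' t"] exI[of _ "\<lambda>x. \<sigma> * (u\<^sub>x t x - V\<^sub>x t x)"]
          exI[of _ "\<lambda>_. 0::real"] exI[of _ "\<sigma> * (u\<^sub>x\<^sub>x t x - V\<^sub>x\<^sub>x t x)"] exI[of _ "0::real"])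
        auto
  qed (use t u(3) \<open>\<nu> \<ge> 0\<close> in auto)
  then show ?thesis by (simp add: F_def)
qed

lemma viscous_burgers_comparison:
  fixes a a' m r :: "real \<Rightarrow> real"
  assumes "viscous_burgers_solution \<nu> t0 f u" and "\<nu> \<ge> 0" "t0 \<le> t1"
    and "continuous_on ({t1..T} \<times> UNIV) (\<lambda>(t, x). V t x)"
    and "\<And>t x. t \<in> {t1..T} \<Longrightarrow> \<bar>V t x\<bar> \<le> N"
    and "\<And>t x. t \<in> {t1<..T} \<Longrightarrow> ((\<lambda>s. V s x) has_real_derivative V\<^sub>t t x) (at t)"
      "\<And>t x. t \<in> {t1<..T} \<Longrightarrow> (V t has_real_derivative V\<^sub>x t x) (at x)"
      "\<And>t x. t \<in> {t1<..T} \<Longrightarrow> (V\<^sub>x t has_real_derivative V\<^sub>x\<^sub>x t x) (at x)"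
      "\<And>t x. t \<in> {t1<..T} \<Longrightarrow> V\<^sub>x t x \<ge> - m t"
      "\<And>t x. t \<in> {t1<..T} \<Longrightarrow> \<bar>V\<^sub>t t x + V t x * V\<^sub>x t x - \<nu> * V\<^sub>x\<^sub>x t x\<bar> \<le> r t"
    and "\<And>t. t \<in> {t1<..T} \<Longrightarrow> m t \<le> c"
    and "continuous_on {t1..T} a" "\<And>t. t \<in> {t1..T} \<Longrightarrow> a t \<ge> 0"
      "\<And>t. t \<in> {t1<..T} \<Longrightarrow> (a has_real_derivative a' t) (at t)"
      "\<And>t. t \<in> {t1<..T} \<Longrightarrow> m t * a t + r t \<le> a' t"
    and "\<And>x. \<bar>u t1 x - V t1 x\<bar> \<le> a t1"
    and "t \<in> {t1..T}"
  shows "\<bar>u t x - V t x\<bar> \<le> a t"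
proof -
  have "\<sigma> * (u t x - V t x) \<le> a t" if "\<sigma> = 1 \<or> \<sigma> = (-1::real)" for \<sigma>
    by (rule viscous_burgers_comparison_one_sided; (rule assms that)?)
  from this[of 1] this[of "-1"] show ?thesis by (simp add: abs_le_iff)
qed

text \<open>
  The barrier \<open>\<omega>(\<xi>) = 2\<nu>k(1 - exp(-k\<xi>))\<close> satisfies \<open>2\<nu>\<omega>'' + \<omega>\<omega>' \<le> 0\<close>, which makes
  \<open>u(t,x) - u(t,y) - \<omega>(y - x)\<close> a subsolution of a linear parabolic equation in \<open>(t,x,y)\<close>.
\<close>

lemma viscous_burgers_drop_bound:
  assumes sol: "viscous_burgers_solution \<nu> t0 f u" and "\<nu> > 0" "k > 0" "h > 0"
    and init: "\<And>x y. x \<le> y \<Longrightarrow> y \<le> x + h \<Longrightarrow> f x - f y \<le> 2 * \<nu> * k * (1 - exp (- k * (y - x)))"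
    and edge: "\<And>t x. t \<in> {t0..T} \<Longrightarrow> u t x - u t (x + h) \<le> 2 * \<nu> * k * (1 - exp (- k * h))"
    and t: "t \<in> {t0..T}" and xy: "x \<le> y" "y \<le> x + h"
  shows "u t x - u t y \<le> 2 * \<nu> * k\<^sup>2 * (y - x)"
proof -
  obtain M u\<^sub>t u\<^sub>x u\<^sub>x\<^sub>x where u:
    "continuous_on ({t0..} \<times> UNIV) (\<lambda>(t, x). u t x)"
    "\<And>t x. t \<ge> t0 \<Longrightarrow> \<bar>u t x\<bar> \<le> M" "M \<ge> 0" "\<And>x. u t0 x = f x"
    "\<And>t x. t > t0 \<Longrightarrow> ((\<lambda>s. u s x) has_real_derivative u\<^sub>t t x) (at t)"
    "\<And>t x. t > t0 \<Longrightarrow> (u t has_real_derivative u\<^sub>x t x) (at x)"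
    "\<And>t x. t > t0 \<Longrightarrow> (u\<^sub>x t has_real_derivative u\<^sub>x\<^sub>x t x) (at x)"
    "\<And>t x. t > t0 \<Longrightarrow> u\<^sub>t t x = \<nu> * u\<^sub>x\<^sub>x t x - u t x * u\<^sub>x t x"
    by (rule viscous_burgers_solutionE[OF sol]) (rule that)
  define w where "w z = 2 * \<nu> * k * (1 - exp (- k * z))" for z
  define w' where "w' z = 2 * \<nu> * k\<^sup>2 * exp (- k * z)" for z
  define w'' where "w'' z = - 2 * \<nu> * k ^ 3 * exp (- k * z)" for z
  define D where "D = {p :: real \<times> real. fst p \<le> snd p \<and> snd p \<le> fst p + h}"
  define F where "F t x y = u t x - u t y - w (y - x)" for t x y
  have w: "((\<lambda>z. w (y - z)) has_real_derivative - w' (y - x)) (at x)"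
    "((\<lambda>z. w' (y - z)) has_real_derivative - w'' (y - x)) (at x)"
    "((\<lambda>z. w (z - x)) has_real_derivative w' (y - x)) (at y)"
    "((\<lambda>z. w' (z - x)) has_real_derivative w'' (y - x)) (at y)" for x y
    unfolding w_def w'_def w''_def
    by (auto intro!: derivative_eq_intros simp: power2_eq_square power3_eq_cube)
  have wnn: "w z \<ge> 0" if "z \<ge> 0" for z
    using that \<open>\<nu> > 0\<close> \<open>k > 0\<close> by (auto simp: w_def intro!: mult_nonneg_nonneg)
  have "F t x y \<le> 0"
  proof (rule parabolic_max_principle[where F = F and D = D and ?t0.0 = t0 and T = T and M = "2 * M"
        and \<nu> = \<nu> and B = M and c = "2 * \<nu> * k\<^sup>2"])
    show "closed D" unfolding D_def
      by (intro closed_Collect_conj closed_Collect_le continuous_intros)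
    show "continuous_on ({t0..T} \<times> D) (\<lambda>(t, x, y). F t x y)"
      unfolding F_def case_prod_unfold w_def
      by (intro continuous_intros continuous_on_curried[OF u(1)]) auto
    show "F t x y \<le> 2 * M" if "t \<in> {t0..T}" "(x, y) \<in> D" for t x y
      using u(2)[of t x] u(2)[of t y] that wnn[of "y - x"] by (auto simp: F_def D_def)
    show "F t0 x y \<le> 0" if "(x, y) \<in> D" for x y
      using init[of x y] that by (auto simp: F_def u(4) w_def D_def)
    fix t x y assume t: "t0 < t" "t \<le> T" and xy: "(x, y) \<in> D" and F: "F t x y > 0"
    \<comment> \<open>On the diagonal \<open>F\<close> vanishes because \<open>w 0 = 0\<close>; on
      the outer edge it is nonpositive by \<open>edge\<close>. Positive values therefore occur only
      inside the strip.\<close>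
    have "x \<noteq> y" using F by (auto simp: F_def w_def)
    moreover have "y \<noteq> x + h" using F edge[of t x] t by (auto simp: F_def w_def)
    ultimately have xy': "x < y" "y < x + h" using xy by (auto simp: D_def)
    have int: "(x, y) \<in> interior D"
    proof (rule interiorI)
      show "open {p :: real \<times> real. fst p < snd p \<and> snd p < fst p + h}"
        by (intro open_Collect_conj open_Collect_less continuous_intros)
    qed (use xy' in \<open>auto simp: D_def\<close>)
    \<comment> \<open>Rewriting the advection terms through the gradient of \<open>F\<close> leaves
      \<open>(u t x - u t y) * w' (y - x)\<close>, that is \<open>(w + F) * w'\<close>. The
      \<open>w\<close> part combines with the viscous correction \<open>2 * \<nu> * w''\<close> into
      a negative square; the \<open>F\<close> part is a zeroth-order term with coefficient at most
      \<open>2 * \<nu> * k^2\<close>.\<close>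
    have *: "u\<^sub>t t x - u\<^sub>t t y \<le> \<nu> * ((u\<^sub>x\<^sub>x t x - w'' (y - x)) + (- u\<^sub>x\<^sub>x t y - w'' (y - x)))
        + M * (\<bar>u\<^sub>x t x + w' (y - x)\<bar> + \<bar>- u\<^sub>x t y - w' (y - x)\<bar>) + 2 * \<nu> * k\<^sup>2 * F t x y"
    proof -
      have *: "- (u t z * q) \<le> M * \<bar>q\<bar>" for q z
      proof -
        have "- (u t z * q) \<le> \<bar>u t z\<bar> * \<bar>q\<bar>" by (metis abs_ge_minus_self abs_mult)
        also have "\<dots> \<le> M * \<bar>q\<bar>" using u(2)[of t z] t by (intro mult_right_mono) auto
        finally show ?thesis .
      qed
      have "u\<^sub>t t x - u\<^sub>t t y = \<nu> * ((u\<^sub>x\<^sub>x t x - w'' (y - x)) + (- u\<^sub>x\<^sub>x t y - w'' (y - x)))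
          + - (u t x * (u\<^sub>x t x + w' (y - x))) + - (u t y * (- u\<^sub>x t y - w' (y - x)))
          + (2 * \<nu> * w'' (y - x) + w (y - x) * w' (y - x)) + F t x y * w' (y - x)"
        by (simp add: u(8)[OF t(1)] F_def algebra_simps)
      moreover have "2 * \<nu> * w'' (y - x) + w (y - x) * w' (y - x) = - (4 * \<nu>\<^sup>2 * k ^ 3 * (exp (- k * (y - x)))\<^sup>2)"
        by (simp add: w_def w'_def w''_def power2_eq_square power3_eq_cube algebra_simps)
      moreover have "0 \<le> 4 * \<nu>\<^sup>2 * k ^ 3 * (exp (- k * (y - x)))\<^sup>2" using \<open>k > 0\<close> by simp
      moreover have "F t x y * w' (y - x) \<le> 2 * \<nu> * k\<^sup>2 * F t x y"
        unfolding mult.commute[of _ "F t x y"]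
        using F xy' \<open>\<nu> > 0\<close> \<open>k > 0\<close> by (intro mult_left_mono) (auto simp: w'_def mult_left_le)
      moreover note *[of x "u\<^sub>x t x + w' (y - x)"] *[of y "- u\<^sub>x t y - w' (y - x)"]
      ultimately show ?thesis unfolding distrib_left[of M] by linarith
    qed
    have "((\<lambda>s. F s x y) has_real_derivative u\<^sub>t t x - u\<^sub>t t y) (at t)"
      unfolding F_def by (auto intro!: derivative_eq_intros u(5)[OF t(1)])
    moreover have "((\<lambda>x. F t x y) has_real_derivative u\<^sub>x t x + w' (y - x)) (at x)" for x
      unfolding F_def by (auto intro!: derivative_eq_intros u(6)[OF t(1)] w)
    moreover have "((\<lambda>x. u\<^sub>x t x + w' (y - x)) has_real_derivative u\<^sub>x\<^sub>x t x - w'' (y - x)) (at x)"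
      by (auto intro!: derivative_eq_intros u(7)[OF t(1)] w)
    moreover have "((\<lambda>y. F t x y) has_real_derivative - u\<^sub>x t y - w' (y - x)) (at y)" for y
      unfolding F_def by (auto intro!: derivative_eq_intros u(6)[OF t(1)] w)
    moreover have "((\<lambda>y. - u\<^sub>x t y - w' (y - x)) has_real_derivative - u\<^sub>x\<^sub>x t y - w'' (y - x)) (at y)"
      by (auto intro!: derivative_eq_intros u(7)[OF t(1)] w)
    ultimately show "(x, y) \<in> interior D \<and> (\<exists>Ft Fx Fy Fxx Fyy.
        ((\<lambda>s. F s x y) has_real_derivative Ft) (at t) \<and>
        (\<forall>x. ((\<lambda>x. F t x y) has_real_derivative Fx x) (at x)) \<and>
        (Fx has_real_derivative Fxx) (at x) \<and>
        (\<forall>y. ((\<lambda>y. F t x y) has_real_derivative Fy y) (at y)) \<and>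
        (Fy has_real_derivative Fyy) (at y) \<and>
        Ft \<le> \<nu> * (Fxx + Fyy) + M * (\<bar>Fx x\<bar> + \<bar>Fy y\<bar>) + 2 * \<nu> * k\<^sup>2 * F t x y)"
      using * int
      by (intro conjI exI[of _ "u\<^sub>t t x - u\<^sub>t t y"] exI[of _ "\<lambda>x. u\<^sub>x t x + w' (y - x)"]
          exI[of _ "\<lambda>y. - u\<^sub>x t y - w' (y - x)"] exI[of _ "u\<^sub>x\<^sub>x t x - w'' (y - x)"]
          exI[of _ "- u\<^sub>x\<^sub>x t y - w'' (y - x)"])
        auto
  qed (use t u(3) \<open>\<nu> > 0\<close> xy in \<open>auto simp: D_def\<close>)
  \<comment> \<open>The concave barrier lies below its tangent at 0, which turns the bound into a
    Lipschitz estimate.\<close>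
  moreover have "w (y - x) \<le> 2 * \<nu> * k * (k * (y - x))"
    unfolding w_def using exp_ge_add_one_self[of "- k * (y - x)"] \<open>\<nu> > 0\<close> \<open>k > 0\<close>
    by (intro mult_left_mono) auto
  ultimately show ?thesis by (simp add: F_def power2_eq_square algebra_simps)
qed

section \<open>Characteristics\<close>

lemma deriv_eq_0_outside:
  fixes g :: "real \<Rightarrow> real"
  assumes "\<And>x. x \<notin> {-L..L} \<Longrightarrow> g x = k" "x \<notin> {-L..L}"
  shows "deriv g x = 0"
proof -
  have "((\<lambda>_. k) has_real_derivative 0) (at x)" by simp
  then have "(g has_real_derivative 0) (at x)"
    by (rule has_field_derivative_transform_within_open[where S = "- {-L..L}"])
      (use assms in auto)
  then show ?thesis by (rule DERIV_imp_deriv)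
qed

lemma bounded_if_const_outside:
  fixes g :: "real \<Rightarrow> real"
  assumes "continuous_on UNIV g" "\<And>x. x \<notin> {-L..L} \<Longrightarrow> g x = k"
  shows "\<exists>B\<ge>1. \<forall>x. \<bar>g x\<bar> \<le> B"
proof -
  have "compact (g ` {-L..L})"
    by (intro compact_continuous_image continuous_on_subset[OF assms(1)]) auto
  then obtain B where B: "\<forall>z\<in>g ` {-L..L}. norm z \<le> B"
    using compact_imp_bounded bounded_iff by metis
  have "\<bar>g x\<bar> \<le> \<bar>B\<bar> + \<bar>k\<bar> + 1" for x
    using B assms(2)[of x] by (cases "x \<in> {-L..L}") force+
  then show ?thesis by (intro exI[of _ "\<bar>B\<bar> + \<bar>k\<bar> + 1"]) auto
qed

text \<open>The derivative bound handles short distances and the bound on \<open>g\<close> handles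
  long ones; the truncated form fits the distance \<open>m\<close> to the steepest point.\<close>

lemma abs_diff_le_min:
  fixes g g' :: "real \<Rightarrow> real"
  assumes "\<And>x. (g has_real_derivative g' x) (at x)" "\<And>x. \<bar>g' x\<bar> \<le> B'" "\<And>x. \<bar>g x\<bar> \<le> B"
  shows "\<bar>g y - g x\<bar> \<le> (B' + 2 * B) * min \<bar>y - x\<bar> 1"
proof -
  have B: "B \<ge> 0" "B' \<ge> 0" using assms(2,3)[of x] by auto
  have "\<bar>g y - g x\<bar> \<le> B' * \<bar>y - x\<bar>"
    using field_differentiable_bound[of UNIV g g' B' y x] assms by auto
  also have "\<dots> \<le> (B' + 2 * B) * \<bar>y - x\<bar>" using B by (intro mult_right_mono) auto
  finally have 1: "\<bar>g y - g x\<bar> \<le> (B' + 2 * B) * \<bar>y - x\<bar>" .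
  have 2: "\<bar>g y - g x\<bar> \<le> (B' + 2 * B) * 1" using assms(3)[of x] assms(3)[of y] B by simp
  from 1 2 show ?thesis by (auto simp: min_def)
qed

section \<open>Initial data and nondegeneracy at the point of steepest descent\<close>

locale burgers_data =
  fixes f :: "real \<Rightarrow> real" and c L x0 t0 :: real
  assumes f_smooth: "smooth f"
    and f_const: "\<And>x. x \<notin> {-L..L} \<Longrightarrow> f x = c"
    and f1_neg: "deriv f x0 < 0"
    and f1_min: "\<And>x. deriv f x0 \<le> deriv f x"
    and f1_unique: "\<And>x. deriv f x = deriv f x0 \<Longrightarrow> x = x0"
    and f3_pos: "(deriv ^^ 3) f x0 > 0"
    and t0_def: "t0 = 1 / deriv f x0"
begin

abbreviation "f1 \<equiv> deriv f"
abbreviation "f2 \<equiv> deriv f1"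
abbreviation "f3 \<equiv> deriv f2"

lemma f_derivs:
  "(f has_real_derivative f1 x) (at x)" "(f1 has_real_derivative f2 x) (at x)"
  "(f2 has_real_derivative f3 x) (at x)"
  "continuous_on UNIV f" "continuous_on UNIV f1" "continuous_on UNIV f2" "continuous_on UNIV f3"
proof -
  have d: "(deriv ^^ n) f differentiable (at x)" for n x
    using f_smooth by (simp add: smooth_def)
  have "f differentiable (at x)" "f1 differentiable (at x)" "f2 differentiable (at x)"
    "f3 differentiable (at x)" for x
    using d[of 0 x] d[of 1 x] d[of 2 x] d[of 3 x] by (simp_all add: numeral_2_eq_2 numeral_3_eq_3)
  then have h: "(f has_real_derivative f1 x) (at x)" "(f1 has_real_derivative f2 x) (at x)"
    "(f2 has_real_derivative f3 x) (at x)" "(f3 has_real_derivative deriv f3 x) (at x)" for x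
    by (simp_all add: DERIV_deriv_iff_real_differentiable)
  then show "(f has_real_derivative f1 x) (at x)" "(f1 has_real_derivative f2 x) (at x)"
    "(f2 has_real_derivative f3 x) (at x)" by auto
  show "continuous_on UNIV f" "continuous_on UNIV f1" "continuous_on UNIV f2" "continuous_on UNIV f3"
    using h by (auto intro!: continuous_at_imp_continuous_on DERIV_isCont)
qed

lemma f3_x0: "f3 x0 > 0"
  using f3_pos by (simp add: numeral_3_eq_3)

lemma t0_neg: "t0 < 0" and f1_x0: "f1 x0 = 1 / t0"
  using f1_neg by (auto simp: t0_def)

lemma f1_ge: "f1 y \<ge> 1 / t0"
  using f1_min[of y] f1_x0 by simp

lemma f1_far: "x \<notin> {-L..L} \<Longrightarrow> f1 x = 0"
  and f2_far: "x \<notin> {-L..L} \<Longrightarrow> f2 x = 0"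
  and f3_far: "x \<notin> {-L..L} \<Longrightarrow> f3 x = 0"
proof -
  show 1: "x \<notin> {-L..L} \<Longrightarrow> f1 x = 0" for x by (rule deriv_eq_0_outside[OF f_const])
  show 2: "x \<notin> {-L..L} \<Longrightarrow> f2 x = 0" for x by (rule deriv_eq_0_outside[OF 1])
  show "x \<notin> {-L..L} \<Longrightarrow> f3 x = 0" by (rule deriv_eq_0_outside[OF 2])
qed

lemma f2_x0: "f2 x0 = 0"
  using DERIV_local_min[OF f_derivs(2), of 1 x0] f1_min by auto

definition B0 where "B0 = (SOME B. B \<ge> 1 \<and> (\<forall>x. \<bar>f x\<bar> \<le> B))"
definition B1 where "B1 = (SOME B. B \<ge> 1 \<and> (\<forall>x. \<bar>f1 x\<bar> \<le> B))"
definition B2 where "B2 = (SOME B. B \<ge> 1 \<and> (\<forall>x. \<bar>f2 x\<bar> \<le> B))"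
definition B3 where "B3 = (SOME B. B \<ge> 1 \<and> (\<forall>x. \<bar>f3 x\<bar> \<le> B))"

lemma f_bounds:
  "B0 \<ge> 1" "B1 \<ge> 1" "B2 \<ge> 1" "B3 \<ge> 1"
  "\<bar>f x\<bar> \<le> B0" "\<bar>f1 x\<bar> \<le> B1" "\<bar>f2 x\<bar> \<le> B2" "\<bar>f3 x\<bar> \<le> B3"
proof -
  note * = someI_ex[OF bounded_if_const_outside[OF f_derivs(4) f_const, unfolded Bex_def]]
    someI_ex[OF bounded_if_const_outside[OF f_derivs(5) f1_far, unfolded Bex_def]]
    someI_ex[OF bounded_if_const_outside[OF f_derivs(6) f2_far, unfolded Bex_def]]
    someI_ex[OF bounded_if_const_outside[OF f_derivs(7) f3_far, unfolded Bex_def]]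
  show "B0 \<ge> 1" "B1 \<ge> 1" "B2 \<ge> 1" "B3 \<ge> 1"
    "\<bar>f x\<bar> \<le> B0" "\<bar>f1 x\<bar> \<le> B1" "\<bar>f2 x\<bar> \<le> B2" "\<bar>f3 x\<bar> \<le> B3"
    using * unfolding B0_def B1_def B2_def B3_def by blast+
qed

text \<open>Truncated because the excess of \<open>f1\<close> over its minimum grows quadratically
  near \<open>x0\<close> but stays bounded far away.\<close>

definition m where "m y = min \<bar>y - x0\<bar> 1"

lemma m_bounds: "0 \<le> m y" "m y \<le> 1" "(m y)\<^sup>2 \<le> 1" "(m y)\<^sup>2 \<le> (y - x0)\<^sup>2"
proof -
  show m: "0 \<le> m y" "m y \<le> 1" by (auto simp: m_def)
  then show "(m y)\<^sup>2 \<le> 1" by (simp add: power_le_one)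
  have "(m y)\<^sup>2 \<le> \<bar>y - x0\<bar>\<^sup>2" using m by (intro power_mono) (auto simp: m_def)
  then show "(m y)\<^sup>2 \<le> (y - x0)\<^sup>2" by simp
qed

lemma f_dev: "\<bar>f y - f x0\<bar> \<le> (B1 + 2 * B0) * m y"
  unfolding m_def by (rule abs_diff_le_min[OF f_derivs(1) f_bounds(6,5)])

lemma f2_dev: "\<bar>f2 y\<bar> \<le> (B3 + 2 * B2) * m y"
  using abs_diff_le_min[OF f_derivs(3) f_bounds(8,7), of y x0] by (simp add: f2_x0 m_def)

text \<open>Three regions: near \<open>x0\<close> the positive third derivative gives a parabola
  below \<open>f1\<close>; on the rest of \<open>{-L..L}\<close> compactness and uniqueness of the
  minimiser give a gap; outside, \<open>f1\<close> is 0, which exceeds the negative minimum.\<close>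

lemma f1_quadratic: "\<exists>q>0. \<forall>y. f1 y \<ge> 1 / t0 + q * (m y)\<^sup>2"
proof -
  define q where "q = f3 x0 / 4"
  have q: "q > 0" using f3_x0 by (simp add: q_def)
  have "isCont f3 x0" using f_derivs(7) by (simp add: continuous_on_eq_continuous_at)
  then obtain r where r: "r > 0" "\<And>y. \<bar>y - x0\<bar> < r \<Longrightarrow> \<bar>f3 y - f3 x0\<bar> < 2 * q"
    using q unfolding continuous_at_eps_delta by (metis dist_real_def mult_pos_pos zero_less_numeral)
  have near: "f1 y - f1 x0 \<ge> q * (y - x0)\<^sup>2" if y: "\<bar>y - x0\<bar> < r" for y
  proof -
    \<comment> \<open>Since \<open>f3 > 2 * q\<close> near \<open>x0\<close>, \<open>f1\<close>
      minus this parabola is still convex there. Its derivative vanishes at \<open>x0\<close>, so it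
      stays above its value at \<open>x0\<close>.\<close>
    define g where "g y = f1 y - q * (y - x0)\<^sup>2" for y
    have "(f2 x0 - 2 * q * (x0 - x0)) * (y - x0) \<le> g y - g x0"
    proof (rule f''_imp_f'[where C = "{x0 - r<..<x0 + r}" and f = g and f' = "\<lambda>y. f2 y - 2 * q * (y - x0)"
          and f'' = "\<lambda>y. f3 y - 2 * q"])
      show "DERIV g y :> f2 y - 2 * q * (y - x0)" for y
        unfolding g_def by (auto intro!: derivative_eq_intros f_derivs)
      show "DERIV (\<lambda>y. f2 y - 2 * q * (y - x0)) y :> f3 y - 2 * q" for y
        by (auto intro!: derivative_eq_intros f_derivs)
      show "0 \<le> f3 y - 2 * q" if "y \<in> {x0 - r<..<x0 + r}" for y
      proof -
        have "\<bar>f3 y - f3 x0\<bar> < 2 * q" using r(2)[of y] that by auto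
        moreover have "f3 x0 = 4 * q" by (simp add: q_def)
        ultimately show ?thesis by linarith
      qed
    qed (use r y in auto)
    then show ?thesis by (simp add: g_def f2_x0)
  qed
  define S where "S = {-L..L} - ball x0 r"
  have "\<exists>d>0. \<forall>y\<in>S. f1 y - f1 x0 \<ge> d"
  proof (cases "S = {}")
    case False
    have "compact S" unfolding S_def by (intro compact_diff) auto
    then obtain y where y: "y \<in> S" "\<forall>z\<in>S. f1 y \<le> f1 z"
      using continuous_attains_inf[OF _ False] continuous_on_subset[OF f_derivs(5)] by (metis subset_UNIV)
    have "y \<noteq> x0" using y(1) r(1) by (auto simp: S_def)
    then have "f1 y - f1 x0 > 0" using f1_unique[of y] f1_min[of y] by force
    then show ?thesis using y by (intro exI[of _ "f1 y - f1 x0"]) auto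
  qed (auto intro: exI[of _ 1])
  then obtain d where d: "d > 0" "\<And>y. y \<in> S \<Longrightarrow> f1 y - f1 x0 \<ge> d" by auto
  define e where "e = min q (min d (- f1 x0))"
  have e: "e > 0" "e \<le> q" "e \<le> d" "e \<le> - f1 x0" using q d f1_neg by (auto simp: e_def)
  have "f1 y \<ge> 1 / t0 + e * (m y)\<^sup>2" for y
  proof (cases "\<bar>y - x0\<bar> < r")
    case True
    have "e * (m y)\<^sup>2 \<le> q * (y - x0)\<^sup>2" using e q m_bounds[of y] by (intro mult_mono) auto
    then show ?thesis using near[OF True] f1_x0 by simp
  next
    case False
    have "e * (m y)\<^sup>2 \<le> e" using e m_bounds[of y] by (intro mult_left_le) auto
    moreover have "f1 y - f1 x0 \<ge> e"
    proof (cases "y \<in> {-L..L}")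
      case True
      then have "y \<in> S" using False by (auto simp: S_def dist_real_def abs_minus_commute)
      then show ?thesis using d(2) e by force
    qed (use e f1_far in auto)
    ultimately show ?thesis using f1_x0 by simp
  qed
  then show ?thesis using e(1) by blast
qed

section \<open>Characteristic map \<open>X\<close>, its Jacobian \<open>P\<close> and its inverse
  \<open>Y\<close>\<close>

definition P where "P t y = 1 + (t - t0) * f1 y"
text \<open>Length of a backward continuation of the characteristics past \<open>t0\<close>, along
  which the Jacobian stays at least 1/2. It makes \<open>t0\<close> an interior time, so that
  products of \<open>v\<close> with test functions are differentiable there.\<close>

definition \<delta> where "\<delta> = 1 / (2 * B1)"

lemma \<delta>_pos: "\<delta> > 0" using f_bounds(2) by (simp add: \<delta>_def)

text \<open>From \<open>f1_quadratic\<close>, \<open>P\<close> is at least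
  \<open>t / t0 + (t - t0) * q * (m y)^2\<close>. In the later half of the time interval the factor
  \<open>t - t0\<close> is bounded below, so the second term supplies the square; in the earlier
  half \<open>t / t0\<close> is at least 1/2 and absorbs it, as \<open>m y\<close> is at most
  1.\<close>

lemma P_lower: "\<exists>\<kappa>>0. \<forall>t\<in>{t0..<0}. \<forall>y. P t y \<ge> \<kappa> * (- t + (m y)\<^sup>2)"
proof -
  obtain q where q: "q > 0" "\<And>y. f1 y \<ge> 1 / t0 + q * (m y)\<^sup>2" using f1_quadratic by auto
  define \<kappa> where "\<kappa> = min (- 1 / (2 * t0)) (min (1 / 4) (- t0 * q / 2))"
  have \<kappa>: "\<kappa> > 0" "\<kappa> \<le> - 1 / (2 * t0)" "\<kappa> \<le> 1 / 4" "\<kappa> \<le> - t0 * q / 2"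
    using t0_neg q(1) by (auto simp: \<kappa>_def divide_neg_pos mult_neg_pos)
  have "P t y \<ge> \<kappa> * (- t + (m y)\<^sup>2)" if t: "t \<in> {t0..<0}" for t y
  proof -
    have "(t - t0) * f1 y \<ge> (t - t0) * (1 / t0 + q * (m y)\<^sup>2)"
      using t q(2)[of y] by (intro mult_left_mono) auto
    then have P: "P t y \<ge> t / t0 + (t - t0) * q * (m y)\<^sup>2"
      using t0_neg by (simp add: P_def field_simps)
    have 1: "2 * (\<kappa> * (- t)) \<le> t / t0"
    proof -
      have "\<kappa> * (- t) \<le> - 1 / (2 * t0) * (- t)" using \<kappa> t by (intro mult_right_mono) auto
      then have "2 * (\<kappa> * (- t)) \<le> 2 * (- 1 / (2 * t0) * (- t))" by (rule mult_left_mono) simp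
      also have "\<dots> = t / t0" by simp
      finally show ?thesis .
    qed
    have tt: "t / t0 \<ge> 0" using t t0_neg by (simp add: divide_nonpos_neg)
    show ?thesis
    proof (cases "t \<ge> t0 / 2")
      case True
      have "\<kappa> * (m y)\<^sup>2 \<le> - t0 * q / 2 * (m y)\<^sup>2" using \<kappa> by (intro mult_right_mono) auto
      also have "\<dots> \<le> (t - t0) * q * (m y)\<^sup>2"
      proof (rule mult_right_mono)
        have "- t0 / 2 * q \<le> (t - t0) * q" using True q by (intro mult_right_mono) auto
        then show "- t0 * q / 2 \<le> (t - t0) * q" by simp
      qed simp
      finally show ?thesis using P 1 tt unfolding distrib_left by linarith
    next
      case False
      then have "t / t0 \<ge> 1 / 2" using t0_neg by (simp add: field_simps)
      moreover have "\<kappa> * (m y)\<^sup>2 \<le> 1 / 4 * 1" using \<kappa> m_bounds[of y] by (intro mult_mono) auto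
      moreover have "(t - t0) * q * (m y)\<^sup>2 \<ge> 0" using t q by simp
      ultimately show ?thesis using P 1 unfolding distrib_left by linarith
    qed
  qed
  then show ?thesis using \<kappa>(1) by blast
qed

text \<open>A lower bound for \<open>P\<close> uniform in space: from \<open>t0\<close> on the
  smallest Jacobian is \<open>t / t0\<close>, attained on the characteristic from \<open>x0\<close>;
  the value 1/2 covers the backward continuation.\<close>

definition p where "p t = min (1 / 2) (t / t0)"

lemma p_pos: "t < 0 \<Longrightarrow> p t > 0"
  using t0_neg by (simp add: p_def divide_neg_neg)

lemma P_ge_p:
  assumes "t \<in> {t0 - \<delta><..<0}" shows "P t y \<ge> p t"
proof (cases "t \<ge> t0")
  case True
  have "(t - t0) * f1 y \<ge> (t - t0) * (1 / t0)" using True f1_ge[of y] by (intro mult_left_mono) auto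
  then have "P t y \<ge> t / t0" using t0_neg by (simp add: P_def field_simps)
  then show ?thesis by (simp add: p_def)
next
  case False
  have "\<bar>(t - t0) * f1 y\<bar> \<le> \<delta> * B1"
    unfolding abs_mult using assms False f_bounds by (intro mult_mono) auto
  also have "\<dots> = 1 / 2" using f_bounds(2) by (simp add: \<delta>_def)
  finally show ?thesis by (simp add: P_def p_def)
qed

lemma P_pos: "t \<in> {t0 - \<delta><..<0} \<Longrightarrow> P t y > 0"
  using P_ge_p[of t y] p_pos[of t] by auto

definition X where "X t y = y + (t - t0) * f y"

lemma X_deriv: "(X t has_real_derivative P t y) (at y)"
  unfolding X_def[abs_def] P_def by (auto intro!: derivative_eq_intros f_derivs)

lemma X_expand:
  assumes "t \<in> {t0 - \<delta><..<0}" shows "p t * \<bar>y - z\<bar> \<le> \<bar>X t y - X t z\<bar>"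
proof -
  have *: "p t * (y - z) \<le> X t y - X t z" if lt: "z < y" for y z
  proof -
    obtain \<xi> where "X t y - X t z = (y - z) * P t \<xi>"
      using MVT2[OF lt X_deriv] by auto
    moreover have "(y - z) * p t \<le> (y - z) * P t \<xi>" using lt P_ge_p[OF assms] by (intro mult_left_mono) auto
    ultimately show ?thesis by (simp add: mult.commute)
  qed
  show ?thesis using *[of z y] *[of y z] by (cases y z rule: linorder_cases) (auto simp: abs_if)
qed

text \<open>\<open>X t\<close> differs from the identity by a bounded function, so the intermediate
  value theorem gives surjectivity; the expansion estimate \<open>X_expand\<close> gives
  injectivity.\<close>

lemma X_bij:
  assumes "t \<in> {t0 - \<delta><..<0}" shows "\<exists>!y. X t y = x"
proof (rule ex_ex1I)
  define R where "R = \<bar>t - t0\<bar> * B0"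
  have R: "\<bar>(t - t0) * f y\<bar> \<le> R" for y
    unfolding R_def abs_mult using f_bounds by (intro mult_left_mono) auto
  have "R \<ge> 0" using R[of 0] by linarith
  moreover have "continuous_on {x - R..x + R} (X t)"
    using X_deriv by (intro continuous_at_imp_continuous_on) (auto intro: DERIV_isCont)
  ultimately show "\<exists>y. X t y = x"
    using IVT'[of "X t" "x - R" x "x + R"] abs_le_D2[OF R[of "x + R"]] abs_le_D1[OF R[of "x - R"]]
    by (force simp: X_def)
  show "y = z" if "X t y = x" "X t z = x" for y z
    using X_expand[OF assms, of y z] p_pos[of t] that assms by (simp add: mult_le_0_iff)
qed

definition Y where "Y t x = (THE y. X t y = x)"

lemma X_Y: "t \<in> {t0 - \<delta><..<0} \<Longrightarrow> X t (Y t x) = x"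
  unfolding Y_def by (rule theI'[OF X_bij])

lemma Y_X: "t \<in> {t0 - \<delta><..<0} \<Longrightarrow> Y t (X t y) = y"
  using X_bij X_Y by blast

lemma Y_t0: "Y t0 x = x"
  using Y_X[of t0 x] \<delta>_pos t0_neg by (simp add: X_def)

abbreviation "\<Omega> \<equiv> {t0 - \<delta><..<0} \<times> (UNIV :: real set)"

lemma open_\<Omega>: "open \<Omega>" by (intro open_Times) auto

text \<open>The foot \<open>Y s y\<close> is followed to time \<open>t\<close> instead of
  \<open>s\<close>, which moves its image by at most \<open>|t - s| * B0\<close>;
  \<open>X_expand\<close> at the fixed time \<open>t\<close> then bounds the difference of the
  feet.\<close>

lemma Y_isCont:
  assumes "z \<in> \<Omega>" shows "isCont (\<lambda>(t, x). Y t x) z"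
proof -
  obtain t x where z: "z = (t, x)" "t \<in> {t0 - \<delta><..<0}" using assms by auto
  have "((\<lambda>q. Y (fst q) (snd q)) \<longlongrightarrow> Y t x) (at z)"
  proof (rule Lim_null[THEN iffD2], rule Lim_null_comparison)
    show "\<forall>\<^sub>F q in at z. norm (Y (fst q) (snd q) - Y t x) \<le> (\<bar>snd q - x\<bar> + \<bar>fst q - t\<bar> * B0) / p t"
      using eventually_at_in_open'[OF open_\<Omega> assms]
    proof (rule eventually_mono)
      fix q assume q: "q \<in> \<Omega>"
      obtain s y where q': "q = (s, y)" "s \<in> {t0 - \<delta><..<0}" using q by auto
      have "X t (Y s y) = y + (t - s) * f (Y s y)"
        using X_Y[OF q'(2), of y] by (simp add: X_def algebra_simps)
      then have "p t * \<bar>Y s y - Y t x\<bar> \<le> \<bar>y - x + (t - s) * f (Y s y)\<bar>"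
        using X_expand[OF z(2), of "Y s y" "Y t x"] X_Y[OF z(2), of x] by (simp add: algebra_simps)
      also have "\<dots> \<le> \<bar>y - x\<bar> + \<bar>t - s\<bar> * \<bar>f (Y s y)\<bar>" by (metis abs_mult abs_triangle_ineq)
      also have "\<dots> \<le> \<bar>y - x\<bar> + \<bar>s - t\<bar> * B0"
        using f_bounds(5)[of "Y s y"] by (auto intro!: mult_mono)
      finally show "norm (Y (fst q) (snd q) - Y t x) \<le> (\<bar>snd q - x\<bar> + \<bar>fst q - t\<bar> * B0) / p t"
        using p_pos[of t] z(2) by (simp add: q' field_simps)
    qed
    have "((\<lambda>q. (\<bar>snd q - x\<bar> + \<bar>fst q - t\<bar> * B0) / p t) \<longlongrightarrow> (\<bar>snd z - x\<bar> + \<bar>fst z - t\<bar> * B0) / p t) (at z)"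
      using p_pos[of t] z(2) by (intro tendsto_intros) auto
    then show "((\<lambda>q. (\<bar>snd q - x\<bar> + \<bar>fst q - t\<bar> * B0) / p t) \<longlongrightarrow> 0) (at z)" by (simp add: z)
  qed
  then show ?thesis by (simp add: z isCont_def case_prod_unfold)
qed

text \<open>Inverse function argument for the map from \<open>(t, y)\<close> to
  \<open>(t, X t y)\<close>: its derivative is invertible because \<open>P\<close> is positive, and
  continuity of the inverse is \<open>Y_isCont\<close>.\<close>

lemma Y_has_derivative:
  assumes t: "t \<in> {t0 - \<delta><..<0}"
  shows "((\<lambda>(t, x). Y t x) has_derivative (\<lambda>(h, k). (k - h * f (Y t x)) / P t (Y t x))) (at (t, x))"
proof -
  let ?y = "Y t x"
  have Pne: "P t ?y \<noteq> 0" using P_pos[OF t, of ?y] by simp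
  have "((\<lambda>q. (fst q, Y (fst q) (snd q))) has_derivative
      (\<lambda>q. (fst q, (snd q - fst q * f ?y) / P t ?y))) (at (t, x))"
  proof (rule has_derivative_inverse_basic[where f = "\<lambda>q. (fst q, X (fst q) (snd q))"
        and f' = "\<lambda>q. (fst q, fst q * f ?y + snd q * P t ?y)" and T = \<Omega>])
    have "((\<lambda>q. f (snd q)) has_derivative (\<lambda>h. snd h * f1 ?y)) (at (t, ?y))"
      using has_derivative_compose[OF has_derivative_snd[OF has_derivative_ident],
        of f "\<lambda>h. h * f1 ?y" "(t, ?y)" UNIV] f_derivs(1)[of ?y]
      by (simp add: has_field_derivative_def mult.commute[of _ "f1 ?y"] mult_commute_abs)
    then show "((\<lambda>q. (fst q, X (fst q) (snd q))) has_derivative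
        (\<lambda>q. (fst q, fst q * f ?y + snd q * P t ?y))) (at (fst (t, x), Y (fst (t, x)) (snd (t, x))))"
      unfolding X_def P_def by (auto intro!: derivative_eq_intros simp: algebra_simps)
    show "bounded_linear (\<lambda>q. (fst q, (snd q - fst q * f ?y) / P t ?y))"
      by (intro bounded_linear_Pair bounded_linear_fst bounded_linear_divide
          bounded_linear_compose[OF bounded_linear_divide] bounded_linear_sub bounded_linear_snd
          bounded_linear_compose[OF bounded_linear_mult_left bounded_linear_fst])
    show "(\<lambda>q. (fst q, (snd q - fst q * f ?y) / P t ?y)) \<circ> (\<lambda>q. (fst q, fst q * f ?y + snd q * P t ?y)) = id"
      using Pne by (auto simp: fun_eq_iff)
    have "isCont (\<lambda>q. Y (fst q) (snd q)) (t, x)" using Y_isCont[of "(t, x)"] t by (simp add: case_prod_unfold)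
    then show "continuous (at (t, x)) (\<lambda>q. (fst q, Y (fst q) (snd q)))" by (intro continuous_intros) auto
    show "open \<Omega>" by (rule open_\<Omega>)
    show "(t, x) \<in> \<Omega>" using t by auto
  qed (auto simp: X_Y)
  from has_derivative_snd[OF this] show ?thesis by (simp add: case_prod_unfold)
qed

lemma Y_deriv_t:
  assumes "t \<in> {t0 - \<delta><..<0}"
  shows "((\<lambda>s. Y s x) has_real_derivative - f (Y t x) / P t (Y t x)) (at t)"
proof -
  have "((\<lambda>s. (s, x)) has_derivative (\<lambda>h. (h, 0))) (at t)" by (auto intro!: derivative_eq_intros)
  from has_derivative_compose[OF this Y_has_derivative[OF assms, of x]]
  have "((\<lambda>s. Y s x) has_derivative (\<lambda>h. (0 - h * f (Y t x)) / P t (Y t x))) (at t)" by simp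
  then show ?thesis by (rule has_derivative_imp_has_field_derivative) (simp add: divide_simps)
qed

lemma Y_deriv_x:
  assumes "t \<in> {t0 - \<delta><..<0}"
  shows "(Y t has_real_derivative 1 / P t (Y t x)) (at x)"
proof -
  have "((\<lambda>y. (t, y)) has_derivative (\<lambda>h. (0, h))) (at x)" by (auto intro!: derivative_eq_intros)
  from has_derivative_compose[OF this Y_has_derivative[OF assms, of x]]
  have "((\<lambda>y. Y t y) has_derivative (\<lambda>h. (h - 0 * f (Y t x)) / P t (Y t x))) (at x)" by simp
  then show ?thesis by (rule has_derivative_imp_has_field_derivative) (simp add: divide_simps)
qed

section \<open>The classical solution before the shock and its scaling bounds\<close>

definition v where "v t x = f (Y t x)"
definition vx where "vx t x = f1 (Y t x) / P t (Y t x)"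
text \<open>Set by the inviscid equation; \<open>v_derivs\<close> identifies it with the time
  derivative, and this is how \<open>v\<close> is known to solve the equation.\<close>

definition vt where "vt t x = - v t x * vx t x"
definition vxx where "vxx t x = f2 (Y t x) / P t (Y t x) ^ 3"

lemma v_t0: "v t0 x = f x" by (simp add: v_def Y_t0)

lemma v_bdd: "\<bar>v t x\<bar> \<le> B0" by (simp add: v_def f_bounds)

lemma v_derivs:
  assumes t: "t \<in> {t0 - \<delta><..<0}"
  shows "((\<lambda>s. v s x) has_real_derivative vt t x) (at t)"
    "(v t has_real_derivative vx t x) (at x)"
    "(vx t has_real_derivative vxx t x) (at x)"
proof -
  have Pne: "P t (Y t x) \<noteq> 0" using P_pos[OF t, of "Y t x"] by simp
  show "((\<lambda>s. v s x) has_real_derivative vt t x) (at t)"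
    using DERIV_chain2[OF f_derivs(1) Y_deriv_t[OF t, of x]] by (simp add: v_def vt_def vx_def mult.commute)
  show "(v t has_real_derivative vx t x) (at x)"
    using DERIV_chain2[OF f_derivs(1) Y_deriv_x[OF t, of x]] by (simp add: v_def[abs_def] vx_def)
  \<comment> \<open>The numerator \<open>f2 * P - f1 * (t - t0) * f2\<close> of the quotient rule
    collapses to \<open>f2\<close>.\<close>
  have "((\<lambda>y. f1 y / P t y) has_real_derivative f2 (Y t x) / (P t (Y t x))\<^sup>2) (at (Y t x))"
    using Pne unfolding P_def
    by (auto intro!: derivative_eq_intros f_derivs simp: power2_eq_square divide_simps) (auto simp: algebra_simps)
  from DERIV_chain2[OF this Y_deriv_x[OF t, of x]]
  show "(vx t has_real_derivative vxx t x) (at x)"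
    by (simp add: vx_def[abs_def] vxx_def power2_eq_square power3_eq_cube)
qed

lemma v_cont: "continuous_on \<Omega> (\<lambda>(t, x). v t x)" "continuous_on \<Omega> (\<lambda>(t, x). vx t x)"
  "continuous_on \<Omega> (\<lambda>(t, x). vt t x)"
proof -
  have Y: "continuous_on \<Omega> (\<lambda>q. Y (fst q) (snd q))"
    using Y_isCont by (intro continuous_at_imp_continuous_on) (auto simp: case_prod_unfold)
  have Pne: "P (fst q) (Y (fst q) (snd q)) \<noteq> 0" if "q \<in> \<Omega>" for q
    using P_pos[of "fst q" "Y (fst q) (snd q)"] that by auto
  have 1: "continuous_on \<Omega> (\<lambda>q. f (Y (fst q) (snd q)))" "continuous_on \<Omega> (\<lambda>q. f1 (Y (fst q) (snd q)))"
    by (rule continuous_on_compose2[OF f_derivs(4) Y] continuous_on_compose2[OF f_derivs(5) Y]; simp)+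
  have 2: "continuous_on \<Omega> (\<lambda>q. P (fst q) (Y (fst q) (snd q)))"
    unfolding P_def by (intro continuous_intros 1)
  show "continuous_on \<Omega> (\<lambda>(t, x). v t x)" "continuous_on \<Omega> (\<lambda>(t, x). vx t x)"
    "continuous_on \<Omega> (\<lambda>(t, x). vt t x)"
    unfolding case_prod_unfold v_def vt_def vx_def
    by (intro continuous_intros 1 2 ballI Pne; assumption)+
qed

text \<open>\<open>P t y - t * f1 y\<close> equals \<open>1 - t0 * f1 y\<close>, which is
  nonnegative since \<open>f1\<close> is at least \<open>1 / t0\<close>.\<close>

lemma vx_ge:
  assumes "t \<in> {t0..<0}" shows "vx t x \<ge> 1 / t"
proof -
  let ?y = "Y t x"
  have P: "P t ?y > 0" using P_pos assms \<delta>_pos by auto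
  have "t0 * f1 ?y \<le> 1" using f1_ge[of ?y] t0_neg by (simp add: field_simps)
  then have "P t ?y \<ge> t * f1 ?y" by (simp add: P_def algebra_simps)
  then show ?thesis using P assms by (simp add: vx_def field_simps)
qed

text \<open>With \<open>r = sqrt (- t)\<close> and \<open>Q = r^2 + (m y)^2\<close> the Jacobian is
  at least \<open>\<kappa> * Q\<close>, while \<open>f2 y\<close> and \<open>f y - f x0\<close> are
  both of order \<open>m y\<close>. The claims reduce to \<open>r^5 * m y <= Q^3\<close> and
  \<open>r * m y <= Q\<close>, which follow from \<open>r^2 <= Q\<close> and the
  arithmetic-geometric mean inequality.\<close>

lemma v_scaling:
  "\<exists>C\<ge>1. \<forall>t\<in>{t0..<0}. \<forall>x. \<bar>vxx t x\<bar> \<le> C / sqrt (- t) ^ 5 \<and> \<bar>(v t x - f x0) * vx t x\<bar> \<le> C / sqrt (- t)"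
proof -
  obtain \<kappa> where \<kappa>: "\<kappa> > 0" "\<And>t y. t \<in> {t0..<0} \<Longrightarrow> P t y \<ge> \<kappa> * (- t + (m y)\<^sup>2)"
    using P_lower by auto
  define C1 where "C1 = B3 + 2 * B2"
  define C2 where "C2 = (B1 + 2 * B0) * B1"
  have C: "C1 \<ge> 1" "C2 \<ge> 0" using f_bounds(1-4) by (auto simp: C1_def C2_def)
  define C where "C = 1 + C1 / \<kappa> ^ 3 + C2 / \<kappa>"
  have bound: "\<bar>vxx t x\<bar> \<le> C / sqrt (- t) ^ 5 \<and> \<bar>(v t x - f x0) * vx t x\<bar> \<le> C / sqrt (- t)"
    if t: "t \<in> {t0..<0}" for t x
  proof -
    define y where "y = Y t x"
    define r where "r = sqrt (- t)"
    have r: "r > 0" "r\<^sup>2 = - t" using t by (auto simp: r_def)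
    define Q where "Q = r\<^sup>2 + (m y)\<^sup>2"
    have Q: "r\<^sup>2 \<le> Q" "Q > 0" using r(1) by (simp_all add: Q_def add_pos_nonneg)
    have "0 \<le> (r - m y)\<^sup>2" by simp
    then have "2 * (r * m y) \<le> Q" by (simp add: Q_def power2_diff)
    moreover have "0 \<le> r * m y" using r m_bounds by simp
    ultimately have rm: "r * m y \<le> Q" by linarith
    have P: "P t y \<ge> \<kappa> * Q" using \<kappa>(2)[OF t, of y] r by (simp add: Q_def)
    have kQ: "\<kappa> * Q > 0" using \<kappa> Q by simp
    have Pp: "P t y > 0" using P kQ by linarith
    have "r ^ 5 * m y \<le> Q ^ 3"
    proof -
      have "(r\<^sup>2 * r\<^sup>2) * (r * m y) \<le> (Q * Q) * Q"
        using Q rm r(1) m_bounds[of y] by (intro mult_mono) auto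
      then show ?thesis by (simp add: power_numeral_reduce mult.assoc)
    qed
    then have q3: "m y / Q ^ 3 \<le> 1 / r ^ 5" using Q r by (simp add: field_simps)
    have q1: "m y / Q \<le> 1 / r" using rm Q r by (simp add: field_simps)
    have "\<bar>vxx t x\<bar> = \<bar>f2 y\<bar> / P t y ^ 3" using Pp by (simp add: vxx_def y_def[symmetric])
    also have "\<dots> \<le> (C1 * m y) / (\<kappa> * Q) ^ 3"
      using f2_dev[of y] P kQ by (intro frac_le power_mono) (auto simp: C1_def)
    also have "\<dots> = C1 / \<kappa> ^ 3 * (m y / Q ^ 3)" by (simp add: power_mult_distrib)
    also have "\<dots> \<le> C1 / \<kappa> ^ 3 * (1 / r ^ 5)" using q3 C \<kappa> by (intro mult_left_mono) auto
    also have "\<dots> \<le> C * (1 / r ^ 5)" using C \<kappa> r by (intro mult_right_mono) (auto simp: C_def)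
    finally have 1: "\<bar>vxx t x\<bar> \<le> C / r ^ 5" by simp
    have "\<bar>(v t x - f x0) * vx t x\<bar> = \<bar>f y - f x0\<bar> * \<bar>f1 y\<bar> / P t y"
      using Pp by (simp add: v_def vx_def y_def[symmetric] abs_mult)
    also have "\<dots> \<le> ((B1 + 2 * B0) * m y * B1) / (\<kappa> * Q)"
      using f_dev[of y] f_bounds P kQ m_bounds[of y] by (intro frac_le mult_mono) auto
    also have "\<dots> = C2 / \<kappa> * (m y / Q)" by (simp add: C2_def)
    also have "\<dots> \<le> C2 / \<kappa> * (1 / r)" using q1 C \<kappa> by (intro mult_left_mono) auto
    also have "\<dots> \<le> C * (1 / r)" using C \<kappa> r by (intro mult_right_mono) (auto simp: C_def)
    finally have 2: "\<bar>(v t x - f x0) * vx t x\<bar> \<le> C / r" by simp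
    from 1 2 show ?thesis by (simp add: r_def)
  qed
  moreover have "C \<ge> 1" using C \<kappa> by (simp add: C_def)
  ultimately show ?thesis by blast
qed

end

section \<open>Bounds for the viscous solution\<close>

context burgers_data begin

lemma \<Omega>_time: "t \<in> {t0..<0} \<Longrightarrow> t \<in> {t0 - \<delta><..<0}"
  using \<delta>_pos by auto

lemma v_drop:
  assumes "t \<in> {t0..<0}" "h > 0" shows "v t x - v t (x + h) \<le> h / (- t)"
proof -
  obtain \<xi> where "v t (x + h) - v t x = (x + h - x) * vx t \<xi>"
    using MVT2[of x "x + h" "v t" "vx t"] v_derivs(2)[OF \<Omega>_time[OF assms(1)]] assms(2) by auto
  moreover have "h * (1 / t) \<le> h * vx t \<xi>" using vx_ge[OF assms(1)] assms(2) by (intro mult_left_mono) auto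
  ultimately show ?thesis by (simp add: minus_divide_right[symmetric])
qed

text \<open>In the frame moving with speed \<open>f x0\<close> the rate of change is integrable up to time \<open>0\<close>.\<close>

lemma v_moving_frame:
  assumes C: "\<And>t x. t \<in> {t0..<0} \<Longrightarrow> \<bar>(v t x - f x0) * vx t x\<bar> \<le> C / sqrt (- t)"
    and st: "t0 \<le> s" "s \<le> t" "t < 0" and C0: "C \<ge> 0"
  shows "\<bar>v t (x + f x0 * (t - s)) - v s x\<bar> \<le> 2 * C * sqrt (- s)"
proof -
  define g where "g r = v r (x + f x0 * (r - s))" for r
  have g': "(g has_real_derivative - ((v r (x + f x0 * (r - s)) - f x0) * vx r (x + f x0 * (r - s)))) (at r)"
    if r: "r \<in> {t0..<0}" for r
  proof -
    let ?z = "x + f x0 * (r - s)"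
    have "((\<lambda>r. (r, x + f x0 * (r - s))) has_derivative (\<lambda>h. (h, f x0 * h))) (at r)"
      by (auto intro!: derivative_eq_intros)
    from has_derivative_compose[OF this Y_has_derivative[OF \<Omega>_time[OF r], of ?z]]
    have "((\<lambda>r. Y r (x + f x0 * (r - s))) has_derivative
        (\<lambda>h. (f x0 * h - h * f (Y r ?z)) / P r (Y r ?z))) (at r)" by simp
    then have "((\<lambda>r. Y r (x + f x0 * (r - s))) has_real_derivative (f x0 - f (Y r ?z)) / P r (Y r ?z)) (at r)"
      by (rule has_derivative_imp_has_field_derivative) (simp add: algebra_simps)
    from DERIV_chain2[OF f_derivs(1) this] show ?thesis
      unfolding g_def[abs_def] v_def vx_def by (rule DERIV_cong) (simp add: algebra_simps diff_divide_distrib)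
  qed
  \<comment> \<open>The derivative of \<open>2 * C * sqrt (- r)\<close> is
    \<open>- C / sqrt (- r)\<close>, which dominates the rate of change of \<open>g\<close>. Hence
    the sum is nonincreasing for either sign.\<close>
  have "\<sigma> * g t + 2 * C * sqrt (- t) \<le> \<sigma> * g s + 2 * C * sqrt (- s)" if \<sigma>: "\<sigma> = 1 \<or> \<sigma> = (-1::real)" for \<sigma>
  proof (rule DERIV_nonpos_imp_nonincreasing[OF st(2)])
    fix r assume "s \<le> r" "r \<le> t"
    then have r: "r \<in> {t0..<0}" using st by auto
    let ?G = "(v r (x + f x0 * (r - s)) - f x0) * vx r (x + f x0 * (r - s))"
    have "((\<lambda>r. \<sigma> * g r + 2 * C * sqrt (- r)) has_real_derivative \<sigma> * (- ?G) + 2 * C * (- (inverse (sqrt (- r)) / 2))) (at r)"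
      using r by (auto intro!: derivative_eq_intros g'[OF r])
    moreover have "\<sigma> * (- ?G) + 2 * C * (- (inverse (sqrt (- r)) / 2)) \<le> 0"
    proof -
      define h where "h = ?G"
      have "\<sigma> * (- h) \<le> \<bar>h\<bar>" using \<sigma> by auto
      also have "\<dots> \<le> C / sqrt (- r)" unfolding h_def by (rule C[OF r])
      also have "\<dots> = - (2 * C * (- (inverse (sqrt (- r)) / 2)))" by (simp add: inverse_eq_divide)
      finally show ?thesis unfolding h_def by linarith
    qed
    ultimately show "\<exists>y. ((\<lambda>r. \<sigma> * g r + 2 * C * sqrt (- r)) has_real_derivative y) (at r) \<and> y \<le> 0" by blast
  qed
  from this[of 1] this[of "-1"] have "\<bar>g t - g s\<bar> + 2 * C * sqrt (- t) \<le> 2 * C * sqrt (- s)" by (simp add: abs_if)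
  moreover have "2 * C * sqrt (- t) \<ge> 0" using C0 st by simp
  ultimately show ?thesis by (simp add: g_def)
qed

text \<open>Comparison with \<open>v\<close> itself: its residual is the viscous term, and its slope
  is at least \<open>1 / t\<close>. The error function solves \<open>a' = m * a + r\<close> with
  equality, for \<open>m = 1 / |t|\<close> and
  \<open>r = C * \<nu> * |t| powr (-5/2)\<close>.\<close>

lemma viscous_early:
  assumes C: "\<And>t x. t \<in> {t0..<0} \<Longrightarrow> \<bar>vxx t x\<bar> \<le> C / sqrt (- t) ^ 5" and C0: "C \<ge> 0"
    and sol: "viscous_burgers_solution \<nu> t0 f u" and \<nu>: "\<nu> \<ge> 0"
    and t: "t0 \<le> t" "t < 0"
  shows "\<bar>u t x - v t x\<bar> \<le> 2 * C * \<nu> / sqrt (- t) ^ 3"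
proof (rule viscous_burgers_comparison[where ?t1.0 = t0 and T = t and V = v and V\<^sub>t = vt and V\<^sub>x = vx and V\<^sub>x\<^sub>x = vxx
      and m = "\<lambda>t. - 1 / t" and r = "\<lambda>t. \<nu> * (C / sqrt (- t) ^ 5)" and c = "- 1 / t"
      and a = "\<lambda>t. 2 * C * \<nu> / sqrt (- t) ^ 3" and a' = "\<lambda>t. 3 * C * \<nu> / sqrt (- t) ^ 5" and N = B0, OF sol \<nu>])
  show "continuous_on ({t0..t} \<times> UNIV) (\<lambda>(t, x). v t x)"
    by (rule continuous_on_subset[OF v_cont(1)]) (use \<delta>_pos t in auto)
  show "\<bar>v s x\<bar> \<le> B0" for s x by (rule v_bdd)
  fix s assume "s \<in> {t0<..t}"
  then have s: "s \<in> {t0..<0}" "s \<in> {t0 - \<delta><..<0}" "s \<le> t" using t \<delta>_pos by auto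
  show "((\<lambda>s. v s x) has_real_derivative vt s x) (at s)" "(v s has_real_derivative vx s x) (at x)"
    "(vx s has_real_derivative vxx s x) (at x)" for x by (rule v_derivs[OF s(2)])+
  show "- (- 1 / s) \<le> vx s x" for x using vx_ge[OF s(1), of x] by simp
  have "\<nu> * \<bar>vxx s x\<bar> \<le> \<nu> * (C / sqrt (- s) ^ 5)" for x using C[OF s(1)] \<nu> by (intro mult_left_mono) auto
  then show "\<bar>vt s x + v s x * vx s x - \<nu> * vxx s x\<bar> \<le> \<nu> * (C / sqrt (- s) ^ 5)" for x
    using \<nu> by (simp add: vt_def abs_mult)
  show "- 1 / s \<le> - 1 / t" using s t by (simp add: field_simps)
  define q where "q = sqrt (- s)"
  have q: "q > 0" "- s = q\<^sup>2" using s by (auto simp: q_def)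
  show "((\<lambda>t. 2 * C * \<nu> / sqrt (- t) ^ 3) has_real_derivative 3 * C * \<nu> / sqrt (- s) ^ 5) (at s)"
  proof -
    have "((\<lambda>t. sqrt (- t)) has_real_derivative - (inverse q / 2)) (at s)"
      unfolding q_def using s by (auto intro!: derivative_eq_intros)
    moreover have "((\<lambda>q. 2 * C * \<nu> / q ^ 3) has_real_derivative 2 * C * \<nu> * (- (3 / q ^ 4))) (at (sqrt (- s)))"
      unfolding q_def[symmetric] using q(1)
      by (auto intro!: derivative_eq_intros simp: divide_simps power_numeral_reduce)
    ultimately have "((\<lambda>t. 2 * C * \<nu> / sqrt (- t) ^ 3) has_real_derivative
        2 * C * \<nu> * (- (3 / q ^ 4)) * (- (inverse q / 2))) (at s)"
      by (rule DERIV_chain2[rotated])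
    then show ?thesis unfolding q_def[symmetric]
      by (rule DERIV_cong) (use q(1) in \<open>simp add: field_simps power_numeral_reduce\<close>)
  qed
  have "s = - (q\<^sup>2)" using q by simp
  then show "- 1 / s * (2 * C * \<nu> / sqrt (- s) ^ 3) + \<nu> * (C / sqrt (- s) ^ 5) \<le> 3 * C * \<nu> / sqrt (- s) ^ 5"
    unfolding q_def[symmetric] using q(1) by (simp add: field_simps power_numeral_reduce)
next
  show "continuous_on {t0..t} (\<lambda>t. 2 * C * \<nu> / sqrt (- t) ^ 3)"
    using t by (intro continuous_intros) auto
  show "0 \<le> 2 * C * \<nu> / sqrt (- s) ^ 3" if "s \<in> {t0..t}" for s using that t C0 \<nu> by simp
  have "u t0 x = f x" for x using sol by (simp add: viscous_burgers_solution_def)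
  then show "\<bar>u t0 x - v t0 x\<bar> \<le> 2 * C * \<nu> / sqrt (- t0) ^ 3" for x using C0 \<nu> t0_neg by (simp add: v_t0)
qed (use t in auto)

text \<open>Comparison with the profile at time \<tau>, frozen and moved with speed
  \<open>f x0\<close>; its residual is \<open>(v - f x0) * vx - \<nu> * vxx\<close> at that time. In
  the exponent 2 of \<open>a\<close>, one unit pays for the slope bound \<open>1 / |\<tau>|\<close>
  and one for the residual, which is at most \<open>A / |\<tau>|\<close>. The remaining time is
  below \<open>|\<tau>|\<close>, hence the factor \<open>exp 2\<close>.\<close>

lemma viscous_late:
  assumes C: "\<And>t x. t \<in> {t0..<0} \<Longrightarrow> \<bar>vxx t x\<bar> \<le> C / sqrt (- t) ^ 5"
      "\<And>t x. t \<in> {t0..<0} \<Longrightarrow> \<bar>(v t x - f x0) * vx t x\<bar> \<le> C / sqrt (- t)"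
    and sol: "viscous_burgers_solution \<nu> t0 f u" and \<nu>: "\<nu> \<ge> 0"
    and \<tau>: "t0 \<le> \<tau>" "\<tau> < 0"
    and A: "\<And>x. \<bar>u \<tau> x - v \<tau> x\<bar> \<le> A"  "(C / sqrt (- \<tau>) + \<nu> * (C / sqrt (- \<tau>) ^ 5)) * (- \<tau>) \<le> A"
    and t: "\<tau> \<le> t" "t < 0"
  shows "\<bar>u t x - v \<tau> (x - f x0 * (t - \<tau>))\<bar> \<le> A * exp 2"
proof -
  define y where "y t x = x - f x0 * (t - \<tau>)" for t x
  have \<tau>': "\<tau> \<in> {t0..<0}" using \<tau> by auto
  note \<tau>\<Omega> = \<Omega>_time[OF \<tau>']
  have A0: "A \<ge> 0" using A(1)[of 0] by simp
  define a where "a t = A * exp (2 * (t - \<tau>) / (- \<tau>))" for t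
  have "\<bar>u t x - v \<tau> (y t x)\<bar> \<le> a t"
  proof (rule viscous_burgers_comparison[where ?t1.0 = \<tau> and T = t and V = "\<lambda>t x. v \<tau> (y t x)"
        and V\<^sub>t = "\<lambda>t x. - f x0 * vx \<tau> (y t x)" and V\<^sub>x = "\<lambda>t x. vx \<tau> (y t x)" and V\<^sub>x\<^sub>x = "\<lambda>t x. vxx \<tau> (y t x)"
      and m = "\<lambda>t. - 1 / \<tau>" and r = "\<lambda>t. C / sqrt (- \<tau>) + \<nu> * (C / sqrt (- \<tau>) ^ 5)" and c = "- 1 / \<tau>"
      and a = a and a' = "\<lambda>t. a t * (2 / (- \<tau>))" and N = B0, OF sol \<nu> \<tau>(1)])
    have "continuous_on UNIV (v \<tau>)"
      using v_derivs(2)[OF \<tau>\<Omega>] by (intro continuous_at_imp_continuous_on) (auto intro: DERIV_isCont)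
    then show "continuous_on ({\<tau>..t} \<times> UNIV) (\<lambda>(t, x). v \<tau> (y t x))"
      unfolding case_prod_unfold y_def by (rule continuous_on_compose2) (auto intro!: continuous_intros)
    show "\<bar>v \<tau> (y s x)\<bar> \<le> B0" for s x by (rule v_bdd)
    fix s assume s: "s \<in> {\<tau><..t}"
    have yt: "((\<lambda>s. y s x) has_real_derivative - f x0) (at s)" for x
      unfolding y_def by (auto intro!: derivative_eq_intros)
    have yx: "((\<lambda>x. y s x) has_real_derivative 1) (at x)" for x
      unfolding y_def by (auto intro!: derivative_eq_intros)
    show "((\<lambda>s. v \<tau> (y s x)) has_real_derivative - f x0 * vx \<tau> (y s x)) (at s)" for x
      using DERIV_chain2[OF v_derivs(2)[OF \<tau>\<Omega>] yt] by (simp add: mult.commute)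
    show "((\<lambda>x. v \<tau> (y s x)) has_real_derivative vx \<tau> (y s x)) (at x)" for x
      using DERIV_chain2[OF v_derivs(2)[OF \<tau>\<Omega>] yx] by simp
    show "((\<lambda>x. vx \<tau> (y s x)) has_real_derivative vxx \<tau> (y s x)) (at x)" for x
      using DERIV_chain2[OF v_derivs(3)[OF \<tau>\<Omega>] yx] by simp
    show "- (- 1 / \<tau>) \<le> vx \<tau> (y s x)" for x using vx_ge[OF \<tau>'] by simp
    have "\<nu> * \<bar>vxx \<tau> z\<bar> \<le> \<nu> * (C / sqrt (- \<tau>) ^ 5)" for z using C(1)[OF \<tau>'] \<nu> by (intro mult_left_mono) auto
    then have 1: "\<bar>\<nu> * vxx \<tau> z\<bar> \<le> \<nu> * (C / sqrt (- \<tau>) ^ 5)" for z using \<nu> by (simp add: abs_mult)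
    show "\<bar>- f x0 * vx \<tau> (y s x) + v \<tau> (y s x) * vx \<tau> (y s x) - \<nu> * vxx \<tau> (y s x)\<bar>
        \<le> C / sqrt (- \<tau>) + \<nu> * (C / sqrt (- \<tau>) ^ 5)" for x
    proof -
      have "- f x0 * vx \<tau> (y s x) + v \<tau> (y s x) * vx \<tau> (y s x) = (v \<tau> (y s x) - f x0) * vx \<tau> (y s x)"
        by (simp add: algebra_simps)
      then show ?thesis using C(2)[OF \<tau>', of "y s x"] 1[of "y s x"] by linarith
    qed
    show "(a has_real_derivative a s * (2 / (- \<tau>))) (at s)"
      unfolding a_def[abs_def] using \<tau> by (auto intro!: derivative_eq_intros simp: field_simps)
    have "A \<le> a s"
      unfolding a_def using s \<tau> A0 by (simp add: mult_le_cancel_left1 divide_nonneg_neg divide_nonneg_pos divide_nonpos_neg divide_le_0_iff)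
    then have "(C / sqrt (- \<tau>) + \<nu> * (C / sqrt (- \<tau>) ^ 5)) * (- \<tau>) \<le> a s" using A(2) by linarith
    then have "C / sqrt (- \<tau>) + \<nu> * (C / sqrt (- \<tau>) ^ 5) \<le> a s / (- \<tau>)" 
      using \<tau> by (subst pos_le_divide_eq) auto
    then show "- 1 / \<tau> * a s + (C / sqrt (- \<tau>) + \<nu> * (C / sqrt (- \<tau>) ^ 5)) \<le> a s * (2 / (- \<tau>))"
    proof -
      assume *: "C / sqrt (- \<tau>) + \<nu> * (C / sqrt (- \<tau>) ^ 5) \<le> a s / (- \<tau>)"
      define w where "w = a s / (- \<tau>)"
      have "- 1 / \<tau> * a s = w" "a s * (2 / (- \<tau>)) = 2 * w" by (simp_all add: w_def)
      moreover note *[folded w_def]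
      ultimately show ?thesis by linarith
    qed
  next
    show "continuous_on {\<tau>..t} a" unfolding a_def[abs_def] using \<tau> by (intro continuous_intros) auto
    show "0 \<le> a s" for s using A0 by (simp add: a_def)
    show "\<bar>u \<tau> x - v \<tau> (y \<tau> x)\<bar> \<le> a \<tau>" for x using A(1)[of x] by (simp add: a_def y_def)
  qed (use t in auto)
  also have "a t \<le> A * exp 2"
    unfolding a_def using A0 t \<tau> by (intro mult_left_mono) (auto simp: field_simps)
  finally show ?thesis by (simp add: y_def)
qed

text \<open>With \<open>\<nu> = n^4\<close> every power of \<nu> becomes an integer power of
  \<open>n\<close>. The second conjunct bounds the drop of \<open>u\<close> across distance
  \<open>n^3\<close>; it is what the lower bound needs at the outer edge of its strip.\<close>

lemma viscous_upper:
  "\<exists>C\<ge>1. \<forall>n\<in>{0<..1}. \<forall>u. viscous_burgers_solution (n ^ 4) t0 f u \<longrightarrow>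
    (\<forall>t\<in>{t0..<0}. \<forall>x. \<bar>u t x - v t x\<bar> \<le> C * n \<and> u t x - u t (x + n ^ 3) \<le> C * n)"
proof -
  obtain C where C: "C \<ge> 1" "\<And>t x. t \<in> {t0..<0} \<Longrightarrow> \<bar>vxx t x\<bar> \<le> C / sqrt (- t) ^ 5"
    "\<And>t x. t \<in> {t0..<0} \<Longrightarrow> \<bar>(v t x - f x0) * vx t x\<bar> \<le> C / sqrt (- t)"
    using v_scaling by blast
  define r where "r = sqrt (- t0)"
  have r: "r > 0" "- t0 = r\<^sup>2" using t0_neg by (auto simp: r_def)
  define K where "K = 2 * C / r ^ 3"
  \<comment> \<open>\<open>K\<close> is the coefficient of the early error at time \<tau>; the other
    two terms are the residual bound multiplied by \<open>- \<tau>\<close>, in units of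
    \<open>n\<close>.\<close>
  define A where "A = K + C * r + C / r ^ 3"
  have "C * r \<ge> 0" "C / r ^ 3 \<ge> 0" "K \<ge> 0" using C(1) r(1) by (auto simp: K_def)
  then have K: "K \<ge> 0" "K \<le> A" "A \<ge> 0" by (auto simp: A_def)
  define C' where "C' = 1 + 2 * A * exp 2 + 2 * C * r + 1 / r\<^sup>2"
  have AE: "A * exp 2 \<ge> A" using K by (simp add: mult_le_cancel_left1)
  have pos: "A * exp 2 \<ge> 0" "2 * C * r \<ge> 0" "1 / r\<^sup>2 \<ge> 0" using K C r by auto
  have "\<bar>u t x - v t x\<bar> \<le> C' * n \<and> u t x - u t (x + n ^ 3) \<le> C' * n"
    if n: "n \<in> {0<..1}" and sol: "viscous_burgers_solution (n ^ 4) t0 f u" and t: "t \<in> {t0..<0}" for n u t x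
  proof -
    \<comment> \<open>This time balances the two errors: \<open>\<nu> * |\<tau>| powr (-3/2)\<close>
      from the early phase and \<open>|\<tau>| powr (1/2)\<close> from freezing the profile are both
      of order \<open>n\<close>.\<close>
    define \<tau> where "\<tau> = t0 * n\<^sup>2"
    have \<tau>eq: "- \<tau> = r\<^sup>2 * n\<^sup>2" by (simp add: \<tau>_def r(2)[symmetric])
    have sq: "sqrt (- \<tau>) = r * n" unfolding \<tau>eq using n r by (simp add: real_sqrt_mult)
    have "n\<^sup>2 \<le> 1" using n by (simp add: power_le_one)
    then have \<tau>: "t0 \<le> \<tau>" "\<tau> < 0"
      using t0_neg n by (auto simp: \<tau>_def mult_le_cancel_left1 mult_neg_pos)
    have early: "\<bar>u t x - v t x\<bar> \<le> K * n" if "t0 \<le> t" "t \<le> \<tau>" for t x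
    proof -
      have "\<bar>u t x - v t x\<bar> \<le> 2 * C * n ^ 4 / sqrt (- t) ^ 3"
        by (rule viscous_early[OF C(2) _ sol]) (use C that \<tau> in auto)
      also have "\<dots> \<le> 2 * C * n ^ 4 / sqrt (- \<tau>) ^ 3"
        using that \<tau> C n by (intro divide_left_mono power_mono mult_pos_pos) auto
      also have "\<dots> = K * n" unfolding sq using n r by (simp add: K_def field_simps power_numeral_reduce)
      finally show ?thesis .
    qed
    \<comment> \<open>The reference \<open>w\<close> is \<open>v t\<close> before \<tau> and the
      transported frozen profile after it. In both cases its slope is controlled by
      \<open>1 / |\<tau>|\<close>, unlike that of \<open>v t\<close> close to the shock.\<close>
    have *: "\<exists>w. (\<forall>x. \<bar>u t x - w x\<bar> \<le> A * exp 2 * n) \<and> (\<forall>x. \<bar>w x - v t x\<bar> \<le> 2 * C * r * n)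
       \<and> (\<forall>x. w x - w (x + n ^ 3) \<le> 1 / r\<^sup>2 * n)"
    proof (cases "t \<le> \<tau>")
      case True
      have "\<bar>u t x - v t x\<bar> \<le> A * exp 2 * n" for x
      proof -
        have "K * n \<le> A * exp 2 * n" using K AE n by (intro mult_right_mono) auto
        then show ?thesis using early[of t x] True t by auto
      qed
      moreover have "v t x - v t (x + n ^ 3) \<le> 1 / r\<^sup>2 * n" for x
      proof -
        have "v t x - v t (x + n ^ 3) \<le> n ^ 3 / (- t)" using v_drop[OF t] n by auto
        also have "\<dots> \<le> n ^ 3 / (- \<tau>)" using True \<tau> t n by (intro divide_left_mono) (auto simp: mult_neg_neg)
        also have "\<dots> = 1 / r\<^sup>2 * n" unfolding \<tau>eq using n by (simp add: field_simps power_numeral_reduce)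
        finally show ?thesis .
      qed
      ultimately show ?thesis using C r n by (intro exI[of _ "v t"]) auto
    next
      case False
      let ?w = "\<lambda>x. v \<tau> (x - f x0 * (t - \<tau>))"
      have \<tau>': "\<tau> \<in> {t0..<0}" using \<tau> by auto
      have "\<bar>u t x - ?w x\<bar> \<le> (A * n) * exp 2" for x
      proof (rule viscous_late[OF C(2,3) sol _ \<tau>])
        show "\<bar>u \<tau> x - v \<tau> x\<bar> \<le> A * n" for x
        proof -
          have "K * n \<le> A * n" using K n by (intro mult_right_mono) auto
          then show ?thesis using early[of \<tau> x] \<tau> by auto
        qed
        have "(C / sqrt (- \<tau>) + n ^ 4 * (C / sqrt (- \<tau>) ^ 5)) * (- \<tau>) = (C * r + C / r ^ 3) * n"
          unfolding sq unfolding \<tau>eq using n r by (simp add: field_simps power_numeral_reduce)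
        also have "\<dots> \<le> A * n" using K n by (intro mult_right_mono) (auto simp: A_def)
        finally show "(C / sqrt (- \<tau>) + n ^ 4 * (C / sqrt (- \<tau>) ^ 5)) * (- \<tau>) \<le> A * n" .
      qed (use False t n in auto)
      moreover have "\<bar>?w x - v t x\<bar> \<le> 2 * C * r * n" for x
        using v_moving_frame[OF C(3) \<tau>(1), of t "x - f x0 * (t - \<tau>)"] False t C(1)
        unfolding sq by (simp add: abs_minus_commute mult.assoc)
      moreover have "?w x - ?w (x + n ^ 3) \<le> 1 / r\<^sup>2 * n" for x
      proof -
        have "?w x - ?w (x + n ^ 3) \<le> n ^ 3 / (- \<tau>)"
          using v_drop[OF \<tau>', of "n ^ 3" "x - f x0 * (t - \<tau>)"] n by (simp add: algebra_simps)
        also have "\<dots> = 1 / r\<^sup>2 * n" unfolding \<tau>eq using n by (simp add: field_simps power_numeral_reduce)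
        finally show ?thesis .
      qed
      ultimately show ?thesis by (intro exI[of _ ?w]) (simp add: mult_ac)
    qed
    then obtain w where w: "\<And>x. \<bar>u t x - w x\<bar> \<le> A * exp 2 * n" "\<And>x. \<bar>w x - v t x\<bar> \<le> 2 * C * r * n"
       "\<And>x. w x - w (x + n ^ 3) \<le> 1 / r\<^sup>2 * n" by blast
    have "A * exp 2 * n \<ge> 0" "2 * C * r * n \<ge> 0" "1 / r\<^sup>2 * n \<ge> 0" "n \<ge> 0"
      using pos n by (auto intro!: mult_nonneg_nonneg)
    moreover have "C' * n = n + 2 * (A * exp 2 * n) + 2 * C * r * n + 1 / r\<^sup>2 * n" by (simp add: C'_def algebra_simps)
    ultimately show ?thesis using w(1)[of x] w(1)[of "x + n ^ 3"] w(2)[of x] w(3)[of x] unfolding abs_le_iff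
      by linarith
  qed
  moreover have "C' \<ge> 1" using pos by (simp add: C'_def)
  ultimately show ?thesis by blast
qed

section \<open>Lower bound of order \<open>\<nu> powr (1/4)\<close>\<close>

text \<open>Third-order expansion at \<open>x0\<close>, where \<open>f2\<close> vanishes; repeated
  mean values give the remainder without the factor 1/6.\<close>

lemma f_cubic:
  assumes "z > 0" shows "f (x0 + z) - f x0 \<le> z / t0 + B3 * z ^ 3"
proof -
  obtain a where a: "x0 < a" "a < x0 + z" "f (x0 + z) - f x0 = (x0 + z - x0) * f1 a"
    using MVT2[of x0 "x0 + z" f f1] f_derivs(1) assms by auto
  obtain b where b: "x0 < b" "b < a" "f1 a - f1 x0 = (a - x0) * f2 b"
    using MVT2[of x0 a f1 f2] f_derivs(2) a by auto
  obtain d where d: "f2 b - f2 x0 = (b - x0) * f3 d"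
    using MVT2[of x0 b f2 f3] f_derivs(3) b by auto
  have "f2 b \<le> (b - x0) * B3"
    using d f2_x0 abs_le_D1[OF f_bounds(8)[of d]] b by (simp add: mult_left_mono)
  also have "\<dots> \<le> z * B3" using a b f_bounds(4) by (intro mult_right_mono) auto
  finally have "(a - x0) * f2 b \<le> (a - x0) * (z * B3)" using a by (intro mult_left_mono) auto
  also have "\<dots> \<le> z * (z * B3)" using a assms f_bounds(4) by (intro mult_right_mono) auto
  finally have "f1 a \<le> 1 / t0 + z * (z * B3)" using b f1_x0 by simp
  then have "z * f1 a \<le> z * (1 / t0 + z * (z * B3))" using assms by (intro mult_left_mono) auto
  then show ?thesis using a(3) by (simp add: algebra_simps power3_eq_cube)
qed

text \<open>Two characteristics, starting at \<open>x0\<close> and at distance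
  \<open>z = \<theta> * n\<close>, are followed until their distance is of order \<open>z^3\<close>.
  Then \<open>v\<close> drops by order \<open>z\<close> between them, while the barrier bound lets
  \<open>u\<close> drop only by order \<open>\<theta>^3 * n\<close>. For small fixed \<theta> the
  error at one of the two points must be large.\<close>

lemma viscous_lower:
  "\<exists>C\<ge>1. \<forall>n\<in>{0<..1}. \<forall>u. viscous_burgers_solution (n ^ 4) t0 f u \<longrightarrow>
    (\<exists>t\<in>{t0<..<0}. \<exists>x. n / C \<le> \<bar>u t x - v t x\<bar>)"
proof -
  obtain C where C: "C \<ge> 1" "\<And>n u t x. n \<in> {0<..1} \<Longrightarrow> viscous_burgers_solution (n ^ 4) t0 f u \<Longrightarrow>
      t \<in> {t0..<0} \<Longrightarrow> u t x - u t (x + n ^ 3) \<le> C * n"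
    using viscous_upper by blast
  \<comment> \<open>\<open>C\<close> controls the drop at the outer edge and \<open>B1\<close> the
    drop of the data. Being at least 1 gives \<open>2 * \<kappa> / (1 + \<kappa>) >= 1\<close>, the
    room lost when \<open>1 - exp (- z)\<close> is replaced by \<open>z / (1 + z)\<close>.\<close>
  define \<kappa> where "\<kappa> = C + B1"
  have \<kappa>: "\<kappa> \<ge> 1" "\<kappa> \<ge> C" "\<kappa> \<ge> B1" using C f_bounds(2) by (auto simp: \<kappa>_def)
  define G where "G = 1 - t0 * B3"
  have G: "G \<ge> 1" using t0_neg f_bounds(4) by (simp add: G_def mult_nonpos_nonneg)
  define S where "S = B3 + 2 * \<kappa>\<^sup>2 * G"
  have S: "S \<ge> 0" using f_bounds(4) G by (simp add: S_def)
  \<comment> \<open>\<theta> is the inverse of \<open>H\<close>. The summand \<open>G\<close>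
    ensures that the two points stay within \<open>n^3\<close> of each other; the last summand
    ensures that the cubic terms collected in \<open>S\<close> consume at most half of the linear
    drop of \<open>v\<close>; the 1 makes \<theta> at most 1.\<close>
  define H where "H = 1 + G + 2 * (- t0) * S"
  have "2 * (- t0) * S \<ge> 0" using S t0_neg by (intro mult_nonneg_nonneg) auto
  then have H: "H \<ge> 1" "H \<ge> G" "H \<ge> 2 * (- t0) * S" unfolding H_def using G by linarith+
  define \<theta> where "\<theta> = 1 / H"
  have \<theta>: "0 < \<theta>" "\<theta> \<le> 1" using H by (auto simp: \<theta>_def)
  have \<theta>G: "G * \<theta> ^ 3 \<le> 1"
  proof -
    have "\<theta> ^ 3 \<le> \<theta>" using \<theta> power_decreasing[of 1 3 \<theta>] by simp
    then have "G * \<theta> ^ 3 \<le> G * \<theta>" using G by (intro mult_left_mono) auto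
    also have "\<dots> \<le> 1" using H by (simp add: \<theta>_def)
    finally show ?thesis .
  qed
  have \<theta>S: "S * \<theta>\<^sup>2 \<le> 1 / (2 * (- t0))"
  proof -
    have "\<theta>\<^sup>2 \<le> \<theta>" using \<theta> by (simp add: power2_eq_square mult_left_le)
    then have "S * \<theta>\<^sup>2 \<le> S * \<theta>" using S by (intro mult_left_mono) auto
    also have "\<dots> \<le> 1 / (2 * (- t0))" using H t0_neg unfolding \<theta>_def by (simp add: field_simps)
    finally show ?thesis .
  qed
  define C' where "C' = 1 + 4 * (- t0) / \<theta>"
  have C': "C' \<ge> 1" using t0_neg \<theta> by (simp add: C'_def divide_nonpos_pos)
  have "\<exists>t\<in>{t0<..<0}. \<exists>x. n / C' \<le> \<bar>u t x - v t x\<bar>"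
    if n: "n \<in> {0<..1}" and sol: "viscous_burgers_solution (n ^ 4) t0 f u" for n u
  proof -
    \<comment> \<open>The barrier then has height of order \<open>\<nu> * k = \<kappa> * n\<close>
      and slope of order \<open>\<nu> * k^2 = \<kappa>^2 / n^2\<close>, matched to a strip of width
      \<open>n^3\<close>.\<close>
    define k where "k = \<kappa> / n ^ 3"
    have k: "k > 0" "k * n ^ 3 = \<kappa>" using \<kappa> n by (auto simp: k_def)
    have n1: "n > 0" "n \<le> 1" using n by auto
    have \<nu>k: "n ^ 4 * k = \<kappa> * n" "n ^ 4 * k\<^sup>2 = \<kappa>\<^sup>2 / n\<^sup>2"
      using n1 by (auto simp: k_def field_simps power_numeral_reduce)
    have frac: "1 - exp (- z) \<ge> z / (1 + z)" if "z \<ge> 0" for z :: real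
    proof -
      have "exp (- z) \<le> 1 / (1 + z)"
        using exp_ge_add_one_self[of z] that by (simp add: exp_minus inverse_eq_divide frac_le)
      then show ?thesis using that by (simp add: field_simps)
    qed
    have drop: "u t x - u t y \<le> 2 * n ^ 4 * k\<^sup>2 * (y - x)"
      if t: "t \<in> {t0..<0}" and xy: "x \<le> y" "y \<le> x + n ^ 3" for t x y
    proof (rule viscous_burgers_drop_bound[OF sol, of k "n ^ 3" t])
      fix x y :: real assume xy: "x \<le> y" "y \<le> x + n ^ 3"
      have "\<bar>f y - f x\<bar> \<le> B1 * \<bar>y - x\<bar>"
        using field_differentiable_bound[of UNIV f f1 B1 y x] f_derivs(1) f_bounds(6) by auto
      then have "f x - f y \<le> B1 * (y - x)" using xy by auto
      also have "\<dots> \<le> \<kappa> / n\<^sup>2 * (y - x)"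
      proof (rule mult_right_mono)
        have "\<kappa> \<le> \<kappa> / n\<^sup>2" using n1 \<kappa> by (simp add: pos_le_divide_eq power_le_one mult_left_le)
        then show "B1 \<le> \<kappa> / n\<^sup>2" using \<kappa> by linarith
      qed (use xy in auto)
      also have "\<dots> \<le> (2 * \<kappa> / (1 + \<kappa>)) * (\<kappa> / n\<^sup>2 * (y - x))"
      proof -
        have "1 \<le> 2 * \<kappa> / (1 + \<kappa>)" using \<kappa> by (simp add: field_simps)
        moreover have "0 \<le> \<kappa> / n\<^sup>2 * (y - x)" using \<kappa> xy by simp
        ultimately show ?thesis by (metis mult_1 mult_right_mono)
      qed
      also have "\<dots> = 2 * n ^ 4 * k * (k * (y - x) / (1 + \<kappa>))"
      proof -
        have "(2 * \<kappa> / (1 + \<kappa>)) * (\<kappa> / n\<^sup>2 * (y - x)) = 2 * (\<kappa>\<^sup>2 / n\<^sup>2) * ((y - x) / (1 + \<kappa>))"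
          by (simp add: power2_eq_square mult_ac)
        also have "\<dots> = 2 * n ^ 4 * k * (k * (y - x) / (1 + \<kappa>))"
          unfolding \<nu>k(2)[symmetric] by (simp add: power2_eq_square)
        finally show ?thesis .
      qed
      also have "\<dots> \<le> 2 * n ^ 4 * k * (k * (y - x) / (1 + k * (y - x)))"
      proof -
        have "k * (y - x) \<le> k * n ^ 3" using k xy by (intro mult_left_mono) auto
        then show ?thesis using k xy n1 by (intro mult_left_mono divide_left_mono mult_pos_pos) (auto simp: add_pos_nonneg)
      qed
      also have "\<dots> \<le> 2 * n ^ 4 * k * (1 - exp (- k * (y - x)))"
        using frac[of "k * (y - x)"] k xy n1 by (intro mult_left_mono) auto
      finally show "f x - f y \<le> 2 * n ^ 4 * k * (1 - exp (- k * (y - x)))" .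
    next
      fix s x assume s: "s \<in> {t0..t}"
      have "u s x - u s (x + n ^ 3) \<le> C * n" using C(2)[OF n sol] s t by auto
      also have "\<dots> \<le> \<kappa> * n" using \<kappa> n1 by (intro mult_right_mono) auto
      also have "\<dots> \<le> 2 * (\<kappa> * n) * (\<kappa> / (1 + \<kappa>))" using \<kappa> n1 by (simp add: field_simps)
      also have "\<dots> \<le> 2 * (\<kappa> * n) * (1 - exp (- \<kappa>))" using frac[of \<kappa>] \<kappa> n1 by (intro mult_left_mono) auto
      finally show "u s x - u s (x + n ^ 3) \<le> 2 * n ^ 4 * k * (1 - exp (- k * n ^ 3))"
        using \<nu>k(1) k(2) by (simp add: mult.assoc)
    qed (use n1 k t xy in auto)
    define z where "z = \<theta> * n"
    have z: "z > 0" "z \<le> 1" "z \<le> \<theta>" using \<theta> n1 by (auto simp: z_def mult_le_one mult_left_le)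
    \<comment> \<open>At this time the linear part \<open>z * (t / t0)\<close> of the separation is
      \<open>z^3 / 2\<close>, comparable to the cubic remainder. The half, with
      \<open>z <= 1\<close>, keeps \<open>t\<close> strictly after \<open>t0\<close>.\<close>
    define t where "t = t0 * z\<^sup>2 / 2"
    have z2: "z\<^sup>2 > 0" "z\<^sup>2 \<le> 1" using z by (auto simp: power_le_one)
    have t: "t0 < t" "t < 0" using t0_neg z2
      by (auto simp: t_def mult_neg_pos)
    have tt: "t \<in> {t0..<0}" using t by auto
    define x y where "x = X t x0" "y = X t (x0 + z)"
    have vxy: "v t x = f x0" "v t y = f (x0 + z)"
      using Y_X[OF \<Omega>_time[OF tt]] by (auto simp: v_def x_y_def)
    have cub: "f (x0 + z) - f x0 \<le> z / t0 + B3 * z ^ 3" by (rule f_cubic[OF z(1)])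
    have "x < y" unfolding x_y_def
      by (rule DERIV_pos_imp_increasing[where f = "X t"]) (use z X_deriv P_pos[OF \<Omega>_time[OF tt]] in auto)
    have "y - x = z + (t - t0) * (f (x0 + z) - f x0)" by (simp add: x_y_def X_def algebra_simps)
    also have "\<dots> \<le> z + (t - t0) * (z / t0 + B3 * z ^ 3)"
      using cub t by (intro add_left_mono mult_left_mono) auto
    also have "\<dots> = z * (t / t0) + (t - t0) * (B3 * z ^ 3)" using t0_neg by (simp add: field_simps)
    also have "\<dots> \<le> z ^ 3 + (- t0) * (B3 * z ^ 3)"
    proof (rule add_mono)
      have "z * (t / t0) = z ^ 3 / 2" using t0_neg by (simp add: t_def power_numeral_reduce)
      also have "\<dots> \<le> z ^ 3" using z by simp
      finally show "z * (t / t0) \<le> z ^ 3" .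
      show "(t - t0) * (B3 * z ^ 3) \<le> (- t0) * (B3 * z ^ 3)"
        using t z f_bounds(4) by (intro mult_right_mono) auto
    qed
    also have "\<dots> = G * z ^ 3" by (simp add: G_def algebra_simps)
    finally have dist: "y - x \<le> G * z ^ 3" .
    have "G * z ^ 3 = (G * \<theta> ^ 3) * n ^ 3" by (simp add: z_def power_mult_distrib)
    also have "\<dots> \<le> 1 * n ^ 3" using \<theta>G n1 by (intro mult_right_mono) auto
    finally have yx: "y \<le> x + n ^ 3" using dist by simp
    have "u t x - u t y \<le> 2 * n ^ 4 * k\<^sup>2 * (y - x)" by (rule drop) (use tt \<open>x < y\<close> yx in auto)
    also have "\<dots> \<le> 2 * n ^ 4 * k\<^sup>2 * (G * z ^ 3)" using dist n1 by (intro mult_left_mono) auto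
    also have "\<dots> = 2 * (n ^ 4 * k\<^sup>2) * (G * z ^ 3)" by simp
    also have "\<dots> = 2 * \<kappa>\<^sup>2 * G * \<theta> ^ 3 * n"
      unfolding \<nu>k using n1 by (simp add: z_def power_mult_distrib field_simps power_numeral_reduce)
    finally have ud: "u t x - u t y \<le> 2 * \<kappa>\<^sup>2 * G * \<theta> ^ 3 * n" .
    have "B3 * z ^ 3 \<le> B3 * \<theta> ^ 3 * n"
    proof -
      have "n ^ 3 \<le> n" using n1 power_decreasing[of 1 3 n] by simp
      then have "B3 * \<theta> ^ 3 * n ^ 3 \<le> B3 * \<theta> ^ 3 * n" using \<theta> f_bounds(4) by (intro mult_left_mono) auto
      then show ?thesis by (simp add: z_def power_mult_distrib)
    qed
    then have vd: "v t x - v t y \<ge> \<theta> * n / (- t0) - B3 * \<theta> ^ 3 * n"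
      using cub by (simp add: vxy z_def)
    have "2 * \<kappa>\<^sup>2 * G * \<theta> ^ 3 * n + B3 * \<theta> ^ 3 * n = (S * \<theta>\<^sup>2) * (\<theta> * n)"
      by (simp add: S_def algebra_simps power_numeral_reduce)
    also have "\<dots> \<le> 1 / (2 * (- t0)) * (\<theta> * n)" using \<theta>S \<theta> n1 by (intro mult_right_mono) auto
    finally have SS: "2 * \<kappa>\<^sup>2 * G * \<theta> ^ 3 * n + B3 * \<theta> ^ 3 * n \<le> 1 / (2 * (- t0)) * (\<theta> * n)" .
    \<comment> \<open>A quarter of the linear drop of \<open>v\<close>. The two drops differ by at
      least \<open>2 * q\<close>, so the error is at least \<open>q\<close> at one of the two
      points.\<close>
    define q where "q = \<theta> * n / (4 * (- t0))"
    have "1 / (2 * (- t0)) * (\<theta> * n) = 2 * q" "\<theta> * n / (- t0) = 4 * q" using t0_neg by (auto simp: q_def)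
    then have "2 * q \<le> (v t x - v t y) - (u t x - u t y)" using ud vd SS by linarith
    then have or: "q \<le> \<bar>u t x - v t x\<bar> \<or> q \<le> \<bar>u t y - v t y\<bar>" by linarith
    have "n / C' \<le> n / (4 * (- t0) / \<theta>)"
      using n1 t0_neg \<theta> C' by (intro divide_left_mono mult_pos_pos) (auto simp: C'_def divide_neg_pos)
    also have "\<dots> = q" by (simp add: q_def)
    finally have nq: "n / C' \<le> q" .
    from or show ?thesis
    proof
      assume "q \<le> \<bar>u t x - v t x\<bar>"
      then show ?thesis using nq t by (intro bexI[of _ t] exI[of _ x]) auto
    next
      assume "q \<le> \<bar>u t y - v t y\<bar>"
      then show ?thesis using nq t by (intro bexI[of _ t] exI[of _ y]) auto
    qed
  qed
  then show ?thesis using C' by blast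
qed

end

section \<open>Weak-strong uniqueness\<close>

lemma smooth_poly: "smooth (poly p)"
proof -
  have "(deriv ^^ n) (poly p) = poly ((pderiv ^^ n) p)" for n
  proof (induction n)
    case (Suc n)
    have "deriv (poly r) = poly (pderiv r)" for r :: "real poly"
      by (intro ext DERIV_imp_deriv poly_DERIV)
    then show ?case using Suc by simp
  qed simp
  then show ?thesis
    unfolding smooth_def by (metis poly_DERIV real_differentiable_def)
qed

text \<open>One family contains every pair needed: the square, multiples of the identity of either
  sign (\<open>a = 0\<close>), and constant entropies or fluxes of either sign.\<close>

lemma entropy_pair_quadratic:
  assumes "a \<ge> 0"
  shows "entropy_pair (\<lambda>w. a * w\<^sup>2 / 2 + b * w + k) (\<lambda>w. a * w ^ 3 / 3 + b * w\<^sup>2 / 2 + d)"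
proof -
  let ?\<eta> = "\<lambda>w. a * w\<^sup>2 / 2 + b * w + k"
  have D: "(?\<eta> has_real_derivative a * w + b) (at w)" for w
    by (auto intro!: derivative_eq_intros)
  have "?\<eta> = poly [:k, b, a / 2:]" by (simp add: fun_eq_iff power2_eq_square algebra_simps)
  then have "smooth ?\<eta>" by (simp add: smooth_poly)
  moreover have "convex_on UNIV ?\<eta>"
  proof (rule f''_ge0_imp_convex)
    show "((\<lambda>w. a * w + b) has_real_derivative a) (at w)" for w
      by (auto intro!: derivative_eq_intros)
  qed (use D assms in auto)
  moreover have "((\<lambda>w. a * w ^ 3 / 3 + b * w\<^sup>2 / 2 + d) has_real_derivative w * deriv ?\<eta> w) (at w)" for w
    unfolding DERIV_imp_deriv[OF D]
    by (auto intro!: derivative_eq_intros simp: power2_eq_square algebra_simps)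
  ultimately show ?thesis unfolding entropy_pair_def by blast
qed

text \<open>The complement of the support set is open and \<open>\<phi>\<close> vanishes on it, so
  both partial derivatives vanish there too; this gives integrability of the weak form.\<close>

lemma test_function_support:
  assumes "test_function \<phi> \<phi>\<^sub>t \<phi>\<^sub>x"
  obtains K where "compact K" "\<And>t x. (t, x) \<notin> K \<Longrightarrow> \<phi> t x = 0 \<and> \<phi>\<^sub>t t x = 0 \<and> \<phi>\<^sub>x t x = 0"
proof -
  obtain K where K: "compact K" "\<And>t x. (t, x) \<notin> K \<Longrightarrow> \<phi> t x = 0"
    using assms unfolding test_function_def by blast
  have D: "((\<lambda>s. \<phi> s x) has_real_derivative \<phi>\<^sub>t t x) (at t)" "(\<phi> t has_real_derivative \<phi>\<^sub>x t x) (at x)" for t x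
    using assms unfolding test_function_def by blast+
  have "\<phi> t x = 0 \<and> \<phi>\<^sub>t t x = 0 \<and> \<phi>\<^sub>x t x = 0" if "(t, x) \<notin> K" for t x
  proof -
    have o: "open (- K)" using K(1) by (simp add: compact_imp_closed open_Compl)
    have o1: "open ((\<lambda>s. (s, x)) -` (- K))" and o2: "open ((\<lambda>y. (t, y)) -` (- K))"
      by (intro continuous_open_vimage o continuous_intros)+
    have "((\<lambda>s. \<phi> s x) has_real_derivative 0) (at t)"
      by (rule has_field_derivative_transform_within_open[OF DERIV_const[of 0] o1]) (use K(2) that in auto)
    moreover have "(\<phi> t has_real_derivative 0) (at x)"
      by (rule has_field_derivative_transform_within_open[OF DERIV_const[of 0] o2]) (use K(2) that in auto)
    ultimately show ?thesis using D K(2)[OF that] DERIV_unique by blast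
  qed
  with K(1) show ?thesis by (rule that)
qed

text \<open>The factor \<open>w\<close> is controlled only for times in \<open>J\<close>. Since
  \<open>\<phi>\<close> vanishes outside the closed interval \<open>{a..b}\<close> inside
  \<open>J\<close>, the product and its derivatives vanish there, and the two open time sets cover
  the plane.\<close>

lemma test_function_mult:
  assumes \<phi>: "test_function \<phi> \<phi>\<^sub>t \<phi>\<^sub>x" and cont: "continuous_on UNIV (\<lambda>(t, x). \<phi> t x)"
    and supp: "\<And>t x. t \<notin> {a..b} \<Longrightarrow> \<phi> t x = 0"
    and J: "open J" "{a..b} \<subseteq> J"
    and w: "\<And>t x. t \<in> J \<Longrightarrow> ((\<lambda>s. w s x) has_real_derivative w\<^sub>t t x) (at t)"
      "\<And>t x. t \<in> J \<Longrightarrow> (w t has_real_derivative w\<^sub>x t x) (at x)"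
      "\<And>t x. t \<in> J \<Longrightarrow> w t x \<ge> 0"
      "continuous_on (J \<times> UNIV) (\<lambda>(t, x). w t x)" "continuous_on (J \<times> UNIV) (\<lambda>(t, x). w\<^sub>t t x)"
      "continuous_on (J \<times> UNIV) (\<lambda>(t, x). w\<^sub>x t x)"
  shows "test_function (\<lambda>t x. \<phi> t x * w t x) (\<lambda>t x. \<phi>\<^sub>t t x * w t x + \<phi> t x * w\<^sub>t t x)
    (\<lambda>t x. \<phi>\<^sub>x t x * w t x + \<phi> t x * w\<^sub>x t x)"
proof -
  have \<phi>D: "((\<lambda>s. \<phi> s x) has_real_derivative \<phi>\<^sub>t t x) (at t)" "(\<phi> t has_real_derivative \<phi>\<^sub>x t x) (at x)"
    "\<phi> t x \<ge> 0" for t x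
    using \<phi> unfolding test_function_def by blast+
  have \<phi>c: "continuous_on UNIV (\<lambda>(t, x). \<phi>\<^sub>t t x)" "continuous_on UNIV (\<lambda>(t, x). \<phi>\<^sub>x t x)"
    using \<phi> unfolding test_function_def by blast+
  have o: "open (- {a..b})" by auto
  have z: "((\<lambda>s. \<phi> s x) has_real_derivative 0) (at t)" "(\<phi> t has_real_derivative 0) (at x)"
    "((\<lambda>s. \<phi> s x * w s x) has_real_derivative 0) (at t)" "((\<lambda>x. \<phi> t x * w t x) has_real_derivative 0) (at x)"
    if t: "t \<notin> {a..b}" for t x
  proof -
    show "((\<lambda>s. \<phi> s x) has_real_derivative 0) (at t)" "((\<lambda>s. \<phi> s x * w s x) has_real_derivative 0) (at t)"
      by (rule has_field_derivative_transform_within_open[OF DERIV_const[of 0] o]; use t supp in auto)+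
    have "\<phi> t = (\<lambda>_. 0)" using supp[OF t] by auto
    then show "(\<phi> t has_real_derivative 0) (at x)" "((\<lambda>x. \<phi> t x * w t x) has_real_derivative 0) (at x)" by auto
  qed
  have \<phi>0: "\<phi>\<^sub>t t x = 0" "\<phi>\<^sub>x t x = 0" if "t \<notin> {a..b}" for t x
    using z(1,2)[OF that, of x] \<phi>D(1,2)[of x t] \<phi>D(1,2)[of t x] DERIV_unique by blast+
  have glue: "continuous_on UNIV (\<lambda>(t, x). \<alpha> t x * w t x + \<phi> t x * \<gamma> t x)"
    if "continuous_on UNIV (\<lambda>(t, x). \<alpha> t x)" "continuous_on (J \<times> UNIV) (\<lambda>(t, x). \<gamma> t x)"
      "\<And>t x. t \<notin> {a..b} \<Longrightarrow> \<alpha> t x = 0" for \<alpha> \<gamma> :: "real \<Rightarrow> real \<Rightarrow> real"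
  proof -
    have "continuous_on (J \<times> UNIV) (\<lambda>(t, x). \<alpha> t x * w t x + \<phi> t x * \<gamma> t x)"
      using continuous_on_subset[OF that(1), of "J \<times> UNIV"] continuous_on_subset[OF cont, of "J \<times> UNIV"] w(4) that(2)
      unfolding case_prod_unfold by (intro continuous_intros) auto
    moreover have "continuous_on ((- {a..b}) \<times> UNIV) (\<lambda>(t, x). \<alpha> t x * w t x + \<phi> t x * \<gamma> t x)"
      by (rule continuous_on_eq[where f = "\<lambda>_. 0"]) (auto simp: that(3) supp)
    ultimately have "continuous_on (J \<times> UNIV \<union> (- {a..b}) \<times> UNIV) (\<lambda>(t, x). \<alpha> t x * w t x + \<phi> t x * \<gamma> t x)"
      by (intro continuous_on_open_Un open_Times J o) auto
    moreover have "J \<times> UNIV \<union> (- {a..b}) \<times> UNIV = (UNIV :: (real \<times> real) set)" using J(2) by auto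
    ultimately show ?thesis by simp
  qed
  show ?thesis unfolding test_function_def
  proof (intro conjI allI)
    show "0 \<le> \<phi> t x * w t x" for t x
    proof (cases "t \<in> J")
      case False
      then have "t \<notin> {a..b}" using J(2) by auto
      then show ?thesis using supp[of t x] by simp
    qed (use \<phi>D(3)[of t x] w(3)[of t x] in simp)
    obtain K where "compact K" "\<forall>t x. (t, x) \<notin> K \<longrightarrow> \<phi> t x = 0"
      using \<phi> unfolding test_function_def by blast
    then show "\<exists>K. compact K \<and> (\<forall>t x. (t, x) \<notin> K \<longrightarrow> \<phi> t x * w t x = 0)" by auto
    show "((\<lambda>s. \<phi> s x * w s x) has_real_derivative \<phi>\<^sub>t t x * w t x + \<phi> t x * w\<^sub>t t x) (at t)" for t x
    proof (cases "t \<in> J")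
      case True
      show ?thesis using DERIV_mult[OF \<phi>D(1) w(1)[OF True]] by (simp add: mult.commute add.commute)
    next
      case False
      then have "t \<notin> {a..b}" using J(2) by auto
      then show ?thesis using z(3)[of t x] \<phi>0[of t x] supp[of t x] by simp
    qed
    show "((\<lambda>x. \<phi> t x * w t x) has_real_derivative \<phi>\<^sub>x t x * w t x + \<phi> t x * w\<^sub>x t x) (at x)" for t x
    proof (cases "t \<in> J")
      case True
      show ?thesis using DERIV_mult[OF \<phi>D(2) w(2)[OF True]] by (simp add: mult.commute add.commute)
    next
      case False
      then have "t \<notin> {a..b}" using J(2) by auto
      then show ?thesis using z(4)[of t x] \<phi>0[of t x] supp[of t x] by simp
    qed
  qed (intro glue \<phi>c w \<phi>0; assumption)+
qed

lemma bounded_on_compact_support: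
  fixes g :: "'a::topological_space \<Rightarrow> real"
  assumes "compact K" "continuous_on UNIV g"
  obtains B where "B \<ge> 0" "\<And>x. x \<in> K \<Longrightarrow> \<bar>g x\<bar> \<le> B"
proof -
  have "compact (g ` K)" by (intro compact_continuous_image continuous_on_subset[OF assms(2)] assms(1)) auto
  then obtain B where "\<forall>z\<in>g ` K. norm z \<le> B" using compact_imp_bounded bounded_iff by metis
  then show ?thesis by (intro that[of "\<bar>B\<bar>"]) force+
qed

lemma integrable_bounded_times_compact_support:
  fixes u \<psi> :: "real \<Rightarrow> real \<Rightarrow> real" and h :: "real \<Rightarrow> real"
  assumes S: "S \<in> sets lebesgue"
    and u: "(\<lambda>(t, x). u t x) \<in> borel_measurable (lebesgue_on S)" "AE (t, x) in lebesgue_on S. \<bar>u t x\<bar> \<le> M"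
    and h: "continuous_on UNIV h"
    and \<psi>: "continuous_on UNIV (\<lambda>(t, x). \<psi> t x)" and K: "compact K" "\<And>t x. (t, x) \<notin> K \<Longrightarrow> \<psi> t x = 0"
  shows "integrable (lebesgue_on S) (\<lambda>(t, x). h (u t x) * \<psi> t x)"
proof -
  obtain H where H: "H \<ge> 0" "\<And>w. w \<in> {-M..M} \<Longrightarrow> \<bar>h w\<bar> \<le> H"
    using bounded_on_compact_support[OF compact_Icc h] by metis
  obtain B where B: "B \<ge> 0" "\<And>z. z \<in> K \<Longrightarrow> \<bar>(\<lambda>(t, x). \<psi> t x) z\<bar> \<le> B"
    using bounded_on_compact_support[OF K(1) \<psi>] by metis
  have hm: "h \<in> borel_measurable borel" using h by (rule borel_measurable_continuous_onI)
  have \<psi>m: "(\<lambda>(t, x). \<psi> t x) \<in> borel_measurable (lebesgue_on S)"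
    using borel_measurable_continuous_onI[OF \<psi>]
    by (intro measurable_restrict_space1 measurable_completion) simp
  have Km: "K \<in> sets lebesgue" using K(1) by (simp add: borel_compact sets_completionI_sets)
  show ?thesis
  proof (rule integrableI_bounded_set[where A = "K \<inter> S" and B = "H * B"])
    show "K \<inter> S \<in> sets (lebesgue_on S)" using Km S by (simp add: sets_restrict_space_iff)
    show "(\<lambda>(t, x). h (u t x) * \<psi> t x) \<in> borel_measurable (lebesgue_on S)"
      using borel_measurable_times[OF measurable_compose[OF u(1) hm] \<psi>m]
      by (simp add: case_prod_unfold)
    have "emeasure (lebesgue_on S) (K \<inter> S) = emeasure lebesgue (K \<inter> S)"
      using S Km by (simp add: emeasure_restrict_space)
    also have "\<dots> \<le> emeasure lebesgue K" using Km by (intro emeasure_mono) auto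
    also have "\<dots> < \<infinity>" using emeasure_compact_finite[OF K(1)] K(1) by (simp add: borel_compact emeasure_completion)
    finally show "emeasure (lebesgue_on S) (K \<inter> S) < \<infinity>" .
    show "AE z in lebesgue_on S. z \<in> K \<inter> S \<longrightarrow> norm ((\<lambda>(t, x). h (u t x) * \<psi> t x) z) \<le> H * B"
      using u(2)
    proof eventually_elim
      case (elim z)
      obtain t x where z: "z = (t, x)" by (cases z)
      show ?case
        using elim H(2)[of "u t x"] B(2)[of z] H(1) by (auto simp: z abs_mult abs_le_iff intro!: mult_mono)
    qed
    show "AE z in lebesgue_on S. z \<notin> K \<inter> S \<longrightarrow> (\<lambda>(t, x). h (u t x) * \<psi> t x) z = 0"
      by (rule AE_I2) (use K(2) in \<open>auto simp: space_restrict_space\<close>)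
  qed
qed

lemma integrable_continuous_compact_support:
  fixes g :: "real \<Rightarrow> real"
  assumes "continuous_on UNIV g" "compact K" "\<And>x. x \<notin> K \<Longrightarrow> g x = 0"
  shows "integrable lebesgue g"
proof -
  have "integrable lborel (\<lambda>x. indicator K x *\<^sub>R g x)"
    by (rule borel_integrable_compact[OF assms(2) continuous_on_subset[OF assms(1)]]) auto
  moreover have "(\<lambda>x. indicator K x *\<^sub>R g x) = g" using assms(3) by (auto simp: indicator_def fun_eq_iff)
  ultimately show ?thesis
    using integrable_completion[of g lborel] by (simp add: borel_measurable_integrable)
qed

text \<open>Squaring makes the positive part continuously differentiable, so it can serve as a
  cutoff.\<close>

lemma square_positive_part_deriv:
  "((\<lambda>r. (max 0 r)\<^sup>2) has_real_derivative 2 * max 0 r) (at (r::real))"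
proof (cases r "0::real" rule: linorder_cases)
  case less
  show ?thesis
    by (rule has_field_derivative_transform_within_open[where f = "\<lambda>_. 0" and S = "{..<0}"]) (use less in auto)
next
  case greater
  show ?thesis
    by (rule has_field_derivative_transform_within_open[where f = "\<lambda>r. r\<^sup>2" and S = "{0<..}"])
      (use greater in \<open>auto intro!: derivative_eq_intros\<close>)
next
  case equal
  have "((\<lambda>h. (max 0 h)\<^sup>2 / h) \<longlongrightarrow> 0) (at (0::real))"
  proof (rule Lim_null_comparison)
    show "\<forall>\<^sub>F h in at 0. norm ((max 0 h)\<^sup>2 / h) \<le> \<bar>h::real\<bar>"
      by (intro always_eventually) (auto simp: max_def power2_eq_square)
    show "((\<lambda>h. \<bar>h::real\<bar>) \<longlongrightarrow> 0) (at 0)" by (intro tendsto_rabs_zero tendsto_ident_at)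
  qed
  then show ?thesis using equal by (simp add: has_field_derivative_iff)
qed

section \<open>Backward cone cutoff and the relative entropy argument\<close>

context burgers_data begin

context
  fixes K T :: real
begin

text \<open>
  A test function decreasing along all speeds up to \<open>K\<close>, supported in a cone with tip at time \<open>T\<close>;
  the quadratic term with coefficient \<open>cq\<close> switches it off before time \<open>t0 - \<delta> / 2\<close>, where \<open>v\<close> need not exist.
\<close>

definition cq where "cq = 4 * K * (T - t0) / \<delta>\<^sup>2 + 2 * K / \<delta> + 1"
text \<open>\<open>sqrt (1 + x^2)\<close> replaces \<open>|x|\<close> smoothly with slope at most 1
  in absolute value; the leading 1 puts the tip of the cone at \<open>x = 0\<close>.\<close>

definition \<rho> where "\<rho> t x = 1 + K * (T - t) - cq * (max 0 (t0 - t))\<^sup>2 - sqrt (1 + x\<^sup>2)"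
text \<open>Decay rate chosen to beat the compression: up to time \<open>T\<close> the slope
  \<open>vx\<close> is at least \<open>1 / T\<close>, so \<open>\<Lambda> + vx\<close> is at least
  1.\<close>

definition \<Lambda> where "\<Lambda> = 1 - 1 / T"
definition \<phi> where "\<phi> t x = exp (- \<Lambda> * t) * (max 0 (\<rho> t x))\<^sup>2"
definition \<phi>t where "\<phi>t t x = exp (- \<Lambda> * t) * (2 * max 0 (\<rho> t x) * (- K + 2 * cq * max 0 (t0 - t)) - \<Lambda> * (max 0 (\<rho> t x))\<^sup>2)"
definition \<phi>x where "\<phi>x t x = exp (- \<Lambda> * t) * (2 * max 0 (\<rho> t x) * (- (x / sqrt (1 + x\<^sup>2))))"

context
  assumes K: "K \<ge> 0" and T: "t0 < T" "T < 0"
begin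

lemma one_plus_sq_pos: "1 + x\<^sup>2 > (0::real)" by (simp add: add_pos_nonneg)

text \<open>If \<open>s = t0 - t\<close> is at least \<open>\<delta> / 2\<close>, the first summand
  of \<open>cq\<close> makes \<open>cq * s^2\<close> exceed \<open>K * (T - t0)\<close> and the
  second makes it exceed \<open>K * s\<close>, together cancelling
  \<open>K * (T - t)\<close>.\<close>

lemma \<rho>_pos_time:
  assumes "\<rho> t x > 0" shows "t \<in> {t0 - \<delta> / 2..T}" "\<bar>x\<bar> \<le> 1 + K * (T - t)"
proof -
  have s1: "sqrt (1 + x\<^sup>2) \<ge> 1" by simp
  have cq: "cq \<ge> 0" using K T \<delta>_pos by (simp add: cq_def)
  have *: "K * (T - t) - cq * (max 0 (t0 - t))\<^sup>2 > 0" using assms s1 unfolding \<rho>_def by linarith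
  moreover have "cq * (max 0 (t0 - t))\<^sup>2 \<ge> 0" using cq by simp
  ultimately have "K * (T - t) > 0" by linarith
  then have tT: "t < T" using K by (simp add: zero_less_mult_iff)
  have "t \<ge> t0 - \<delta> / 2"
  proof (rule ccontr)
    assume "\<not> ?thesis"
    then have s: "t0 - t \<ge> \<delta> / 2" by simp
    define s where "s = t0 - t"
    have s: "s \<ge> \<delta> / 2" "s > 0" using s \<delta>_pos by (auto simp: s_def)
    have "s\<^sup>2 \<ge> (\<delta> / 2)\<^sup>2" using s \<delta>_pos by (intro power_mono) auto
    then have "4 * K * (T - t0) / \<delta>\<^sup>2 * s\<^sup>2 \<ge> 4 * K * (T - t0) / \<delta>\<^sup>2 * (\<delta> / 2)\<^sup>2"
      using K T by (intro mult_left_mono) auto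
    also have "4 * K * (T - t0) / \<delta>\<^sup>2 * (\<delta> / 2)\<^sup>2 = K * (T - t0)" using \<delta>_pos by (simp add: power_divide)
    finally have 1: "4 * K * (T - t0) / \<delta>\<^sup>2 * s\<^sup>2 \<ge> K * (T - t0)" .
    have "2 * K / \<delta> * s * s \<ge> 2 * K / \<delta> * s * (\<delta> / 2)"
      using K s \<delta>_pos by (intro mult_left_mono) auto
    also have "2 * K / \<delta> * s * (\<delta> / 2) = K * s" using \<delta>_pos by simp
    finally have 2: "2 * K / \<delta> * s\<^sup>2 \<ge> K * s" by (simp add: power2_eq_square)
    have "K * (T - t0) + K * s \<le> 4 * K * (T - t0) / \<delta>\<^sup>2 * s\<^sup>2 + 2 * K / \<delta> * s\<^sup>2"
      by (rule add_mono[OF 1 2])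
    also have "\<dots> \<le> 4 * K * (T - t0) / \<delta>\<^sup>2 * s\<^sup>2 + 2 * K / \<delta> * s\<^sup>2 + s\<^sup>2" by simp
    also have "\<dots> = cq * s\<^sup>2" by (simp add: cq_def distrib_right)
    finally have "cq * s\<^sup>2 \<ge> K * (T - t0) + K * s" .
    then show False using * s by (simp add: s_def max_def algebra_simps split: if_splits)
  qed
  then show "t \<in> {t0 - \<delta> / 2..T}" using tT by auto
  have "\<bar>x\<bar> \<le> sqrt (1 + x\<^sup>2)" by (rule real_le_rsqrt) simp
  also have "\<dots> \<le> 1 + K * (T - t)" using assms \<open>cq * (max 0 (t0 - t))\<^sup>2 \<ge> 0\<close> by (simp add: \<rho>_def)
  finally show "\<bar>x\<bar> \<le> 1 + K * (T - t)" .
qed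

lemma \<phi>_cont: "continuous_on UNIV (\<lambda>(t, x). \<phi> t x)" "continuous_on UNIV (\<lambda>(t, x). \<phi>t t x)"
  "continuous_on UNIV (\<lambda>(t, x). \<phi>x t x)"
proof -
  have nz: "sqrt (1 + x\<^sup>2) \<noteq> 0" for x :: real using one_plus_sq_pos[of x] by simp
  show "continuous_on UNIV (\<lambda>(t, x). \<phi> t x)" "continuous_on UNIV (\<lambda>(t, x). \<phi>t t x)"
    "continuous_on UNIV (\<lambda>(t, x). \<phi>x t x)"
    unfolding \<phi>_def \<phi>t_def \<phi>x_def \<rho>_def case_prod_unfold
    by (intro continuous_intros ballI nz)+
qed

lemma \<phi>_supp: "t \<notin> {t0 - \<delta> / 2..T} \<Longrightarrow> \<phi> t x = 0"
  using \<rho>_pos_time(1)[of t x] by (cases "\<rho> t x > 0") (auto simp: \<phi>_def max_def)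

lemma \<phi>_test: "test_function \<phi> \<phi>t \<phi>x"
  unfolding test_function_def
proof (intro conjI allI)
  show "0 \<le> \<phi> t x" for t x by (simp add: \<phi>_def)
  define R where "R = 1 + K * (T - (t0 - \<delta> / 2))"
  have "\<phi> t x = 0" if n: "(t, x) \<notin> {t0 - \<delta> / 2..T} \<times> {-R..R}" for t x
  proof (cases "\<rho> t x > 0")
    case True
    note \<rho>_pos_time[OF this]
    moreover have "K * (T - t) \<le> K * (T - (t0 - \<delta> / 2))"
      using \<rho>_pos_time(1)[OF True] K by (intro mult_left_mono) auto
    ultimately show ?thesis using n by (auto simp: R_def)
  qed (auto simp: \<phi>_def max_def)
  then show "\<exists>C. compact C \<and> (\<forall>t x. (t, x) \<notin> C \<longrightarrow> \<phi> t x = 0)"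
    by (intro exI[of _ "{t0 - \<delta> / 2..T} \<times> {-R..R}"]) (auto intro: compact_Times)
  show "((\<lambda>s. \<phi> s x) has_real_derivative \<phi>t t x) (at t)" for t x
  proof -
    have 1: "((\<lambda>s. (max 0 (t0 - s))\<^sup>2) has_real_derivative 2 * max 0 (t0 - t) * (-1)) (at t)"
      by (rule DERIV_chain2[OF square_positive_part_deriv]) (auto intro!: derivative_eq_intros)
    have "((\<lambda>s. \<rho> s x) has_real_derivative - K + 2 * cq * max 0 (t0 - t)) (at t)"
      unfolding \<rho>_def
      by (rule DERIV_cong[OF DERIV_diff[OF DERIV_diff[OF DERIV_add[OF DERIV_const
            DERIV_cmult[OF DERIV_diff[OF DERIV_const DERIV_ident]]] DERIV_cmult[OF 1]] DERIV_const]]) simp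
    then have "((\<lambda>s. (max 0 (\<rho> s x))\<^sup>2) has_real_derivative 2 * max 0 (\<rho> t x) * (- K + 2 * cq * max 0 (t0 - t))) (at t)"
      by (rule DERIV_chain2[OF square_positive_part_deriv])
    moreover have "((\<lambda>s. exp (- \<Lambda> * s)) has_real_derivative exp (- \<Lambda> * t) * - \<Lambda>) (at t)"
      by (auto intro!: derivative_eq_intros)
    ultimately show ?thesis unfolding \<phi>_def \<phi>t_def
      by (intro DERIV_cong[OF DERIV_mult]) (auto simp: algebra_simps)
  qed
  show "(\<phi> t has_real_derivative \<phi>x t x) (at x)" for t x
  proof -
    have "((\<lambda>x. \<rho> t x) has_real_derivative - (x / sqrt (1 + x\<^sup>2))) (at x)"
      unfolding \<rho>_def using one_plus_sq_pos[of x] by (auto intro!: derivative_eq_intros simp: divide_simps)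
    then have "((\<lambda>x. (max 0 (\<rho> t x))\<^sup>2) has_real_derivative 2 * max 0 (\<rho> t x) * (- (x / sqrt (1 + x\<^sup>2)))) (at x)"
      by (rule DERIV_chain2[OF square_positive_part_deriv])
    from DERIV_cmult[OF this, of "exp (- \<Lambda> * t)"]
    show ?thesis unfolding \<phi>_def[abs_def] \<phi>x_def by simp
  qed
qed (rule \<phi>_cont)+

lemma \<phi>_mult_test:
  assumes w: "\<And>t x. t \<in> {t0 - \<delta><..<0} \<Longrightarrow> ((\<lambda>s. w s x) has_real_derivative w\<^sub>t t x) (at t)"
      "\<And>t x. t \<in> {t0 - \<delta><..<0} \<Longrightarrow> (w t has_real_derivative w\<^sub>x t x) (at x)"
      "\<And>t x. t \<in> {t0 - \<delta><..<0} \<Longrightarrow> w t x \<ge> 0"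
      "continuous_on \<Omega> (\<lambda>(t, x). w t x)" "continuous_on \<Omega> (\<lambda>(t, x). w\<^sub>t t x)"
      "continuous_on \<Omega> (\<lambda>(t, x). w\<^sub>x t x)"
  shows "test_function (\<lambda>t x. \<phi> t x * w t x) (\<lambda>t x. \<phi>t t x * w t x + \<phi> t x * w\<^sub>t t x)
    (\<lambda>t x. \<phi>x t x * w t x + \<phi> t x * w\<^sub>x t x)"
  by (rule test_function_mult[OF \<phi>_test \<phi>_cont(1), where a = "t0 - \<delta> / 2" and b = T and J = "{t0 - \<delta><..<0}"];
      (rule \<phi>_supp w)?; use T \<delta>_pos in auto)

text \<open>The cone shrinks with speed \<open>K\<close>, so transport at speed \<open>s\<close>
  does not increase its weight; the quadratic switch is inactive from \<open>t0\<close> on, and the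
  exponential factor absorbs \<open>- vx\<close> with one unit to spare.\<close>

lemma \<phi>_decay:
  assumes t: "t \<ge> t0" and s: "\<bar>s\<bar> \<le> K"
  shows "\<phi>t t x + s * \<phi>x t x - vx t x * \<phi> t x \<le> - \<phi> t x"
proof (cases "\<rho> t x > 0")
  case True
  have t': "t \<in> {t0..<0}" "t \<le> T" using \<rho>_pos_time(1)[OF True] t T by auto
  have "1 / T \<le> 1 / t" using t' T by (simp add: field_simps)
  then have \<Lambda>: "\<Lambda> + vx t x \<ge> 1" using vx_ge[OF t'(1), of x] by (simp add: \<Lambda>_def)
  define y where "y = x / sqrt (1 + x\<^sup>2)"
  have "\<bar>x\<bar> \<le> sqrt (1 + x\<^sup>2)" by (rule real_le_rsqrt) simp
  then have "\<bar>y\<bar> \<le> 1" using one_plus_sq_pos[of x] by (simp add: y_def abs_divide)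
  then have "\<bar>s * y\<bar> \<le> K * 1" unfolding abs_mult using s by (intro mult_mono) auto
  then have "2 * \<rho> t x * (- K - s * y) \<le> 0" using True by (intro mult_nonneg_nonpos) auto
  moreover have "(\<Lambda> + vx t x) * (\<rho> t x)\<^sup>2 \<ge> 1 * (\<rho> t x)\<^sup>2" using \<Lambda> by (intro mult_right_mono) auto
  ultimately have "2 * \<rho> t x * (- K - s * y) - (\<Lambda> + vx t x) * (\<rho> t x)\<^sup>2 \<le> - (\<rho> t x)\<^sup>2" by linarith
  then have "exp (- \<Lambda> * t) * (2 * \<rho> t x * (- K - s * y) - (\<Lambda> + vx t x) * (\<rho> t x)\<^sup>2) \<le> exp (- \<Lambda> * t) * - (\<rho> t x)\<^sup>2"
    by (intro mult_left_mono) auto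
  moreover have "\<phi>t t x + s * \<phi>x t x - vx t x * \<phi> t x = exp (- \<Lambda> * t) * (2 * \<rho> t x * (- K - s * y) - (\<Lambda> + vx t x) * (\<rho> t x)\<^sup>2)"
    using True t unfolding \<phi>t_def \<phi>x_def \<phi>_def y_def[symmetric] by (simp add: algebra_simps)
  ultimately show ?thesis using True by (simp add: \<phi>_def)
qed (auto simp: \<phi>_def \<phi>t_def \<phi>x_def max_def)


text \<open>Relative entropy: \<open>(u - v)^2 / 2\<close> is transported with speed
  \<open>(2 * u + v) / 3\<close>, and \<open>K\<close> bounds this speed. Tested with the cone
  weight, its total is forced to be zero because the data coincide.\<close>

lemma relative_entropy_zero:
  assumes sol: "burgers_entropy_solution t0 f u"
    and bdd: "AE (t, x) in lebesgue_on ({t0..} \<times> UNIV). \<bar>u t x\<bar> \<le> M" and KM: "K \<ge> (2 * M + B0) / 3"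
  shows "AE (t, x) in lebesgue_on ({t0..} \<times> UNIV). \<rho> t x > 0 \<longrightarrow> u t x = v t x"
proof -
  define S :: "(real \<times> real) set" where "S = {t0..} \<times> UNIV"
  have S: "S \<in> sets lebesgue" unfolding S_def by (intro sets_completionI_sets) (simp add: borel_closed closed_Times)
  have um: "(\<lambda>(t, x). u t x) \<in> borel_measurable (lebesgue_on S)"
    using sol unfolding burgers_entropy_solution_def S_def by blast
  note bdd = bdd[folded S_def]
  have int: "integrable (lebesgue_on S) (\<lambda>(t, x). \<eta> (u t x) * \<psi>\<^sub>t t x + q (u t x) * \<psi>\<^sub>x t x)"
    if \<psi>: "test_function \<psi> \<psi>\<^sub>t \<psi>\<^sub>x" and \<eta>: "continuous_on UNIV \<eta>" and q: "continuous_on UNIV q" for \<psi> \<psi>\<^sub>t \<psi>\<^sub>x \<eta> q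
  proof -
    obtain C where C: "compact C" "\<And>t x. (t, x) \<notin> C \<Longrightarrow> \<psi> t x = 0 \<and> \<psi>\<^sub>t t x = 0 \<and> \<psi>\<^sub>x t x = 0"
      using test_function_support[OF \<psi>] by blast
    have c: "continuous_on UNIV (\<lambda>(t, x). \<psi>\<^sub>t t x)" "continuous_on UNIV (\<lambda>(t, x). \<psi>\<^sub>x t x)"
      using \<psi> unfolding test_function_def by blast+
    have "integrable (lebesgue_on S) (\<lambda>(t, x). \<eta> (u t x) * \<psi>\<^sub>t t x)"
      by (rule integrable_bounded_times_compact_support[OF S um bdd \<eta> c(1) C(1)]) (use C(2) in blast)
    moreover have "integrable (lebesgue_on S) (\<lambda>(t, x). q (u t x) * \<psi>\<^sub>x t x)"
      by (rule integrable_bounded_times_compact_support[OF S um bdd q c(2) C(1)]) (use C(2) in blast)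
    ultimately show ?thesis unfolding case_prod_unfold by (rule Bochner_Integration.integrable_add)
  qed
  have bint: "integrable lebesgue (\<lambda>x. h x * \<psi> t0 x)"
    if \<psi>: "test_function \<psi> \<psi>\<^sub>t \<psi>\<^sub>x" and h: "continuous_on UNIV h" for \<psi> \<psi>\<^sub>t \<psi>\<^sub>x h
  proof -
    obtain C where C: "compact C" "\<And>t x. (t, x) \<notin> C \<Longrightarrow> \<psi> t x = 0"
      using \<psi> unfolding test_function_def by blast
    have "compact (snd ` C)" by (intro compact_continuous_image C continuous_intros)
    moreover have "continuous_on UNIV (\<psi> t0)"
      using \<psi> unfolding test_function_def by (intro continuous_at_imp_continuous_on) (blast intro: DERIV_isCont)
    moreover have "\<psi> t0 x = 0" if "x \<notin> snd ` C" for x using C(2)[of t0 x] that by force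
    ultimately show ?thesis using h by (intro integrable_continuous_compact_support[where K = "snd ` C"] continuous_intros) auto
  qed
  have weak: "(LINT z|lebesgue_on S. (a * (u (fst z) (snd z))\<^sup>2 / 2 + b * u (fst z) (snd z) + k) * \<psi>\<^sub>t (fst z) (snd z)
        + (a * u (fst z) (snd z) ^ 3 / 3 + b * (u (fst z) (snd z))\<^sup>2 / 2 + d) * \<psi>\<^sub>x (fst z) (snd z))
      + (LINT x|lebesgue. (a * (f x)\<^sup>2 / 2 + b * f x + k) * \<psi> t0 x) \<ge> 0
    \<and> integrable (lebesgue_on S) (\<lambda>z. (a * (u (fst z) (snd z))\<^sup>2 / 2 + b * u (fst z) (snd z) + k) * \<psi>\<^sub>t (fst z) (snd z)
        + (a * u (fst z) (snd z) ^ 3 / 3 + b * (u (fst z) (snd z))\<^sup>2 / 2 + d) * \<psi>\<^sub>x (fst z) (snd z))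
    \<and> integrable lebesgue (\<lambda>x. (a * (f x)\<^sup>2 / 2 + b * f x + k) * \<psi> t0 x)"
    if \<psi>: "test_function \<psi> \<psi>\<^sub>t \<psi>\<^sub>x" and a: "a \<ge> 0" for \<psi> \<psi>\<^sub>t \<psi>\<^sub>x a b k d
  proof (intro conjI)
    let ?\<eta> = "\<lambda>w. a * w\<^sup>2 / 2 + b * w + k" and ?q = "\<lambda>w. a * w ^ 3 / 3 + b * w\<^sup>2 / 2 + d"
    have "(LINT (t, x)|lebesgue_on ({t0..} \<times> UNIV). ?\<eta> (u t x) * \<psi>\<^sub>t t x + ?q (u t x) * \<psi>\<^sub>x t x)
      + (LINT x|lebesgue. ?\<eta> (f x) * \<psi> t0 x) \<ge> 0"
      using sol entropy_pair_quadratic[OF a, of b k d] \<psi> unfolding burgers_entropy_solution_def by blast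
    then show "(LINT z|lebesgue_on S. (a * (u (fst z) (snd z))\<^sup>2 / 2 + b * u (fst z) (snd z) + k) * \<psi>\<^sub>t (fst z) (snd z)
        + (a * u (fst z) (snd z) ^ 3 / 3 + b * (u (fst z) (snd z))\<^sup>2 / 2 + d) * \<psi>\<^sub>x (fst z) (snd z))
      + (LINT x|lebesgue. (a * (f x)\<^sup>2 / 2 + b * f x + k) * \<psi> t0 x) \<ge> 0"
      unfolding S_def case_prod_unfold .
    have "continuous_on UNIV ?\<eta>" "continuous_on UNIV ?q" by (intro continuous_intros; simp)+
    from int[OF \<psi> this] show "integrable (lebesgue_on S) (\<lambda>z. (a * (u (fst z) (snd z))\<^sup>2 / 2 + b * u (fst z) (snd z) + k) * \<psi>\<^sub>t (fst z) (snd z)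
        + (a * u (fst z) (snd z) ^ 3 / 3 + b * (u (fst z) (snd z))\<^sup>2 / 2 + d) * \<psi>\<^sub>x (fst z) (snd z))"
      unfolding case_prod_unfold .
    show "integrable lebesgue (\<lambda>x. (a * (f x)\<^sup>2 / 2 + b * f x + k) * \<psi> t0 x)"
      by (rule bint[OF \<psi>]) (intro continuous_intros f_derivs; simp)
  qed
  note vD = v_derivs(1,2)
  \<comment> \<open>Test functions must be nonnegative, so \<open>v\<close> and \<open>v^3\<close>
    are shifted by powers of their bound \<open>B0\<close>; the shifts are removed again by the
    instances \<open>W3\<close> and \<open>W6\<close>.\<close>
  have v0: "v t x + B0 \<ge> 0" "(v t x ^ 3 + B0 ^ 3) / 6 \<ge> 0" for t x
  proof -
    show 1: "v t x + B0 \<ge> 0" using v_bdd[of t x] by (simp add: abs_le_iff)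
    have "(- B0) ^ 3 \<le> v t x ^ 3" using 1 by (intro power_mono_odd) auto
    then show "(v t x ^ 3 + B0 ^ 3) / 6 \<ge> 0" by (simp add: power3_eq_cube)
  qed
  note vc = v_cont[unfolded case_prod_unfold]
  have test2: "test_function (\<lambda>t x. \<phi> t x * (v t x + B0)) (\<lambda>t x. \<phi>t t x * (v t x + B0) + \<phi> t x * vt t x)
      (\<lambda>t x. \<phi>x t x * (v t x + B0) + \<phi> t x * vx t x)"
    by (rule \<phi>_mult_test; (unfold case_prod_unfold)?; (rule v0(1))?)
      (auto intro!: derivative_eq_intros vD continuous_intros vc)
  have test4: "test_function (\<lambda>t x. \<phi> t x * ((v t x)\<^sup>2 / 2)) (\<lambda>t x. \<phi>t t x * ((v t x)\<^sup>2 / 2) + \<phi> t x * (v t x * vt t x))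
      (\<lambda>t x. \<phi>x t x * ((v t x)\<^sup>2 / 2) + \<phi> t x * (v t x * vx t x))"
    by (rule \<phi>_mult_test; (unfold case_prod_unfold)?)
      (auto intro!: derivative_eq_intros vD continuous_intros vc)
  have test5: "test_function (\<lambda>t x. \<phi> t x * ((v t x ^ 3 + B0 ^ 3) / 6)) (\<lambda>t x. \<phi>t t x * ((v t x ^ 3 + B0 ^ 3) / 6) + \<phi> t x * ((v t x)\<^sup>2 * vt t x / 2))
      (\<lambda>t x. \<phi>x t x * ((v t x ^ 3 + B0 ^ 3) / 6) + \<phi> t x * ((v t x)\<^sup>2 * vx t x / 2))"
    by (rule \<phi>_mult_test; (unfold case_prod_unfold)?; (rule v0(2))?)
      (auto intro!: derivative_eq_intros vD continuous_intros vc)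
  \<comment> \<open>\<open>W1\<close> is the square entropy and \<open>W2\<close> the cross term in
    \<open>u\<close> and \<open>v\<close>. \<open>W4\<close> and \<open>W5\<close> use a constant
    entropy and a constant flux to integrate by parts the terms in \<open>v\<close> alone.\<close>
  note W1 = weak[OF \<phi>_test, of 1 0 0 0]
  note W2 = weak[OF test2, of 0 "-1" 0 0]
  note W3 = weak[OF \<phi>_test, of 0 B0 0 0]
  note W4 = weak[OF test4, of 0 0 1 0]
  note W5 = weak[OF test5, of 0 0 0 1]
  note W6 = weak[OF \<phi>_test, of 0 0 0 "- (B0 ^ 3 / 6)"]
  \<comment> \<open>The sum of the six integrands. The flux part rests on
    \<open>2 * u^3 - 3 * u^2 * v + v^3 = (u - v)^2 * (2 * u + v)\<close>, and the last term on
    \<open>vt = - v * vx\<close>.\<close>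
  define G where "G z = (case z of (t, x) \<Rightarrow> (u t x - v t x)\<^sup>2 / 2 *
      (\<phi>t t x + (2 * u t x + v t x) / 3 * \<phi>x t x - vx t x * \<phi> t x))" for z
  have "integrable (lebesgue_on S) G \<and> 0 \<le> integral\<^sup>L (lebesgue_on S) G"
  proof -
    obtain g1 b1 g2 b2 g3 b3 g4 b4 g5 b5 g6 b6 where g:
      "g1 = (\<lambda>z. (1 * (u (fst z) (snd z))\<^sup>2 / 2 + 0 * u (fst z) (snd z) + 0) * \<phi>t (fst z) (snd z)
        + (1 * u (fst z) (snd z) ^ 3 / 3 + 0 * (u (fst z) (snd z))\<^sup>2 / 2 + 0) * \<phi>x (fst z) (snd z))"
      "b1 = (\<lambda>x. (1 * (f x)\<^sup>2 / 2 + 0 * f x + 0) * \<phi> t0 x)"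
      "g2 = (\<lambda>z. (0 * (u (fst z) (snd z))\<^sup>2 / 2 + (-1) * u (fst z) (snd z) + 0) * (\<phi>t (fst z) (snd z) * (v (fst z) (snd z) + B0) + \<phi> (fst z) (snd z) * vt (fst z) (snd z))
        + (0 * u (fst z) (snd z) ^ 3 / 3 + (-1) * (u (fst z) (snd z))\<^sup>2 / 2 + 0) * (\<phi>x (fst z) (snd z) * (v (fst z) (snd z) + B0) + \<phi> (fst z) (snd z) * vx (fst z) (snd z)))"
      "b2 = (\<lambda>x. (0 * (f x)\<^sup>2 / 2 + (-1) * f x + 0) * (\<phi> t0 x * (v t0 x + B0)))"
      "g3 = (\<lambda>z. (0 * (u (fst z) (snd z))\<^sup>2 / 2 + B0 * u (fst z) (snd z) + 0) * \<phi>t (fst z) (snd z)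
        + (0 * u (fst z) (snd z) ^ 3 / 3 + B0 * (u (fst z) (snd z))\<^sup>2 / 2 + 0) * \<phi>x (fst z) (snd z))"
      "b3 = (\<lambda>x. (0 * (f x)\<^sup>2 / 2 + B0 * f x + 0) * \<phi> t0 x)"
      "g4 = (\<lambda>z. (0 * (u (fst z) (snd z))\<^sup>2 / 2 + 0 * u (fst z) (snd z) + 1) * (\<phi>t (fst z) (snd z) * ((v (fst z) (snd z))\<^sup>2 / 2) + \<phi> (fst z) (snd z) * (v (fst z) (snd z) * vt (fst z) (snd z)))
        + (0 * u (fst z) (snd z) ^ 3 / 3 + 0 * (u (fst z) (snd z))\<^sup>2 / 2 + 0) * (\<phi>x (fst z) (snd z) * ((v (fst z) (snd z))\<^sup>2 / 2) + \<phi> (fst z) (snd z) * (v (fst z) (snd z) * vx (fst z) (snd z))))"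
      "b4 = (\<lambda>x. (0 * (f x)\<^sup>2 / 2 + 0 * f x + 1) * (\<phi> t0 x * ((v t0 x)\<^sup>2 / 2)))"
      "g5 = (\<lambda>z. (0 * (u (fst z) (snd z))\<^sup>2 / 2 + 0 * u (fst z) (snd z) + 0) * (\<phi>t (fst z) (snd z) * ((v (fst z) (snd z) ^ 3 + B0 ^ 3) / 6) + \<phi> (fst z) (snd z) * ((v (fst z) (snd z))\<^sup>2 * vt (fst z) (snd z) / 2))
        + (0 * u (fst z) (snd z) ^ 3 / 3 + 0 * (u (fst z) (snd z))\<^sup>2 / 2 + 1) * (\<phi>x (fst z) (snd z) * ((v (fst z) (snd z) ^ 3 + B0 ^ 3) / 6) + \<phi> (fst z) (snd z) * ((v (fst z) (snd z))\<^sup>2 * vx (fst z) (snd z) / 2)))"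
      "b5 = (\<lambda>x. (0 * (f x)\<^sup>2 / 2 + 0 * f x + 0) * (\<phi> t0 x * ((v t0 x ^ 3 + B0 ^ 3) / 6)))"
      "g6 = (\<lambda>z. (0 * (u (fst z) (snd z))\<^sup>2 / 2 + 0 * u (fst z) (snd z) + 0) * \<phi>t (fst z) (snd z)
        + (0 * u (fst z) (snd z) ^ 3 / 3 + 0 * (u (fst z) (snd z))\<^sup>2 / 2 + - (B0 ^ 3 / 6)) * \<phi>x (fst z) (snd z))"
      "b6 = (\<lambda>x. (0 * (f x)\<^sup>2 / 2 + 0 * f x + 0) * \<phi> t0 x)"
      by blast
    have gi: "integrable (lebesgue_on S) g1" "integrable (lebesgue_on S) g2" "integrable (lebesgue_on S) g3"
      "integrable (lebesgue_on S) g4" "integrable (lebesgue_on S) g5" "integrable (lebesgue_on S) g6"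
      and bi: "integrable lebesgue b1" "integrable lebesgue b2" "integrable lebesgue b3"
      "integrable lebesgue b4" "integrable lebesgue b5" "integrable lebesgue b6"
      and ge: "integral\<^sup>L (lebesgue_on S) g1 + integral\<^sup>L lebesgue b1 \<ge> 0"
      "integral\<^sup>L (lebesgue_on S) g2 + integral\<^sup>L lebesgue b2 \<ge> 0"
      "integral\<^sup>L (lebesgue_on S) g3 + integral\<^sup>L lebesgue b3 \<ge> 0"
      "integral\<^sup>L (lebesgue_on S) g4 + integral\<^sup>L lebesgue b4 \<ge> 0"
      "integral\<^sup>L (lebesgue_on S) g5 + integral\<^sup>L lebesgue b5 \<ge> 0"
      "integral\<^sup>L (lebesgue_on S) g6 + integral\<^sup>L lebesgue b6 \<ge> 0"
      unfolding g using W1 W2 W3 W4 W5 W6 by (auto simp del: mult_zero_left)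
    have G: "G = (\<lambda>z. g1 z + g2 z + g3 z + g4 z + g5 z + g6 z)"
      unfolding g G_def case_prod_unfold vt_def
      by (rule ext) (simp add: field_simps power2_eq_square power3_eq_cube)
    \<comment> \<open>The initial terms add up to zero, because \<open>v\<close> has the same data
      \<open>f\<close> at \<open>t0\<close>.\<close>
    have b: "(\<lambda>x. b1 x + b2 x + b3 x + b4 x + b5 x + b6 x) = (\<lambda>_. 0)"
      unfolding g v_t0 by (rule ext) (simp add: field_simps power2_eq_square)
    have "integral\<^sup>L (lebesgue_on S) G = integral\<^sup>L (lebesgue_on S) g1 + integral\<^sup>L (lebesgue_on S) g2 + integral\<^sup>L (lebesgue_on S) g3
      + integral\<^sup>L (lebesgue_on S) g4 + integral\<^sup>L (lebesgue_on S) g5 + integral\<^sup>L (lebesgue_on S) g6"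
      unfolding G using gi by simp
    moreover have "integral\<^sup>L lebesgue b1 + integral\<^sup>L lebesgue b2 + integral\<^sup>L lebesgue b3
      + integral\<^sup>L lebesgue b4 + integral\<^sup>L lebesgue b5 + integral\<^sup>L lebesgue b6
      = integral\<^sup>L lebesgue (\<lambda>x. b1 x + b2 x + b3 x + b4 x + b5 x + b6 x)"
      using bi by simp
    moreover have "integrable (lebesgue_on S) G" unfolding G using gi by simp
    ultimately show ?thesis using ge unfolding b by simp
  qed
  then have Gi: "integrable (lebesgue_on S) G" and Gn: "0 \<le> integral\<^sup>L (lebesgue_on S) G" by auto
  have le: "AE z in lebesgue_on S. (case z of (t, x) \<Rightarrow> (u t x - v t x)\<^sup>2 / 2 * \<phi> t x) \<le> - G z"
    using bdd AE_space
  proof eventually_elim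
    case (elim z)
    obtain t x where z: "z = (t, x)" by (cases z)
    have t: "t \<ge> t0" and u: "\<bar>u t x\<bar> \<le> M" using elim by (auto simp: z S_def space_restrict_space)
    have "\<bar>(2 * u t x + v t x) / 3\<bar> \<le> K" using u v_bdd[of t x] KM by (simp add: abs_le_iff)
    from mult_left_mono[OF \<phi>_decay[OF t this, of x], of "(u t x - v t x)\<^sup>2 / 2"]
    show ?case by (simp add: z G_def)
  qed
  \<comment> \<open>\<open>G\<close> is nonpositive almost everywhere but has nonnegative integral,
    so it vanishes almost everywhere; hence \<open>u = v\<close> where the weight is
    positive.\<close>
  have "AE z in lebesgue_on S. 0 \<le> - G z"
    using le
  proof eventually_elim
    case (elim z)
    have "0 \<le> (case z of (t, x) \<Rightarrow> (u t x - v t x)\<^sup>2 / 2 * \<phi> t x)" by (auto simp: \<phi>_def split: prod.split)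
    then show ?case using elim by linarith
  qed
  moreover from this have "0 \<le> integral\<^sup>L (lebesgue_on S) (\<lambda>z. - G z)" by (rule integral_nonneg_AE)
  ultimately have "AE z in lebesgue_on S. - G z = 0"
    using Gi Gn by (subst integral_nonneg_eq_0_iff_AE[symmetric]) auto
  with le have "AE z in lebesgue_on S. case z of (t, x) \<Rightarrow> \<rho> t x > 0 \<longrightarrow> u t x = v t x"
  proof eventually_elim
    case (elim z)
    obtain t x where z: "z = (t, x)" by (cases z)
    have "(u t x - v t x)\<^sup>2 / 2 * \<phi> t x \<le> 0" using elim by (simp add: z)
    then show ?case
      by (auto simp: z \<phi>_def mult_le_0_iff)
  qed
  then show ?thesis unfolding S_def .
qed

end

end

text \<open>Countably many cones, with speeds \<open>K + N\<close> and tips at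
  \<open>- 1 / (N + 1)\<close>, exhaust the times before 0, so the exceptional null sets can be
  united.\<close>

lemma entropy_solution_eq_v:
  assumes sol: "burgers_entropy_solution t0 f u"
  shows "AE (t, x) in lebesgue_on ({t0..} \<times> UNIV). t < 0 \<longrightarrow> u t x = v t x"
proof -
  obtain M where M: "AE (t, x) in lebesgue_on ({t0..} \<times> UNIV). \<bar>u t x\<bar> \<le> M"
    using sol unfolding burgers_entropy_solution_def by blast
  define K where "K = \<bar>(2 * M + B0) / 3\<bar>"
  define T where "T N = - 1 / (real N + 1)" for N :: nat
  have "AE z in lebesgue_on ({t0..} \<times> UNIV). \<forall>N. t0 < T N \<longrightarrow>
      (case z of (t, x) \<Rightarrow> \<rho> (K + real N) (T N) t x > 0 \<longrightarrow> u t x = v t x)"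
  proof (subst AE_all_countable, intro allI)
    fix N
    show "AE z in lebesgue_on ({t0..} \<times> UNIV). t0 < T N \<longrightarrow>
      (case z of (t, x) \<Rightarrow> \<rho> (K + real N) (T N) t x > 0 \<longrightarrow> u t x = v t x)"
    proof (cases "t0 < T N")
      case True
      have "T N < 0" by (simp add: T_def divide_neg_pos)
      then show ?thesis
        using relative_entropy_zero[OF _ True _ sol M, of "K + real N"] True by (auto simp: K_def)
    qed simp
  qed
  then show ?thesis
    using AE_space
  proof eventually_elim
    case (elim z)
    obtain t x where z: "z = (t, x)" by (cases z)
    have t0: "t \<ge> t0" using elim by (auto simp: z space_restrict_space)
    show ?case
    proof (cases "t < 0")
      case True
      \<comment> \<open>Large enough that the tip lies no earlier than \<open>t / 2\<close> and that
        \<open>N * (- t / 2)\<close> exceeds \<open>sqrt (1 + x^2)\<close>, placing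
        \<open>(t, x)\<close> inside the cone.\<close>
      obtain N :: nat where N: "real N > (2 / (- t)) * (sqrt (1 + x\<^sup>2) + 1)"
        using reals_Archimedean2 by blast
      have N0: "real N > 2 / (- t)"
      proof -
        have "2 / (- t) * 1 \<le> (2 / (- t)) * (sqrt (1 + x\<^sup>2) + 1)"
          using True by (intro mult_left_mono) auto
        then show ?thesis using N by linarith
      qed
      have TN: "T N \<ge> t / 2"
      proof -
        have "real N + 1 > 2 / (- t)" using N0 by linarith
        then have "(real N + 1) * (- t) > 2" using True by (subst (asm) pos_divide_less_eq) auto
        then have "1 / (real N + 1) \<le> - t / 2" by (simp add: field_simps)
        then show ?thesis unfolding T_def by simp
      qed
      then have "t0 < T N" using True t0 by linarith
      moreover have "\<rho> (K + real N) (T N) t x > 0"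
      proof -
        have "sqrt (1 + x\<^sup>2) + 1 < real N * (- t / 2)"
          using N True by (simp add: field_simps)
        also have "\<dots> \<le> (K + real N) * (T N - t)"
          using TN True by (intro mult_mono) (auto simp: K_def)
        finally show ?thesis using t0 by (simp add: \<rho>_def)
      qed
      ultimately show ?thesis using elim(1) by (auto simp: z)
    qed (simp add: z)
  qed
qed

end

section \<open>Norm estimates\<close>

context burgers_data begin

lemma entropy_solution_eq_v_before_shock:
  assumes "burgers_entropy_solution t0 f u"
  shows "AE z in lebesgue. z \<in> {t0..<0} \<times> UNIV \<longrightarrow> (case z of (t, x) \<Rightarrow> u t x = v t x)"
proof -
  have "{t0..} \<times> (UNIV :: real set) \<in> sets lebesgue"
    by (intro sets_completionI_sets) (simp add: borel_closed closed_Times)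
  then have "AE z in lebesgue. z \<in> {t0..} \<times> UNIV \<longrightarrow> (case z of (t, x) \<Rightarrow> t < 0 \<longrightarrow> u t x = v t x)"
    using entropy_solution_eq_v[OF assms] by (subst (asm) AE_restrict_space_iff) auto
  then show ?thesis by eventually_elim auto
qed

lemma slab_measurable: "{t0..<0} \<times> (UNIV :: real set) \<in> sets lebesgue"
proof -
  have "{t0..<0} \<times> (UNIV :: real set) \<in> sets (borel \<Otimes>\<^sub>M borel)" by (intro pair_measureI) auto
  then show ?thesis unfolding borel_prod by (intro sets_completionI_sets) (simp only: sets_lborel)
qed

lemma Linfty_le:
  assumes vis: "viscous_burgers_solution \<nu> t0 f w" and ent: "burgers_entropy_solution t0 f u"
    and le: "\<And>t x. t \<in> {t0..<0} \<Longrightarrow> \<bar>w t x - v t x\<bar> \<le> R"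
  shows "Linfty_norm ({t0..<0} \<times> UNIV) (\<lambda>t x. w t x - u t x) \<le> ereal R"
  unfolding Linfty_norm_def
proof (rule esssup_I)
  have "continuous_on ({t0..<0} \<times> UNIV) (\<lambda>(t, x). w t x)"
    using vis unfolding viscous_burgers_solution_def by (elim conjE continuous_on_subset) auto
  then have [measurable]: "(\<lambda>(t, x). w t x) \<in> borel_measurable (lebesgue_on ({t0..<0} \<times> UNIV))"
    by (rule continuous_imp_measurable_on_sets_lebesgue[OF _ slab_measurable])
  have "(\<lambda>(t, x). u t x) \<in> borel_measurable (lebesgue_on ({t0..} \<times> UNIV))"
    using ent unfolding burgers_entropy_solution_def by blast
  then have [measurable]: "(\<lambda>(t, x). u t x) \<in> borel_measurable (lebesgue_on ({t0..<0} \<times> UNIV))"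
    by (rule measurable_restrict_mono) auto
  have "(\<lambda>z. ereal \<bar>(\<lambda>(t, x). w t x) z - (\<lambda>(t, x). u t x) z\<bar>) \<in> borel_measurable (lebesgue_on ({t0..<0} \<times> UNIV))"
    by measurable
  then show "(\<lambda>(t, x). ereal \<bar>w t x - u t x\<bar>) \<in> borel_measurable (lebesgue_on ({t0..<0} \<times> UNIV))"
    by (simp add: case_prod_unfold)
  have "AE z in lebesgue. z \<in> {t0..<0} \<times> UNIV \<longrightarrow> (case z of (t, x) \<Rightarrow> ereal \<bar>w t x - u t x\<bar>) \<le> ereal R"
    using entropy_solution_eq_v_before_shock[OF ent] by eventually_elim (use le in auto)
  then show "AE z in lebesgue_on ({t0..<0} \<times> UNIV). (case z of (t, x) \<Rightarrow> ereal \<bar>w t x - u t x\<bar>) \<le> ereal R"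
    by (subst AE_restrict_space_iff) (use slab_measurable in auto)
qed

text \<open>The strict inequality at one point with \<open>t0 < t\<close> persists on a nonempty
  open set by continuity of \<open>w - v\<close>. Such a set is not null, so the essential supremum
  sees it although \<open>u\<close> equals \<open>v\<close> only almost everywhere.\<close>

lemma Linfty_ge:
  assumes vis: "viscous_burgers_solution \<nu> t0 f w" and ent: "burgers_entropy_solution t0 f u"
    and ex: "t \<in> {t0<..<0}" "R < \<bar>w t x - v t x\<bar>"
  shows "ereal R \<le> Linfty_norm ({t0..<0} \<times> UNIV) (\<lambda>t x. w t x - u t x)"
proof (rule ccontr)
  assume "\<not> ?thesis"
  then have less: "Linfty_norm ({t0..<0} \<times> UNIV) (\<lambda>t x. w t x - u t x) < ereal R" by simp
  define A :: "(real \<times> real) set" where "A = {t0<..<0} \<times> UNIV"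
  define g where "g z = (case z of (t, x) \<Rightarrow> \<bar>w t x - v t x\<bar>)" for z
  have "continuous_on A (\<lambda>(t, x). w t x)"
    using vis unfolding viscous_burgers_solution_def A_def by (elim conjE continuous_on_subset) auto
  moreover have "continuous_on A (\<lambda>(t, x). v t x)"
    by (rule continuous_on_subset[OF v_cont(1)]) (use \<delta>_pos in \<open>auto simp: A_def\<close>)
  ultimately have "continuous_on A g"
    unfolding g_def case_prod_unfold by (intro continuous_intros)
  moreover have "open A" unfolding A_def by (intro open_Times) auto
  ultimately have op: "open (A \<inter> g -` {R<..})" by (rule continuous_open_preimage) auto
  have "(t, x) \<in> A \<inter> g -` {R<..}" using ex by (simp add: A_def g_def)
  then have "\<not> negligible (A \<inter> g -` {R<..})" using open_not_negligible[OF op] by auto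
  moreover have "A \<inter> g -` {R<..} \<in> null_sets lebesgue"
  proof (subst AE_iff_null_sets)
    show "A \<inter> g -` {R<..} \<in> sets lebesgue" using op by (intro sets_completionI_sets) (simp add: borel_open)
    have "AE z in lebesgue. z \<in> {t0..<0} \<times> UNIV \<longrightarrow>
        (case z of (t, x) \<Rightarrow> ereal \<bar>w t x - u t x\<bar>) \<le> Linfty_norm ({t0..<0} \<times> UNIV) (\<lambda>t x. w t x - u t x)"
      unfolding Linfty_norm_def
      using esssup_AE[of "\<lambda>(t, x). ereal \<bar>w t x - u t x\<bar>" "lebesgue_on ({t0..<0} \<times> UNIV)"]
      by (subst (asm) AE_restrict_space_iff) (use slab_measurable in auto)
    with entropy_solution_eq_v_before_shock[OF ent]
    show "AE z in lebesgue. z \<notin> A \<inter> g -` {R<..}"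
    proof eventually_elim
      case (elim z)
      obtain t x where z: "z = (t, x)" by (cases z)
      show ?case
      proof
        assume "z \<in> A \<inter> g -` {R<..}"
        then have t: "t0 < t" "t < 0" and R: "R < \<bar>w t x - v t x\<bar>" by (auto simp: z A_def g_def)
        have "u t x = v t x" using elim(1) t by (simp add: z)
        then have "ereal \<bar>w t x - v t x\<bar> \<le> Linfty_norm ({t0..<0} \<times> UNIV) (\<lambda>t x. w t x - u t x)"
          using elim(2) t by (simp add: z)
        then have "ereal \<bar>w t x - v t x\<bar> < ereal R" using less by (rule le_less_trans)
        then show False using R by simp
      qed
    qed
  qed
  ultimately show False by (simp add: negligible_iff_null_sets)
qed

end

theorem corollary1p2:
  fixes u_init :: "real \<Rightarrow> real" and c L x\<^sub>0 t\<^sub>0 :: real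
  assumes H1: "smooth u_init"
    and H2: "L > 0" "\<And>x. x \<notin> {-L..L} \<Longrightarrow> u_init x = c"
    and H3: "deriv u_init x\<^sub>0 < 0"
            "\<And>x. deriv u_init x\<^sub>0 \<le> deriv u_init x"
            "\<And>x. deriv u_init x = deriv u_init x\<^sub>0 \<Longrightarrow> x = x\<^sub>0"
    and H4: "(deriv ^^ 3) u_init x\<^sub>0 > 0"
    and t0: "t\<^sub>0 = 1 / deriv u_init x\<^sub>0"
  shows "\<exists>C\<ge>1. \<forall>\<nu>\<in>{0<..1}. \<forall>u\<nu> u0.
      viscous_burgers_solution \<nu> t\<^sub>0 u_init u\<nu> \<longrightarrow>
      burgers_entropy_solution t\<^sub>0 u_init u0 \<longrightarrow>
        ereal (inverse C * \<nu> powr (1/4))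
          \<le> Linfty_norm ({t\<^sub>0..<0} \<times> UNIV) (\<lambda>t x. u\<nu> t x - u0 t x) \<and>
        Linfty_norm ({t\<^sub>0..<0} \<times> UNIV) (\<lambda>t x. u\<nu> t x - u0 t x)
          \<le> ereal (C * \<nu> powr (1/4))"
proof -
  interpret burgers_data u_init c L x\<^sub>0 t\<^sub>0
    by unfold_locales (fact H1 H2 H3 H4 t0)+
  obtain Cu where Cu: "Cu \<ge> 1" "\<And>n u t x. n \<in> {0<..1} \<Longrightarrow> viscous_burgers_solution (n ^ 4) t\<^sub>0 u_init u \<Longrightarrow>
      t \<in> {t\<^sub>0..<0} \<Longrightarrow> \<bar>u t x - v t x\<bar> \<le> Cu * n"
    using viscous_upper by blast
  obtain Cl where Cl: "Cl \<ge> 1" "\<And>n u. n \<in> {0<..1} \<Longrightarrow> viscous_burgers_solution (n ^ 4) t\<^sub>0 u_init u \<Longrightarrow>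
      \<exists>t\<in>{t\<^sub>0<..<0}. \<exists>x. n / Cl \<le> \<bar>u t x - v t x\<bar>"
    using viscous_lower by blast
  \<comment> \<open>The sum rather than the maximum makes \<open>n / C\<close> strictly smaller than
    \<open>n / Cl\<close>, as \<open>Linfty_ge\<close> requires.\<close>
  define C where "C = Cu + Cl"
  have "ereal (inverse C * \<nu> powr (1/4))
          \<le> Linfty_norm ({t\<^sub>0..<0} \<times> UNIV) (\<lambda>t x. u\<nu> t x - u0 t x) \<and>
        Linfty_norm ({t\<^sub>0..<0} \<times> UNIV) (\<lambda>t x. u\<nu> t x - u0 t x)
          \<le> ereal (C * \<nu> powr (1/4))"
    if \<nu>: "\<nu> \<in> {0<..1}" and vis: "viscous_burgers_solution \<nu> t\<^sub>0 u_init u\<nu>"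
      and ent: "burgers_entropy_solution t\<^sub>0 u_init u0" for \<nu> u\<nu> u0
  proof
    define n where "n = \<nu> powr (1/4)"
    have "n ^ 4 = \<nu>" using \<nu> by (simp add: n_def powr_realpow[symmetric] powr_powr)
    then have vis': "viscous_burgers_solution (n ^ 4) t\<^sub>0 u_init u\<nu>" using vis by simp
    have n: "n \<in> {0<..1}" using \<nu> by (auto simp: n_def powr_le1)
    obtain t x where tx: "t \<in> {t\<^sub>0<..<0}" "n / Cl \<le> \<bar>u\<nu> t x - v t x\<bar>" using Cl(2)[OF n vis'] by blast
    have "n / C < n / Cl" using n Cu(1) Cl(1) by (intro divide_strict_left_mono) (auto simp: C_def)
    then have "n / C < \<bar>u\<nu> t x - v t x\<bar>" using tx(2) by linarith
    then have "inverse C * n < \<bar>u\<nu> t x - v t x\<bar>" by (simp only: divide_inverse mult.commute)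
    from Linfty_ge[OF vis ent tx(1) this]
    show "ereal (inverse C * \<nu> powr (1/4)) \<le> Linfty_norm ({t\<^sub>0..<0} \<times> UNIV) (\<lambda>t x. u\<nu> t x - u0 t x)"
      unfolding n_def .
    have "\<bar>u\<nu> t x - v t x\<bar> \<le> C * n" if "t \<in> {t\<^sub>0..<0}" for t x
    proof -
      have "Cu * n \<le> C * n" using n Cl(1) by (intro mult_right_mono) (auto simp: C_def)
      then show ?thesis using Cu(2)[OF n vis' that, of x] by linarith
    qed
    from Linfty_le[OF vis ent this]
    show "Linfty_norm ({t\<^sub>0..<0} \<times> UNIV) (\<lambda>t x. u\<nu> t x - u0 t x) \<le> ereal (C * \<nu> powr (1/4))"
      unfolding n_def .
  qed
  moreover have "C \<ge> 1" using Cu(1) Cl(1) by (simp add: C_def)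
  ultimately show ?thesis by blast
qed

end
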